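(* Let $A_1$ and $A_2$ be C*-algebras and let $C_1$ and $C_2$ be masas of $A_1$ and $A_2$, respectively, such that $C_1$ has the extension property and $C_2$ contains an approximate identity for $A_2$ if $A_2$ is not unital. Then $C_1\otimes C_2$ is a masa of $A_1\otimes_\beta A_2$ for any C*-norm $\beta$ on the algebraic tensor product $A_1\odot A_2$. Moreover, $C_1\otimes C_2$ has the extension property (relative to $A_1\otimes_\beta A_2$) if and only if $C_2$ does (relative to $A_2$).
   Context: A masa of a C*-algebra $A$ is a maximal abelian self-adjoint C*-subalgebra of $A$. A masa $C$ of a C*-algebra $A$ has the extension property if (i) every pure state (i.e. character) of $C$ has a unique pure state extension to $A$, and (ii) when $A$ is non-unital, no pure state of $A$ annihilates $C$ (equivalently, $C$ contains an increasing approximate identity for $A$). For a C*-norm $\beta$ on $A_1\odot A_2$, $A_1\otimes_\beta A_2$ denotes the completion of $A_1\odot A_2$ with respect to $\beta$. $C_1\otimes C_2$ denotes the closure of $C_1\odot C_2$ in $A_1\otimes_\beta A_2$; since $C_1$ and $C_2$ are abelian, this closure is naturally isomorphic to the minimal C*-tensor product $C_1\otimes_{min}C_2$. *)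

theory Defs
  imports "HOL-Analysis.Analysis"
begin

section \<open>Complex *-algebras and C*-algebras\<close>

class complex_vector = real_vector +
  fixes scaleC :: "complex \<Rightarrow> 'a \<Rightarrow> 'a"  (infixr \<open>*\<^sub>C\<close> 75)
  assumes scaleC_add_right: "c *\<^sub>C (x + y) = c *\<^sub>C x + c *\<^sub>C y"
    and scaleC_add_left: "(c + d) *\<^sub>C x = c *\<^sub>C x + d *\<^sub>C x"
    and scaleC_scaleC: "c *\<^sub>C d *\<^sub>C x = (c * d) *\<^sub>C x"
    and scaleC_of_real: "complex_of_real r *\<^sub>C x = r *\<^sub>R x"

global_interpretation complex_vector: vector_space "scaleC :: complex \<Rightarrow> 'a \<Rightarrow> 'a::complex_vector"
  defines csubspace = complex_vector.subspace
    and cspan = complex_vector.span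
proof unfold_locales
  show "1 *\<^sub>C x = x" for x :: 'a
    using scaleC_of_real[of 1 x] by simp
qed (simp_all add: scaleC_add_right scaleC_add_left scaleC_scaleC)

abbreviation clinear :: "('a::complex_vector \<Rightarrow> 'b::complex_vector) \<Rightarrow> bool"
  where "clinear \<equiv> Vector_Spaces.linear scaleC scaleC"

definition cbilinear :: "('a::complex_vector \<Rightarrow> 'b::complex_vector \<Rightarrow> 'c::complex_vector) \<Rightarrow> bool"
  where "cbilinear \<Phi> \<longleftrightarrow> (\<forall>b. clinear (\<lambda>a. \<Phi> a b)) \<and> (\<forall>a. clinear (\<lambda>b. \<Phi> a b))"

text \<open>Algebras are not assumed to have a unit.\<close>

class complex_star_algebra = complex_vector + ring +
  fixes star :: "'a \<Rightarrow> 'a"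
  assumes mult_scaleC_left: "(c *\<^sub>C x) * y = c *\<^sub>C (x * y)"
    and mult_scaleC_right: "x * (c *\<^sub>C y) = c *\<^sub>C (x * y)"
    and star_add: "star (x + y) = star x + star y"
    and star_scaleC: "star (c *\<^sub>C x) = cnj c *\<^sub>C star x"
    and star_mult: "star (x * y) = star y * star x"
    and star_star: "star (star x) = x"

class cstar_algebra = complex_star_algebra + real_normed_algebra + banach +
  assumes norm_scaleC: "norm (c *\<^sub>C x) = cmod c * norm x"
    and cstar_identity: "norm (star x * x) = (norm x)\<^sup>2"

instantiation complex :: cstar_algebra
begin

definition scaleC_complex :: "complex \<Rightarrow> complex \<Rightarrow> complex"
  where "scaleC_complex c x = c * x"

definition star_complex :: "complex \<Rightarrow> complex"
  where "star_complex x = cnj x"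

instance
  by standard
    (simp_all add: scaleC_complex_def star_complex_def algebra_simps norm_mult
      power2_eq_square scaleR_conv_of_real)

end

definition unital :: "'a::times itself \<Rightarrow> bool"
  where "unital _ \<longleftrightarrow> (\<exists>u::'a. \<forall>x. u * x = x \<and> x * u = x)"


section \<open>Subalgebras, states and the extension property\<close>

definition cstar_subalgebra :: "'a::cstar_algebra set \<Rightarrow> bool"
  where "cstar_subalgebra C \<longleftrightarrow>
    csubspace C \<and> closed C \<and> (\<forall>x\<in>C. \<forall>y\<in>C. x * y \<in> C) \<and> (\<forall>x\<in>C. star x \<in> C)"

definition abelian :: "'a::times set \<Rightarrow> bool"
  where "abelian C \<longleftrightarrow> (\<forall>x\<in>C. \<forall>y\<in>C. x * y = y * x)"

definition masa :: "'a::cstar_algebra set \<Rightarrow> bool"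
  where "masa C \<longleftrightarrow> cstar_subalgebra C \<and> abelian C \<and>
    (\<forall>B. cstar_subalgebra B \<and> abelian B \<and> C \<subseteq> B \<longrightarrow> B = C)"

text \<open>
  A functional on a subalgebra \<open>C\<close> is represented by a function on the whole type of which
  only the values on \<open>C\<close> matter; a functional on the whole algebra is the case \<open>C = UNIV\<close>.
\<close>

definition linear_functional_on :: "'a::complex_vector set \<Rightarrow> ('a \<Rightarrow> complex) \<Rightarrow> bool"
  where "linear_functional_on C f \<longleftrightarrow>
    (\<forall>x\<in>C. \<forall>y\<in>C. f (x + y) = f x + f y) \<and> (\<forall>c. \<forall>x\<in>C. f (c *\<^sub>C x) = c * f x)"

definition positive_on :: "'a::cstar_algebra set \<Rightarrow> ('a \<Rightarrow> complex) \<Rightarrow> bool"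
  where "positive_on C f \<longleftrightarrow> (\<forall>x\<in>C. f (star x * x) \<in> \<real>\<^sub>\<ge>\<^sub>0)"

definition bounded_on :: "'a::cstar_algebra set \<Rightarrow> ('a \<Rightarrow> complex) \<Rightarrow> bool"
  where "bounded_on C f \<longleftrightarrow> (\<exists>K. \<forall>x\<in>C. cmod (f x) \<le> K * norm x)"

definition functional_norm_on :: "'a::cstar_algebra set \<Rightarrow> ('a \<Rightarrow> complex) \<Rightarrow> real"
  where "functional_norm_on C f = (SUP x\<in>{x\<in>C. norm x \<le> 1}. cmod (f x))"

definition state_on :: "'a::cstar_algebra set \<Rightarrow> ('a \<Rightarrow> complex) \<Rightarrow> bool"
  where "state_on C f \<longleftrightarrow>
    linear_functional_on C f \<and> positive_on C f \<and> bounded_on C f \<and> functional_norm_on C f = 1"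

text \<open>Pure states are the extreme points of the set of states.\<close>

definition pure_state_on :: "'a::cstar_algebra set \<Rightarrow> ('a \<Rightarrow> complex) \<Rightarrow> bool"
  where "pure_state_on C f \<longleftrightarrow> state_on C f \<and>
    (\<forall>g h t. state_on C g \<and> state_on C h \<and> 0 < t \<and> t < 1 \<and>
        (\<forall>x\<in>C. f x = complex_of_real t * g x + complex_of_real (1 - t) * h x) \<longrightarrow>
      (\<forall>x\<in>C. g x = f x \<and> h x = f x))"

definition extension_property :: "'a::cstar_algebra set \<Rightarrow> bool"
  where "extension_property C \<longleftrightarrow>
    (\<forall>f. pure_state_on C f \<longrightarrow> (\<exists>!g. pure_state_on UNIV g \<and> (\<forall>x\<in>C. g x = f x))) \<and>
    (\<not> unital TYPE('a) \<longrightarrow> \<not> (\<exists>g. pure_state_on UNIV g \<and> (\<forall>x\<in>C. g x = 0)))"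

text \<open>
  Nets in \<open>C\<close> are represented by proper filters concentrated on \<open>C\<close>.
\<close>

definition contains_approximate_identity :: "'a::cstar_algebra set \<Rightarrow> bool"
  where "contains_approximate_identity C \<longleftrightarrow>
    (\<exists>F::'a filter. F \<noteq> bot \<and> (\<forall>\<^sub>F e in F. e \<in> C) \<and>
      (\<forall>a. ((\<lambda>e. e * a) \<longlongrightarrow> a) F \<and> ((\<lambda>e. a * e) \<longlongrightarrow> a) F))"


section \<open>The algebraic tensor product\<close>

text \<open>
  A list of pairs stands for the sum of the corresponding elementary tensors. Two such formal
  sums are identified iff every bilinear form takes the same value on them. That this is
  the usual tensor product of complex vector spaces is the universal property
  \<open>tensor_universal\<close> below.
\<close>

definition eval_sum :: "('a \<Rightarrow> 'b \<Rightarrow> 'c::comm_monoid_add) \<Rightarrow> ('a \<times> 'b) list \<Rightarrow> 'c"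
  where "eval_sum \<Phi> ps = (\<Sum>(a, b)\<leftarrow>ps. \<Phi> a b)"

definition tensor_rel ::
    "('a::complex_vector \<times> 'b::complex_vector) list \<Rightarrow> ('a \<times> 'b) list \<Rightarrow> bool"
  where "tensor_rel ps qs \<longleftrightarrow>
    (\<forall>\<Phi> :: 'a \<Rightarrow> 'b \<Rightarrow> complex. cbilinear \<Phi> \<longrightarrow> eval_sum \<Phi> ps = eval_sum \<Phi> qs)"

lemma clinear_iff:
  "clinear f \<longleftrightarrow> (\<forall>x y. f (x + y) = f x + f y) \<and> (\<forall>c x. f (c *\<^sub>C x) = c *\<^sub>C f x)"
  by (auto simp: Vector_Spaces.linear_iff complex_vector.vector_space_axioms)

lemma cbilinear_iff:
  "cbilinear \<Phi> \<longleftrightarrow>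
    (\<forall>a a' b. \<Phi> (a + a') b = \<Phi> a b + \<Phi> a' b) \<and> (\<forall>c a b. \<Phi> (c *\<^sub>C a) b = c *\<^sub>C \<Phi> a b) \<and>
    (\<forall>a b b'. \<Phi> a (b + b') = \<Phi> a b + \<Phi> a b') \<and> (\<forall>c a b. \<Phi> a (c *\<^sub>C b) = c *\<^sub>C \<Phi> a b)"
  by (auto simp: cbilinear_def clinear_iff)

lemma eval_sum_simps [simp]:
  "eval_sum \<Phi> [] = 0"
  "eval_sum \<Phi> ((a, b) # ps) = \<Phi> a b + eval_sum \<Phi> ps"
  "eval_sum \<Phi> (ps @ qs) = eval_sum \<Phi> ps + eval_sum \<Phi> qs"
  by (simp_all add: eval_sum_def)

quotient_type (overloaded) ('a, 'b) tensor (infixr \<open>\<odot>\<close> 75) =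
  "('a::complex_vector \<times> 'b::complex_vector) list" / tensor_rel
  by (rule equivpI) (auto simp: reflp_def symp_def transp_def tensor_rel_def)

lift_definition tensor_elem :: "'a::complex_vector \<Rightarrow> 'b::complex_vector \<Rightarrow> 'a \<odot> 'b"
    (infixr \<open>\<otimes>\<close> 75)
  is "\<lambda>a b. [(a, b)]" .

definition scale_sum :: "complex \<Rightarrow> ('a::complex_vector \<times> 'b) list \<Rightarrow> ('a \<times> 'b) list"
  where "scale_sum c ps = map (\<lambda>(a, b). (c *\<^sub>C a, b)) ps"

lemma eval_sum_scale:
  fixes \<Phi> :: "'a::complex_vector \<Rightarrow> 'b::complex_vector \<Rightarrow> 'c::complex_vector"
  assumes "cbilinear \<Phi>"
  shows "eval_sum \<Phi> (scale_sum c ps) = c *\<^sub>C eval_sum \<Phi> ps"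
  using assms by (induction ps) (auto simp: scale_sum_def cbilinear_iff scaleC_add_right)

instantiation tensor :: (complex_vector, complex_vector) complex_vector
begin

lift_definition zero_tensor :: "'a \<odot> 'b" is "[]" .

lift_definition plus_tensor :: "'a \<odot> 'b \<Rightarrow> 'a \<odot> 'b \<Rightarrow> 'a \<odot> 'b" is "(@)"
  by (simp add: tensor_rel_def)

lift_definition scaleC_tensor :: "complex \<Rightarrow> 'a \<odot> 'b \<Rightarrow> 'a \<odot> 'b" is scale_sum
  by (simp add: tensor_rel_def eval_sum_scale)

definition scaleR_tensor :: "real \<Rightarrow> 'a \<odot> 'b \<Rightarrow> 'a \<odot> 'b"
  where "scaleR_tensor r x = complex_of_real r *\<^sub>C x"

definition uminus_tensor :: "'a \<odot> 'b \<Rightarrow> 'a \<odot> 'b"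
  where "uminus_tensor x = (- 1) *\<^sub>C x"

definition minus_tensor :: "'a \<odot> 'b \<Rightarrow> 'a \<odot> 'b \<Rightarrow> 'a \<odot> 'b"
  where "minus_tensor x y = x + (- 1) *\<^sub>C y"

instance
proof
  fix x y z :: "'a \<odot> 'b" and c d :: complex and r s :: real
  show "x + y + z = x + (y + z)"
    by transfer (simp add: tensor_rel_def add.assoc)
  show "x + y = y + x"
    by transfer (simp add: tensor_rel_def add.commute)
  show "0 + x = x"
    by transfer (simp add: tensor_rel_def)
  show "- x + x = 0"
    unfolding uminus_tensor_def
    by transfer (simp add: tensor_rel_def eval_sum_scale scaleC_complex_def)
  show "x - y = x + - y"
    by (simp add: minus_tensor_def uminus_tensor_def)
  show add_right: "c *\<^sub>C (x + y) = c *\<^sub>C x + c *\<^sub>C y" for c and x y :: "'a \<odot> 'b"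
    by transfer (simp add: tensor_rel_def eval_sum_scale scaleC_complex_def algebra_simps)
  show add_left: "(c + d) *\<^sub>C x = c *\<^sub>C x + d *\<^sub>C x" for c d
    by transfer (simp add: tensor_rel_def eval_sum_scale scaleC_complex_def algebra_simps)
  show scale: "c *\<^sub>C d *\<^sub>C x = (c * d) *\<^sub>C x" for c d
    by transfer (simp add: tensor_rel_def eval_sum_scale scaleC_complex_def algebra_simps)
  show "complex_of_real r *\<^sub>C x = r *\<^sub>R x"
    by (simp add: scaleR_tensor_def)
  show "r *\<^sub>R (x + y) = r *\<^sub>R x + r *\<^sub>R y"
    by (simp add: scaleR_tensor_def add_right)
  show "(r + s) *\<^sub>R x = r *\<^sub>R x + s *\<^sub>R x"
    by (simp add: scaleR_tensor_def add_left)
  show "r *\<^sub>R s *\<^sub>R x = (r * s) *\<^sub>R x"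
    by (simp add: scaleR_tensor_def scale)
  show "1 *\<^sub>R x = x"
    unfolding scaleR_tensor_def
    by transfer (simp add: tensor_rel_def eval_sum_scale scaleC_complex_def)
qed

end

lemma cbilinear_tensor_elem: "cbilinear (\<otimes>)"
  unfolding cbilinear_iff
  by (intro conjI allI; transfer)
    (simp_all add: tensor_rel_def cbilinear_iff scale_sum_def)

lemma tensor_induct [case_names zero add]:
  assumes "P 0" and "\<And>a b x. P x \<Longrightarrow> P (a \<otimes> b + x)"
  shows "P x"
proof -
  have "P (abs_tensor ps)" for ps
  proof (induction ps)
    case Nil
    then show ?case using assms(1) by (simp add: zero_tensor.abs_eq)
  next
    case (Cons p ps)
    have "abs_tensor (p # ps) = fst p \<otimes> snd p + abs_tensor ps"
      by (simp add: tensor_elem.abs_eq plus_tensor.abs_eq)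
    then show ?case using assms(2)[OF Cons] by simp
  qed
  then show ?thesis by (rule tensor.abs_induct)
qed

text \<open>Linear functionals separate the points of a complex vector space.\<close>

lemma clinear_separating:
  fixes v :: "'v::complex_vector"
  assumes "v \<noteq> 0"
  shows "\<exists>\<phi> :: 'v \<Rightarrow> complex. clinear \<phi> \<and> \<phi> v \<noteq> 0"
proof -
  interpret vp: vector_space_pair
      "scaleC :: complex \<Rightarrow> 'v \<Rightarrow> 'v" "scaleC :: complex \<Rightarrow> complex \<Rightarrow> complex" ..
  have ind: "\<not> complex_vector.dependent {v}"
    using assms by simp
  show ?thesis
    using vp.linear_construct[OF ind, of "\<lambda>_. 1"] vp.construct_basis[OF ind, of v "\<lambda>_. 1"]
    by (intro exI[of _ "vp.construct {v} (\<lambda>_. 1)"]) simp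
qed

lemma tensor_rel_eval_sum:
  fixes \<Phi> :: "'a::complex_vector \<Rightarrow> 'b::complex_vector \<Rightarrow> 'v::complex_vector"
  assumes rel: "tensor_rel ps qs" and bil: "cbilinear \<Phi>"
  shows "eval_sum \<Phi> ps = eval_sum \<Phi> qs"
proof (rule ccontr)
  assume "eval_sum \<Phi> ps \<noteq> eval_sum \<Phi> qs"
  then obtain \<phi> :: "'v \<Rightarrow> complex"
    where \<phi>: "clinear \<phi>" "\<phi> (eval_sum \<Phi> ps - eval_sum \<Phi> qs) \<noteq> 0"
    using clinear_separating[of "eval_sum \<Phi> ps - eval_sum \<Phi> qs"] by auto
  interpret \<phi>: Vector_Spaces.linear scaleC scaleC \<phi> by fact
  have ev: "\<phi> (eval_sum \<Phi> rs) = eval_sum (\<lambda>a b. \<phi> (\<Phi> a b)) rs" for rs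
    by (induction rs) (auto simp: \<phi>.add \<phi>.zero)
  have "cbilinear (\<lambda>a b. \<phi> (\<Phi> a b))"
    using bil by (simp add: cbilinear_iff \<phi>.add \<phi>.scale)
  then have "\<phi> (eval_sum \<Phi> ps) = \<phi> (eval_sum \<Phi> qs)"
    using rel by (simp add: tensor_rel_def ev)
  then show False using \<phi>(2) by (simp add: \<phi>.diff)
qed

theorem tensor_universal:
  fixes \<Phi> :: "'a::complex_vector \<Rightarrow> 'b::complex_vector \<Rightarrow> 'v::complex_vector"
  assumes bil: "cbilinear \<Phi>"
  shows "\<exists>!F :: 'a \<odot> 'b \<Rightarrow> 'v. clinear F \<and> (\<forall>a b. F (a \<otimes> b) = \<Phi> a b)"
proof (rule ex_ex1I)
  define F where "F x = eval_sum \<Phi> (rep_tensor x)" for x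
  have F_abs: "F (abs_tensor ps) = eval_sum \<Phi> ps" for ps
    unfolding F_def
    by (rule tensor_rel_eval_sum[OF _ bil])
      (simp add: tensor.abs_eq_iff[symmetric] Quotient3_abs_rep[OF Quotient3_tensor])
  have "F (x + y) = F x + F y" for x y
    by (induction x rule: tensor.abs_induct; induction y rule: tensor.abs_induct)
      (simp add: plus_tensor.abs_eq F_abs)
  moreover have "F (c *\<^sub>C x) = c *\<^sub>C F x" for c x
    by (induction x rule: tensor.abs_induct) (simp add: scaleC_tensor.abs_eq F_abs eval_sum_scale[OF bil])
  moreover have "F (a \<otimes> b) = \<Phi> a b" for a b
    by (simp add: tensor_elem.abs_eq F_abs)
  ultimately show "\<exists>F. clinear F \<and> (\<forall>a b. F (a \<otimes> b) = \<Phi> a b)"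
    by (auto simp: clinear_iff)
next
  fix F G :: "'a \<odot> 'b \<Rightarrow> 'v"
  assume F: "clinear F \<and> (\<forall>a b. F (a \<otimes> b) = \<Phi> a b)"
    and G: "clinear G \<and> (\<forall>a b. G (a \<otimes> b) = \<Phi> a b)"
  interpret F: Vector_Spaces.linear scaleC scaleC F using F by simp
  interpret G: Vector_Spaces.linear scaleC scaleC G using G by simp
  have "F x = G x" for x
    by (induction x rule: tensor_induct) (simp_all add: F G F.add G.add F.zero G.zero)
  then show "F = G" by blast
qed

definition mult_sum :: "('a::times \<times> 'b::times) list \<Rightarrow> ('a \<times> 'b) list \<Rightarrow> ('a \<times> 'b) list"
  where "mult_sum ps qs = concat (map (\<lambda>(a, b). map (\<lambda>(a', b'). (a * a', b * b')) qs) ps)"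

definition star_sum ::
    "('a::complex_star_algebra \<times> 'b::complex_star_algebra) list \<Rightarrow> ('a \<times> 'b) list"
  where "star_sum ps = map (\<lambda>(a, b). (star a, star b)) ps"

lemma eval_sum_mult_right:
  "eval_sum \<Phi> (mult_sum ps qs) = eval_sum (\<lambda>a b. eval_sum (\<lambda>a' b'. \<Phi> (a * a') (b * b')) qs) ps"
proof (induction ps)
  case (Cons p ps)
  have "eval_sum \<Phi> (map (\<lambda>(a', b'). (a * a', b * b')) qs) =
      eval_sum (\<lambda>a' b'. \<Phi> (a * a') (b * b')) qs" for a b
    by (induction qs) auto
  with Cons show ?case by (cases p) (simp add: mult_sum_def)
qed (simp add: mult_sum_def)

lemma eval_sum_add:
  "eval_sum (\<lambda>a b. \<Phi> a b + \<Psi> a b) ps = eval_sum \<Phi> ps + eval_sum \<Psi> ps"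
  by (induction ps) (auto simp: ac_simps)

lemma eval_sum_zero: "eval_sum (\<lambda>a b. 0) ps = 0"
  by (induction ps) auto

lemma eval_sum_swap:
  "eval_sum (\<lambda>a b. eval_sum (\<lambda>a' b'. \<Psi> a b a' b') qs) ps =
   eval_sum (\<lambda>a' b'. eval_sum (\<lambda>a b. \<Psi> a b a' b') ps) qs"
  by (induction ps) (auto simp: eval_sum_zero eval_sum_add)

lemma eval_sum_scaleC:
  "eval_sum (\<lambda>a b. c *\<^sub>C (\<Phi> a b :: 'c::complex_vector)) ps = c *\<^sub>C eval_sum \<Phi> ps"
  by (induction ps) (auto simp: scaleC_add_right)

lemma cbilinear_mult:
  fixes \<Phi> :: "'a::complex_star_algebra \<Rightarrow> 'b::complex_star_algebra \<Rightarrow> 'c::complex_vector"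
  assumes "cbilinear \<Phi>"
  shows "cbilinear (\<lambda>a b. eval_sum (\<lambda>a' b'. \<Phi> (a * a') (b * b')) qs)"
    and "cbilinear (\<lambda>a' b'. eval_sum (\<lambda>a b. \<Phi> (a * a') (b * b')) ps)"
  using assms
  by (auto simp: cbilinear_iff distrib_left distrib_right mult_scaleC_left mult_scaleC_right
      eval_sum_add eval_sum_scaleC)

lemma mult_sum_rel:
  fixes ps qs :: "('a::complex_star_algebra \<times> 'b::complex_star_algebra) list"
  assumes "tensor_rel ps ps'" and "tensor_rel qs qs'"
  shows "tensor_rel (mult_sum ps qs) (mult_sum ps' qs')"
  unfolding tensor_rel_def
proof (intro allI impI)
  fix \<Phi> :: "'a \<Rightarrow> 'b \<Rightarrow> complex"
  assume bil: "cbilinear \<Phi>"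
  have "eval_sum \<Phi> (mult_sum ps qs) = eval_sum \<Phi> (mult_sum ps' qs)"
    unfolding eval_sum_mult_right
    using assms(1) cbilinear_mult(1)[OF bil] by (simp add: tensor_rel_def)
  also have "\<dots> = eval_sum \<Phi> (mult_sum ps' qs')"
    unfolding eval_sum_mult_right
    by (subst (1 2) eval_sum_swap)
      (use assms(2) cbilinear_mult(2)[OF bil] in \<open>simp add: tensor_rel_def\<close>)
  finally show "eval_sum \<Phi> (mult_sum ps qs) = eval_sum \<Phi> (mult_sum ps' qs')" .
qed

lemma eval_sum_star:
  "eval_sum \<Phi> (star_sum ps) = cnj (eval_sum (\<lambda>a b. cnj (\<Phi> (star a) (star b))) ps)"
  by (induction ps) (auto simp: star_sum_def)

lemma star_sum_rel:
  fixes ps :: "('a::complex_star_algebra \<times> 'b::complex_star_algebra) list"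
  assumes "tensor_rel ps qs"
  shows "tensor_rel (star_sum ps) (star_sum qs)"
  unfolding tensor_rel_def
proof (intro allI impI)
  fix \<Phi> :: "'a \<Rightarrow> 'b \<Rightarrow> complex"
  assume "cbilinear \<Phi>"
  then have "cbilinear (\<lambda>a b. cnj (\<Phi> (star a) (star b)))"
    by (simp add: cbilinear_iff star_add star_scaleC scaleC_complex_def)
  then show "eval_sum \<Phi> (star_sum ps) = eval_sum \<Phi> (star_sum qs)"
    using assms by (simp add: tensor_rel_def eval_sum_star)
qed

instantiation tensor :: (complex_star_algebra, complex_star_algebra) complex_star_algebra
begin

lift_definition times_tensor :: "'a \<odot> 'b \<Rightarrow> 'a \<odot> 'b \<Rightarrow> 'a \<odot> 'b" is mult_sum
  by (rule mult_sum_rel)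

lift_definition star_tensor :: "'a \<odot> 'b \<Rightarrow> 'a \<odot> 'b" is star_sum
  by (rule star_sum_rel)

instance
proof
  fix x y z :: "'a \<odot> 'b" and c :: complex
  show "x * y * z = x * (y * z)"
    by transfer (simp add: tensor_rel_def eval_sum_mult_right mult.assoc)
  show "(x + y) * z = x * z + y * z"
    by transfer (simp add: tensor_rel_def eval_sum_mult_right)
  show "x * (y + z) = x * y + x * z"
    by transfer (simp add: tensor_rel_def eval_sum_mult_right eval_sum_add)
  show "(c *\<^sub>C x) * y = c *\<^sub>C (x * y)"
    by transfer (simp add: tensor_rel_def eval_sum_mult_right eval_sum_scale cbilinear_mult)
  show "x * (c *\<^sub>C y) = c *\<^sub>C (x * y)"
  proof transfer
    fix c and ps qs :: "('a \<times> 'b) list"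
    have "eval_sum \<Phi> (mult_sum ps (scale_sum c qs)) = c *\<^sub>C eval_sum \<Phi> (mult_sum ps qs)"
      if "cbilinear \<Phi>" for \<Phi> :: "'a \<Rightarrow> 'b \<Rightarrow> complex"
      unfolding eval_sum_mult_right
      by (subst (1 2) eval_sum_swap) (simp add: eval_sum_scale cbilinear_mult that)
    then show "tensor_rel (mult_sum ps (scale_sum c qs)) (scale_sum c (mult_sum ps qs))"
      by (simp add: tensor_rel_def eval_sum_scale)
  qed
  show "star (x + y) = star x + star y"
    by transfer (simp add: tensor_rel_def star_sum_def)
  show "star (c *\<^sub>C x) = cnj c *\<^sub>C star x"
  proof transfer
    fix c and ps :: "('a \<times> 'b) list"
    have "star_sum (scale_sum c ps) = scale_sum (cnj c) (star_sum ps)"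
      by (induction ps) (auto simp: star_sum_def scale_sum_def star_scaleC)
    then show "tensor_rel (star_sum (scale_sum c ps)) (scale_sum (cnj c) (star_sum ps))"
      by (simp add: tensor_rel_def)
  qed
  show "star (star x) = x"
    by transfer (simp add: tensor_rel_def star_sum_def star_star comp_def case_prod_beta)
  show "star (x * y) = star y * star x"
  proof transfer
    fix ps qs :: "('a \<times> 'b) list"
    have star_eval: "eval_sum \<Phi> (star_sum rs) = eval_sum (\<lambda>a b. \<Phi> (star a) (star b)) rs"
      for \<Phi> :: "'a \<Rightarrow> 'b \<Rightarrow> complex" and rs
      by (induction rs) (auto simp: star_sum_def)
    have "eval_sum \<Phi> (star_sum (mult_sum ps qs)) = eval_sum \<Phi> (mult_sum (star_sum qs) (star_sum ps))"
      for \<Phi> :: "'a \<Rightarrow> 'b \<Rightarrow> complex"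
      by (simp add: star_eval eval_sum_mult_right star_mult) (rule eval_sum_swap)
    then show "tensor_rel (star_sum (mult_sum ps qs)) (mult_sum (star_sum qs) (star_sum ps))"
      by (simp add: tensor_rel_def)
  qed
qed

end

lemma tensor_elem_mult: "(a \<otimes> b) * (a' \<otimes> b') = (a * a') \<otimes> (b * b')"
  by transfer (simp add: tensor_rel_def mult_sum_def)

lemma star_tensor_elem: "star (a \<otimes> b) = star a \<otimes> star b"
  by transfer (simp add: tensor_rel_def star_sum_def)


section \<open>C*-norms and completions\<close>

definition cstar_norm :: "('a::complex_star_algebra \<Rightarrow> real) \<Rightarrow> bool"
  where "cstar_norm \<beta> \<longleftrightarrow>
    (\<forall>x. 0 \<le> \<beta> x) \<and> (\<forall>x. \<beta> x = 0 \<longleftrightarrow> x = 0) \<and>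
    (\<forall>x y. \<beta> (x + y) \<le> \<beta> x + \<beta> y) \<and> (\<forall>c x. \<beta> (c *\<^sub>C x) = cmod c * \<beta> x) \<and>
    (\<forall>x y. \<beta> (x * y) \<le> \<beta> x * \<beta> y) \<and> (\<forall>x. \<beta> (star x * x) = (\<beta> x)\<^sup>2)"

text \<open>
  The C*-algebra \<open>'d\<close>, with the embedding \<open>\<iota>\<close>, is the completion of the *-algebra \<open>'a\<close> with respect
  to \<open>\<beta>\<close>. These conditions determine \<open>('d, \<iota>)\<close> up to a unique isometric *-isomorphism.
\<close>

definition is_completion ::
    "('a::complex_star_algebra \<Rightarrow> real) \<Rightarrow> ('a \<Rightarrow> 'd::cstar_algebra) \<Rightarrow> bool"
  where "is_completion \<beta> \<iota> \<longleftrightarrow>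
    clinear \<iota> \<and> (\<forall>x y. \<iota> (x * y) = \<iota> x * \<iota> y) \<and> (\<forall>x. \<iota> (star x) = star (\<iota> x)) \<and>
    (\<forall>x. norm (\<iota> x) = \<beta> x) \<and> closure (range \<iota>) = UNIV"

definition alg_tensor_set :: "'a::complex_vector set \<Rightarrow> 'b::complex_vector set \<Rightarrow> ('a \<odot> 'b) set"
  where "alg_tensor_set C\<^sub>1 C\<^sub>2 = cspan {a \<otimes> b | a b. a \<in> C\<^sub>1 \<and> b \<in> C\<^sub>2}"

text \<open>The closure of \<open>C\<^sub>1 \<odot> C\<^sub>2\<close> in the completion given by \<open>\<iota>\<close>.\<close>

definition closed_tensor_set ::
    "('a::complex_vector \<odot> 'b::complex_vector \<Rightarrow> 'd::cstar_algebra) \<Rightarrow> 'a set \<Rightarrow> 'b set \<Rightarrow> 'd set"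
  where "closed_tensor_set \<iota> C\<^sub>1 C\<^sub>2 = closure (\<iota> ` alg_tensor_set C\<^sub>1 C\<^sub>2)"

end

theory Submission
  imports Defs
begin

text \<open>
  Every pure state \<open>f\<^sub>1\<close> of \<open>C\<^sub>1\<close> has a unique state extension \<open>g\<^sub>1\<close>, and even every positive functional
  on \<open>A\<^sub>1\<close> that restricts to \<open>\<kappa> f\<^sub>1\<close> is \<open>\<kappa> g\<^sub>1\<close>. Hence a state \<open>G\<close> of \<open>A\<^sub>1 \<otimes>\<^sub>\<beta> A\<^sub>2\<close> that extends a product
  character \<open>f\<^sub>1 \<otimes> f\<^sub>2\<close> has the form \<open>g\<^sub>1 \<otimes> h\<close> where \<open>h\<close> is a state of \<open>A\<^sub>2\<close> extending \<open>f\<^sub>2\<close>; so uniqueness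
  for \<open>f\<^sub>2\<close> gives uniqueness for \<open>f\<^sub>1 \<otimes> f\<^sub>2\<close>. Conversely \<open>f\<^sub>1 \<otimes> h\<close> is \<open>\<beta>\<close>-bounded on \<open>C\<^sub>1 \<odot> A\<^sub>2\<close> for every
  state \<open>h\<close>, because \<open>\<beta>\<close> is a cross norm, and so it extends to a state.

  For maximality let an abelian \<open>B\<close> contain \<open>C\<^sub>1 \<otimes> C\<^sub>2\<close>. By the Stone-Weierstrass theorem it suffices
  that two characters of \<open>B\<close> that agree on \<open>C\<^sub>1 \<otimes> C\<^sub>2\<close> agree at each \<open>t \<in> B\<close>. They extend to states
  \<open>g\<^sub>1 \<otimes> h\<close> and \<open>g\<^sub>1 \<otimes> h'\<close> whose values at \<open>t\<close> are \<open>h \<rho>\<close> and \<open>h' \<rho>\<close>, where \<open>\<rho>\<close> is the slice of \<open>t\<close>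
  by \<open>g\<^sub>1\<close>. The slice commutes with \<open>C\<^sub>2\<close> since \<open>t\<close> commutes with \<open>C\<^sub>1 \<otimes> C\<^sub>2\<close>, so it lies in the masa
  \<open>C\<^sub>2\<close>, on which \<open>h\<close> and \<open>h'\<close> agree.
\<close>

section \<open>Hahn-Banach and square roots\<close>

text \<open>For an arbitrary C*-norm the slice by \<open>g1\<close> is not visibly bounded, and the
  minimality of the spatial norm is not invoked. Contractivity comes from uniqueness: the product of
  \<open>f1\<close> with a pure state \<open>h\<close> of the second algebra extends to a state of
  the completion, this state must be the product of \<open>g1\<close> and \<open>h\<close>, and an
  \<open>h\<close> that norms the slice gives the bound. The extension property speaks of pure
  states, whereas restriction, compression and slicing produce positive functionals of norm at most
  1. A Krein-Milman argument on faces of the compact set of quasi-states turns uniqueness among pure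
  states into uniqueness among quasi-states, and the absence of annihilating pure states into the
  absence of annihilating quasi-states. Characters of \<open>B\<close> may vanish on the small
  algebra; the approximate identity in the second masa is there to exclude this. Units need not
  exist, so order arguments take place in a unitization. Spectral theory is replaced by two tools: a
  square root found by iteration, and the estimate of \<open>h * (1 - h) ^ m\<close> by
  \<open>1 / (m + 1)\<close>.\<close>

lemma hahn_banach_real:
  fixes V :: "'a::real_normed_vector set" and f :: "'a \<Rightarrow> real"
  assumes V: "subspace V"
    and add: "\<And>x y. x \<in> V \<Longrightarrow> y \<in> V \<Longrightarrow> f (x + y) = f x + f y"
    and scale: "\<And>r x. x \<in> V \<Longrightarrow> f (r *\<^sub>R x) = r * f x"
    and le: "\<And>x. x \<in> V \<Longrightarrow> f x \<le> norm x"
  obtains F where "linear F" "\<And>x. x \<in> V \<Longrightarrow> F x = f x" "\<And>x. F x \<le> norm x"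
proof -
  \<comment> \<open>Partial functionals are represented by their graphs. Single-valuedness follows
    from \<open>snd p \<le> norm (fst p)\<close> on a subspace, see \<open>uniq\<close>.\<close>
  define \<A> where "\<A> = {G :: ('a \<times> real) set. subspace G \<and> (\<lambda>x. (x, f x)) ` V \<subseteq> G \<and>
    (\<forall>p\<in>G. snd p \<le> norm (fst p))}"
  have "subspace ((\<lambda>x. (x, f x)) ` V)"
    unfolding subspace_def
  proof (intro conjI ballI allI)
    show "0 \<in> (\<lambda>x. (x, f x)) ` V"
      using subspace_0[OF V] scale[of 0 0] by (auto simp: zero_prod_def image_iff)
  qed (use V in \<open>auto simp: image_iff add scale subspace_def\<close>)
  then have ne: "\<A> \<noteq> {}"
    using le unfolding \<A>_def by (intro ex_in_conv[THEN iffD1] exI[of _ "(\<lambda>x. (x, f x)) ` V"]) auto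
  have chain: "\<Union>\<C> \<in> \<A>" if "\<C> \<noteq> {}" and ch: "subset.chain \<A> \<C>" for \<C>
  proof -
    have sub: "G \<in> \<A>" if "G \<in> \<C>" for G
      using ch that by (auto simp: subset.chain_def)
    have two: "\<exists>G\<in>\<C>. p \<in> G \<and> q \<in> G" if "p \<in> \<Union>\<C>" "q \<in> \<Union>\<C>" for p q
    proof -
      from that obtain G H where "G \<in> \<C>" "p \<in> G" "H \<in> \<C>" "q \<in> H" by blast
      moreover from this have "G \<subseteq> H \<or> H \<subseteq> G"
        using ch by (auto simp: subset_chain_def)
      ultimately show ?thesis by blast
    qed
    have "subspace (\<Union>\<C>)"
      unfolding subspace_def
    proof (intro conjI ballI allI)
      show "0 \<in> \<Union>\<C>"
        using \<open>\<C> \<noteq> {}\<close> sub by (auto simp: \<A>_def subspace_0)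
      show "p + q \<in> \<Union>\<C>" if "p \<in> \<Union>\<C>" "q \<in> \<Union>\<C>" for p q
        using two[OF that] sub unfolding \<A>_def by (metis (no_types, lifting) UnionI mem_Collect_eq subspace_add)
      show "c *\<^sub>R p \<in> \<Union>\<C>" if "p \<in> \<Union>\<C>" for c p
        using that sub by (auto simp: \<A>_def intro!: subspace_scale)
    qed
    moreover have "(\<lambda>x. (x, f x)) ` V \<subseteq> \<Union>\<C>"
      using \<open>\<C> \<noteq> {}\<close> sub unfolding \<A>_def by blast
    ultimately show ?thesis
      using sub unfolding \<A>_def by blast
  qed
  obtain M where M: "M \<in> \<A>" and max: "\<And>X. X \<in> \<A> \<Longrightarrow> M \<subseteq> X \<Longrightarrow> X = M"
    using subset_Zorn_nonempty[OF ne chain] by blast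
  have Msub: "subspace M" and Mf: "x \<in> V \<Longrightarrow> (x, f x) \<in> M"
    and Mle: "(x, y) \<in> M \<Longrightarrow> y \<le> norm x" for x y
    using M by (auto simp: \<A>_def)
  have uniq: "y = z" if "(x, y) \<in> M" "(x, z) \<in> M" for x y z
    using subspace_diff[OF Msub that] subspace_diff[OF Msub that(2) that(1)] Mle[of 0 "y - z"] Mle[of 0 "z - y"]
    by simp
  have dom: "\<exists>y. (x0, y) \<in> M" for x0
  proof (rule ccontr)
    assume nex: "\<nexists>y. (x0, y) \<in> M"
    have key: "y - norm (x - x0) \<le> norm (x' + x0) - y'" if "(x, y) \<in> M" "(x', y') \<in> M" for x y x' y'
    proof -
      have "y + y' \<le> norm (x + x')"
        using subspace_add[OF Msub that] Mle by simp
      also have "\<dots> = norm ((x - x0) + (x' + x0))" by simp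
      also have "\<dots> \<le> norm (x - x0) + norm (x' + x0)" by (rule norm_triangle_ineq)
      finally show ?thesis by simp
    qed
    have zero: "(0, 0) \<in> M" using subspace_0[OF Msub] by (simp add: zero_prod_def)
    \<comment> \<open>The least value at \<open>x0\<close> that keeps the extension below the norm;
      \<open>key\<close> says that every lower constraint lies below every upper one.\<close>
    define c where "c = (SUP p\<in>M. snd p - norm (fst p - x0))"
    have c1: "y - norm (x - x0) \<le> c" if "(x, y) \<in> M" for x y
      unfolding c_def using key[OF _ zero]
      by (intro cSUP_upper2[OF _ that] bdd_aboveI2[where M = "norm x0"]) auto
    have c2: "c \<le> norm (x + x0) - y" if "(x, y) \<in> M" for x y
      unfolding c_def using key[OF _ that] zero by (intro cSUP_least) auto
    have ext: "y + t * c \<le> norm (x + t *\<^sub>R x0)" if xy: "(x, y) \<in> M" for x y t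
    proof (cases t "0::real" rule: linorder_cases)
      case equal
      then show ?thesis using Mle[OF xy] by simp
    next
      case greater
      have "(inverse t *\<^sub>R x, inverse t * y) \<in> M"
        using subspace_scale[OF Msub xy, of "inverse t"] by simp
      from c2[OF this] have "t * c \<le> t * (norm (inverse t *\<^sub>R x + x0) - inverse t * y)"
        using greater by (intro mult_left_mono) auto
      also have "\<dots> = norm (t *\<^sub>R (inverse t *\<^sub>R x + x0)) - y"
        using greater by (simp add: right_diff_distrib)
      also have "t *\<^sub>R (inverse t *\<^sub>R x + x0) = x + t *\<^sub>R x0"
        using greater by (simp add: scaleR_add_right)
      finally show ?thesis by simp
    next
      case less
      define s where "s = - t"
      have s: "s > 0" using less by (simp add: s_def)
      have "(inverse s *\<^sub>R x, inverse s * y) \<in> M"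
        using subspace_scale[OF Msub xy, of "inverse s"] by simp
      from c1[OF this] have "s * (inverse s * y - norm (inverse s *\<^sub>R x - x0)) \<le> s * c"
        using s by (intro mult_left_mono) auto
      moreover have "s * (inverse s * y - norm (inverse s *\<^sub>R x - x0)) =
          y - norm (s *\<^sub>R (inverse s *\<^sub>R x - x0))"
        using s by (simp add: right_diff_distrib)
      moreover have "s *\<^sub>R (inverse s *\<^sub>R x - x0) = x + t *\<^sub>R x0"
        using s by (simp add: scaleR_diff_right s_def)
      ultimately have "y - norm (x + t *\<^sub>R x0) \<le> s * c" by (simp only:)
      then show ?thesis by (simp add: s_def)
    qed
    define N where "N = {(x + t *\<^sub>R x0, y + t * c) | x y t. (x, y) \<in> M}"
    have "subspace N"
      unfolding subspace_def
    proof (intro conjI ballI allI)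
      show "0 \<in> N" using zero unfolding N_def zero_prod_def
        by (intro CollectI exI[of _ 0]) auto
      show "p + q \<in> N" if pq: "p \<in> N" "q \<in> N" for p q
      proof -
        obtain x y t where p: "p = (x + t *\<^sub>R x0, y + t * c)" "(x, y) \<in> M" using pq by (auto simp: N_def)
        obtain x' y' t' where q: "q = (x' + t' *\<^sub>R x0, y' + t' * c)" "(x', y') \<in> M" using pq by (auto simp: N_def)
        show ?thesis unfolding N_def
          using subspace_add[OF Msub p(2) q(2)] p q
          by (intro CollectI exI[of _ "x + x'"] exI[of _ "y + y'"] exI[of _ "t + t'"])
            (auto simp: algebra_simps)
      qed
      show "r *\<^sub>R p \<in> N" if p: "p \<in> N" for r p
      proof -
        obtain x y t where p: "p = (x + t *\<^sub>R x0, y + t * c)" "(x, y) \<in> M" using p by (auto simp: N_def)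
        show ?thesis unfolding N_def
          using subspace_scale[OF Msub p(2), of r] p
          by (intro CollectI exI[of _ "r *\<^sub>R x"] exI[of _ "r * y"] exI[of _ "r * t"])
            (auto simp: algebra_simps)
      qed
    qed
    moreover have MN: "M \<subseteq> N"
    proof
      fix p assume "p \<in> M"
      then show "p \<in> N" unfolding N_def
        by (intro CollectI exI[of _ "fst p"] exI[of _ "snd p"] exI[of _ 0]) auto
    qed
    moreover have "\<forall>p\<in>N. snd p \<le> norm (fst p)"
      using ext by (auto simp: N_def)
    ultimately have "N \<in> \<A>"
      using Mf unfolding \<A>_def by blast
    then have "N = M" using max MN by blast
    moreover have "(x0, c) \<in> N"
      unfolding N_def using zero by (intro CollectI exI[of _ 0] exI[of _ 1]) auto
    ultimately show False using nex by blast
  qed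
  define F where "F x = (THE y. (x, y) \<in> M)" for x
  have F: "F x = y" if "(x, y) \<in> M" for x y
    unfolding F_def using that uniq by blast
  have FM: "(x, F x) \<in> M" for x
    using dom[of x] F by blast
  show thesis
  proof
    show "linear F"
      using subspace_add[OF Msub FM FM] subspace_scale[OF Msub FM]
      by (intro linearI) (auto intro!: F)
    show "F x = f x" if "x \<in> V" for x using F[OF Mf[OF that]] .
    show "F x \<le> norm x" for x using Mle[OF FM] .
  qed
qed

section \<open>Complex linear functionals on subspaces\<close>

lemma scaleC_real: "complex_of_real r *\<^sub>C x = r *\<^sub>R x"
  by (rule scaleC_of_real)

lemma csubspaceD:
  assumes "csubspace V"
  shows "0 \<in> V" "x \<in> V \<Longrightarrow> y \<in> V \<Longrightarrow> x + y \<in> V" "x \<in> V \<Longrightarrow> c *\<^sub>C x \<in> V"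
    "x \<in> V \<Longrightarrow> r *\<^sub>R x \<in> V" "x \<in> V \<Longrightarrow> - x \<in> V" "x \<in> V \<Longrightarrow> y \<in> V \<Longrightarrow> x - y \<in> V"
  using assms complex_vector.subspace_neg[of V x] complex_vector.subspace_diff[of V x y]
  by (auto simp: complex_vector.subspace_def simp flip: scaleC_real)

lemma linear_functional_onD:
  assumes "linear_functional_on V f" "csubspace V"
  shows "x \<in> V \<Longrightarrow> y \<in> V \<Longrightarrow> f (x + y) = f x + f y"
    "x \<in> V \<Longrightarrow> f (c *\<^sub>C x) = c * f x" "x \<in> V \<Longrightarrow> f (r *\<^sub>R x) = of_real r * f x"
    "x \<in> V \<Longrightarrow> f (- x) = - f x" "x \<in> V \<Longrightarrow> y \<in> V \<Longrightarrow> f (x - y) = f x - f y" "f 0 = 0"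
proof -
  have a: "f (x + y) = f x + f y" if "x \<in> V" "y \<in> V" for x y
    using assms that by (auto simp: linear_functional_on_def)
  have s: "f (c *\<^sub>C x) = c * f x" if "x \<in> V" for x c
    using assms that by (auto simp: linear_functional_on_def)
  have r: "f (r *\<^sub>R x) = of_real r * f x" if "x \<in> V" for x r
    using s[OF that, of "of_real r"] by (simp add: scaleC_real)
  have m: "f (- x) = - f x" if "x \<in> V" for x
    using r[OF that, of "- 1"] by simp
  show "x \<in> V \<Longrightarrow> y \<in> V \<Longrightarrow> f (x + y) = f x + f y"
    "x \<in> V \<Longrightarrow> f (c *\<^sub>C x) = c * f x" "x \<in> V \<Longrightarrow> f (r *\<^sub>R x) = of_real r * f x"
    "x \<in> V \<Longrightarrow> f (- x) = - f x" using a s r m by auto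
  show "f (x - y) = f x - f y" if "x \<in> V" "y \<in> V"
    using a[of x "- y"] m[OF that(2)] that csubspaceD(5)[OF assms(2)] by simp
  show "f 0 = 0" using r[of 0 0] csubspaceD(1)[OF assms(2)] by simp
qed

lemma linear_functional_UNIV: "linear_functional_on UNIV f \<longleftrightarrow> clinear f"
  by (simp add: linear_functional_on_def clinear_iff scaleC_complex_def)

theorem hahn_banach:
  fixes V :: "'a::cstar_algebra set" and f :: "'a \<Rightarrow> complex"
  assumes V: "csubspace V" and f: "linear_functional_on V f"
    and le: "\<And>x. x \<in> V \<Longrightarrow> cmod (f x) \<le> norm x"
  obtains F where "clinear F" "\<And>x. x \<in> V \<Longrightarrow> F x = f x" "\<And>x. cmod (F x) \<le> norm x"
proof -
  note lf = linear_functional_onD[OF f V]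
  obtain g where g: "linear g" "\<And>x. x \<in> V \<Longrightarrow> g x = Re (f x)" "\<And>x. g x \<le> norm x"
  proof (rule hahn_banach_real[of V "\<lambda>x. Re (f x)"])
    show "subspace V"
      using csubspaceD[OF V] by (auto simp: subspace_def)
    show "Re (f x) \<le> norm x" if "x \<in> V" for x
      using complex_Re_le_cmod[of "f x"] le[OF that] by linarith
  qed (auto simp: lf)
  interpret g: linear g by fact
  \<comment> \<open>A complex linear functional is determined by its real part \<open>g\<close>: the
    imaginary part at \<open>x\<close> is minus the real part at
    \<open>\<i> *\<^sub>C x\<close>.\<close>
  define F where "F x = Complex (g x) (- g (\<i> *\<^sub>C x))" for x
  have ii: "\<i> *\<^sub>C \<i> *\<^sub>C x = - x" for x :: 'a
    using scaleC_real[of "-1" x] by (simp add: scaleC_scaleC)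
  have Fadd: "F (x + y) = F x + F y" for x y
    by (simp add: F_def scaleC_add_right g.add complex_eq_iff)
  have Fi: "F (\<i> *\<^sub>C x) = \<i> * F x" for x
    by (simp add: F_def ii g.neg complex_eq_iff)
  have comm: "\<i> *\<^sub>C r *\<^sub>R x = r *\<^sub>R \<i> *\<^sub>C x" for r and x :: 'a
    by (simp add: scaleC_scaleC mult.commute flip: scaleC_real)
  have Fr: "F (r *\<^sub>R x) = of_real r * F x" for x r
    by (simp add: F_def g.scale complex_eq_iff comm)
  have Fc: "F (c *\<^sub>C x) = c * F x" for x c
  proof -
    have "c *\<^sub>C x = Re c *\<^sub>R x + \<i> *\<^sub>C Im c *\<^sub>R x"
      by (simp add: scaleC_scaleC complex_eq flip: scaleC_real scaleC_add_left)
    then show ?thesis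
      by (simp add: Fadd Fi Fr complex_eq_iff algebra_simps)
  qed
  have Fle: "cmod (F x) \<le> norm x" for x
  proof -
    \<comment> \<open>Rotating \<open>x\<close> by this scalar makes the value real and nonnegative,
      where the bound on \<open>g\<close> applies; for \<open>F x = 0\<close> it is 0.\<close>
    define c where "c = cnj (sgn (F x))"
    have "cmod c \<le> 1" by (simp add: c_def norm_sgn)
    have "c * F x = cmod (F x)"
    proof (cases "F x = 0")
      case False
      have "cnj (F x) * F x = complex_of_real (cmod (F x) * cmod (F x))"
        using complex_norm_square[of "F x"] by (simp add: mult.commute power2_eq_square)
      then show ?thesis using False by (simp add: c_def sgn_eq field_simps)
    qed simp
    then have "cmod (F x) = Re (F (c *\<^sub>C x))" by (simp add: Fc)
    also have "\<dots> \<le> norm (c *\<^sub>C x)" using g(3) by (simp add: F_def)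
    also have "\<dots> \<le> norm x" using \<open>cmod c \<le> 1\<close> by (simp add: norm_scaleC mult_left_le_one_le)
    finally show ?thesis .
  qed
  show thesis
  proof
    show "clinear F" by (auto simp: clinear_iff Fadd Fc scaleC_complex_def)
    show "F x = f x" if "x \<in> V" for x
      using g(2)[OF that] g(2)[OF csubspaceD(3)[OF V that, of \<i>]] lf(2)[OF that, of \<i>]
      by (simp add: F_def complex_eq_iff)
    show "cmod (F x) \<le> norm x" for x by (rule Fle)
  qed
qed

section \<open>Elementary consequences of the C*-identity\<close>

lemma star_zero [simp]: "star (0::'a::complex_star_algebra) = 0"
  using star_add[of 0 "0::'a"] by simp

lemma star_minus [simp]: "star (- x) = - star (x::'a::complex_star_algebra)"
  using star_add[of x "- x"] by (simp add: eq_neg_iff_add_eq_0 add.commute)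

lemma star_diff: "star (x - y) = star x - star (y::'a::complex_star_algebra)"
  using star_add[of x "- y"] by simp

lemma star_scaleR: "star (r *\<^sub>R x) = r *\<^sub>R star (x::'a::complex_star_algebra)"
  using star_scaleC[of "of_real r" x] by (simp add: scaleC_real)

lemmas star_simps = star_add star_minus star_diff star_scaleR star_scaleC star_mult star_star

lemma norm_star [simp]: "norm (star x) = norm (x::'a::cstar_algebra)"
proof -
  have *: "norm x \<le> norm (star x)" for x :: 'a
  proof (cases "x = 0")
    case False
    have "norm x * norm x \<le> norm (star x) * norm x"
      using cstar_identity[of x] norm_mult_ineq[of "star x" x] by (simp add: power2_eq_square)
    then show ?thesis using False by simp
  qed simp
  show ?thesis using *[of x] *[of "star x"] by (simp add: star_star)
qed

lemma cstar_identity': "norm (x * star x) = (norm (x::'a::cstar_algebra))\<^sup>2"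
  using cstar_identity[of "star x"] by (simp add: star_star)

lemma bounded_linear_star: "bounded_linear (star :: 'a \<Rightarrow> 'a::cstar_algebra)"
  by (rule bounded_linear_intro[where K = 1]) (auto simp: star_add star_scaleR)

lemma bounded_linear_scaleC: "bounded_linear (\<lambda>x. c *\<^sub>C (x :: 'a::cstar_algebra))"
  by (rule bounded_linear_intro[where K = "cmod c"])
    (auto simp: scaleC_add_right norm_scaleC scaleC_scaleC mult.commute simp flip: scaleC_real)

lemmas tendsto_star = bounded_linear.tendsto[OF bounded_linear_star]
lemmas tendsto_scaleC = bounded_linear.tendsto[OF bounded_linear_scaleC]

lemma cstar_subalgebraD:
  assumes "cstar_subalgebra C"
  shows "csubspace C" "closed C" "x \<in> C \<Longrightarrow> y \<in> C \<Longrightarrow> x * y \<in> C" "x \<in> C \<Longrightarrow> star x \<in> C"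
    "0 \<in> C" "x \<in> C \<Longrightarrow> y \<in> C \<Longrightarrow> x + y \<in> C" "x \<in> C \<Longrightarrow> c *\<^sub>C x \<in> C"
    "x \<in> C \<Longrightarrow> r *\<^sub>R x \<in> C" "x \<in> C \<Longrightarrow> - x \<in> C" "x \<in> C \<Longrightarrow> y \<in> C \<Longrightarrow> x - y \<in> C"
  using assms csubspaceD[of C] by (auto simp: cstar_subalgebra_def)

lemma cstar_subalgebra_UNIV [simp]: "cstar_subalgebra UNIV"
  by (auto simp: cstar_subalgebra_def complex_vector.subspace_def)

text \<open>The iteration \<open>s \<mapsto> (u + s\<^sup>2) / 2\<close> is dominated by the real iteration with \<open>u = 1\<close>, which is
  monotone and bounded; so it converges even when \<open>\<parallel>u\<parallel> = 1\<close>. In a unitization, \<open>1 - s\<close> is then a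
  square root of \<open>1 - u\<close>.\<close>

lemma sqrt_one_minus:
  fixes u :: "'a::cstar_algebra"
  assumes C: "cstar_subalgebra C" and u: "u \<in> C" "star u = u" "norm u \<le> 1"
  obtains s where "s \<in> C" "star s = s" "norm s \<le> 1" "s + s - s * s = u"
    "\<And>y. y * u = u * y \<Longrightarrow> y * s = s * y"
proof -
  define s where "s = rec_nat 0 (\<lambda>n s. (1/2) *\<^sub>R (u + s * s))"
  define \<sigma> :: "nat \<Rightarrow> real" where "\<sigma> = rec_nat 0 (\<lambda>n s. (1 + s * s) / 2)"
  have s0 [simp]: "s 0 = 0" and s_Suc: "s (Suc n) = (1/2) *\<^sub>R (u + s n * s n)" for n
    by (simp_all add: s_def)
  have \<sigma>0 [simp]: "\<sigma> 0 = 0" and \<sigma>_Suc: "\<sigma> (Suc n) = (1 + \<sigma> n * \<sigma> n) / 2" for n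
    by (simp_all add: \<sigma>_def)
  have \<sigma>_pos: "0 \<le> \<sigma> n" for n by (induction n) (auto simp: \<sigma>_Suc)
  have \<sigma>_le: "\<sigma> n \<le> 1" for n
  proof (induction n)
    case (Suc n)
    then show ?case using mult_mono[OF Suc Suc] \<sigma>_pos[of n] by (simp add: \<sigma>_Suc)
  qed simp
  have \<sigma>_mono: "\<sigma> n \<le> \<sigma> (Suc n)" for n
    using zero_le_power2[of "1 - \<sigma> n"] by (simp add: \<sigma>_Suc power2_eq_square algebra_simps)
  have s_le: "norm (s n) \<le> \<sigma> n" for n
  proof (induction n)
    case (Suc n)
    have "norm (u + s n * s n) \<le> 1 + \<sigma> n * \<sigma> n"
      using norm_triangle_ineq[of u "s n * s n"] u(3) norm_mult_ineq[of "s n" "s n"]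
        mult_mono[OF Suc Suc \<sigma>_pos norm_ge_zero] by linarith
    then show ?case by (simp add: s_Suc \<sigma>_Suc)
  qed simp
  have step: "norm (s (Suc n) - s n) \<le> \<sigma> (Suc n) - \<sigma> n" for n
  proof (induction n)
    case 0
    then show ?case using u(3) by (simp add: s_Suc \<sigma>_Suc)
  next
    case (Suc n)
    let ?a = "s (Suc n)" and ?b = "s n" and ?x = "\<sigma> (Suc n)" and ?y = "\<sigma> n"
    \<comment> \<open>This splitting of the difference of squares lets each factor be dominated by
      its scalar counterpart; for \<open>\<sigma>\<close> the same splitting is exact.\<close>
    have "s (Suc (Suc n)) - ?a = (1/2) *\<^sub>R (?a * (?a - ?b) + (?a - ?b) * ?b)"
      by (simp add: s_Suc[of "Suc n"] s_Suc[of n] algebra_simps)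
    then have "norm (s (Suc (Suc n)) - ?a) \<le> (norm (?a * (?a - ?b)) + norm ((?a - ?b) * ?b)) / 2"
      using norm_triangle_ineq[of "?a * (?a - ?b)" "(?a - ?b) * ?b"] by simp
    also have "\<dots> \<le> (?x * (?x - ?y) + (?x - ?y) * ?y) / 2"
      using order_trans[OF norm_mult_ineq[of ?a "?a - ?b"] mult_mono[OF s_le Suc \<sigma>_pos norm_ge_zero]]
        order_trans[OF norm_mult_ineq[of "?a - ?b" ?b] mult_mono[OF Suc s_le _ norm_ge_zero]] \<sigma>_mono[of n]
      by simp
    also have "\<dots> = \<sigma> (Suc (Suc n)) - \<sigma> (Suc n)"
      by (simp add: \<sigma>_Suc[of "Suc n"] \<sigma>_Suc[of n] field_simps)
    finally show ?case .
  qed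
  have "summable (\<lambda>n. \<sigma> (Suc n) - \<sigma> n)"
  proof -
    have "incseq \<sigma>" using \<sigma>_mono by (rule incseq_SucI)
    then obtain L where "\<sigma> \<longlonglongrightarrow> L" using incseq_convergent \<sigma>_le by blast
    from telescope_sums[OF this] show ?thesis by (rule sums_summable)
  qed
  then have "summable (\<lambda>n. s (Suc n) - s n)"
    using step by (rule summable_comparison_test')
  then have "(\<lambda>n. \<Sum>i<n. s (Suc i) - s i) \<longlonglongrightarrow> (\<Sum>i. s (Suc i) - s i)"
    by (rule summable_LIMSEQ)
  then obtain t where t: "s \<longlonglongrightarrow> t"
    by (auto simp: sum_lessThan_telescope)
  have inC: "s n \<in> C" for n
    by (induction n) (auto simp: s_Suc intro!: cstar_subalgebraD[OF C] u)
  have sa: "star (s n) = s n" for n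
    by (induction n) (auto simp: s_Suc star_simps u)
  have comm: "y * s n = s n * y" if "y * u = u * y" for y n
  proof (induction n)
    case (Suc n)
    have "y * (s n * s n) = (s n * s n) * y" using Suc by (metis mult.assoc)
    then show ?case using that by (simp add: s_Suc distrib_left distrib_right)
  qed simp
  show thesis
  proof
    show "t \<in> C" using closed_sequentially[OF cstar_subalgebraD(2)[OF C]] inC t by blast
    show "star t = t"
      using tendsto_star[OF t] t LIMSEQ_unique by (auto simp: sa)
    show "norm t \<le> 1"
      using order_trans[OF s_le \<sigma>_le] tendsto_norm[OF t] by (intro LIMSEQ_le_const2[where X = "\<lambda>n. norm (s n)"]) auto
    show "t + t - t * t = u"
    proof -
      have "(\<lambda>n. s (Suc n) + s (Suc n) - s n * s n) \<longlonglongrightarrow> t + t - t * t"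
        by (intro tendsto_intros t LIMSEQ_Suc[OF t])
      moreover have "s (Suc n) + s (Suc n) - s n * s n = u" for n
      proof -
        have "s (Suc n) + s (Suc n) = u + s n * s n"
          unfolding s_Suc by (simp flip: scaleR_add_left)
        then show ?thesis by simp
      qed
      ultimately show ?thesis by (simp add: LIMSEQ_const_iff)
    qed
    show "y * t = t * y" if "y * u = u * y" for y
    proof -
      have "(\<lambda>n. s n * y) \<longlonglongrightarrow> y * t"
        unfolding comm[OF that, symmetric] by (intro tendsto_intros t)
      moreover have "(\<lambda>n. s n * y) \<longlonglongrightarrow> t * y"
        by (intro tendsto_intros t)
      ultimately show ?thesis by (rule LIMSEQ_unique)
    qed
  qed
qed

section \<open>Unitization\<close>

class unital_cstar_algebra = cstar_algebra + real_normed_algebra_1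

text \<open>A new unit is adjoined even if \<open>'a\<close> has one. The norm is the larger of the norm of left
  multiplication on \<open>'a\<close> and the norm of the scalar part, which is definite in that case as well.\<close>

datatype 'a uz = Uz (vec: 'a) (scl: complex)

lemma uz_eq_iff: "x = y \<longleftrightarrow> vec x = vec y \<and> scl x = scl y"
  by (cases x; cases y) auto

lemma scaleC_simps [simp]:
  fixes x :: "'a::complex_vector"
  shows "c *\<^sub>C (0::'a) = 0" "0 *\<^sub>C x = 0" "1 *\<^sub>C x = x" "(- c) *\<^sub>C x = - (c *\<^sub>C x)" "c *\<^sub>C (- x) = - (c *\<^sub>C x)"
  by (simp_all add: complex_vector.scale_minus_left complex_vector.scale_minus_right)

lemma scaleC_diff:
  fixes x :: "'a::complex_vector"
  shows "c *\<^sub>C (x - y) = c *\<^sub>C x - c *\<^sub>C y" "(c - d) *\<^sub>C x = c *\<^sub>C x - d *\<^sub>C x"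
  using complex_vector.scale_right_diff_distrib[of c x y] complex_vector.scale_left_diff_distrib[of c d x]
  by auto

lemmas scaleC_algebra = scaleC_add_right scaleC_add_left scaleC_diff scaleC_scaleC
  mult_scaleC_left mult_scaleC_right

instantiation uz :: (cstar_algebra) complex_star_algebra
begin

definition "0 = Uz 0 0"
definition "x + y = Uz (vec x + vec y) (scl x + scl y)"
definition "x - y = Uz (vec x - vec y) (scl x - scl y)"
definition "- x = Uz (- vec x) (- scl x)"
definition "r *\<^sub>R x = Uz (r *\<^sub>R vec x) (r *\<^sub>R scl x)"
definition "c *\<^sub>C x = Uz (c *\<^sub>C vec x) (c * scl x)"
definition "x * y = Uz (vec x * vec y + scl x *\<^sub>C vec y + scl y *\<^sub>C vec x) (scl x * scl y)"
definition "star x = Uz (star (vec x)) (cnj (scl x))"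

lemmas uz_defs = zero_uz_def plus_uz_def minus_uz_def uminus_uz_def scaleR_uz_def scaleC_uz_def
  times_uz_def star_uz_def

instance
  by standard (auto simp: uz_defs scaleC_algebra scaleR_add_right scaleR_add_left star_simps distrib_left distrib_right
      scaleC_real scaleR_conv_of_real ac_simps)
end

instantiation uz :: (cstar_algebra) ring_1
begin
definition "1 = Uz 0 1"
instance by standard (auto simp: uz_defs one_uz_def)
end

lemma uz_simps [simp]:
  fixes x y :: "'a::cstar_algebra uz"
  shows "vec 0 = (0::'a)" "scl (0::'a uz) = 0" "vec 1 = (0::'a)" "scl (1::'a uz) = 1"
    "vec (x + y) = vec x + vec y" "scl (x + y) = scl x + scl y"
    "vec (x - y) = vec x - vec y" "scl (x - y) = scl x - scl y"
    "vec (- x) = - vec x" "scl (- x) = - scl x"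
    "vec (r *\<^sub>R x) = r *\<^sub>R vec x" "scl (r *\<^sub>R x) = r *\<^sub>R scl x"
    "vec (c *\<^sub>C x) = c *\<^sub>C vec x" "scl (c *\<^sub>C x) = c * scl x"
    "vec (x * y) = vec x * vec y + scl x *\<^sub>C vec y + scl y *\<^sub>C vec x" "scl (x * y) = scl x * scl y"
    "vec (star x) = star (vec x)" "scl (star x) = cnj (scl x)"
  by (simp_all add: uz_defs one_uz_def)

definition act :: "'a::cstar_algebra uz \<Rightarrow> 'a \<Rightarrow> 'a"
  where "act x y = vec x * y + scl x *\<^sub>C y"

lemma bounded_linear_act: "bounded_linear (act x)"
  unfolding act_def
  by (intro bounded_linear_add bounded_linear_mult_right bounded_linear_scaleC)

lemma act_mult: "act (x * z) y = act x (act z y)"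
  by (simp add: act_def scaleC_algebra distrib_left distrib_right mult.assoc)

lemma act_scaleC: "act (c *\<^sub>C x) y = c *\<^sub>C act x y"
  by (simp add: act_def scaleC_algebra)

text \<open>With \<open>star y * w\<close> as an algebra-valued inner product,
  \<open>act (star x)\<close> is the adjoint of \<open>act x\<close>. This is the source of the
  C*-identity on the unitization.\<close>

lemma star_act_mult: "star (act x y) * w = star y * act (star x) w"
  by (simp add: act_def star_simps distrib_left distrib_right mult.assoc mult_scaleC_left mult_scaleC_right)

instantiation uz :: (cstar_algebra) real_normed_vector
begin

definition "norm x = max (onorm (act x)) (cmod (scl x))"
definition "dist x y = norm (x - y :: 'a uz)"
definition "sgn x = x /\<^sub>R norm (x :: 'a uz)"
definition [code del]: "(uniformity :: ('a uz \<times> 'a uz) filter) = (INF e\<in>{0 <..}. principal {(x, y). dist x y < e})"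
definition [code del]: "open (U :: 'a uz set) \<longleftrightarrow> (\<forall>x\<in>U. \<forall>\<^sub>F (x', y) in uniformity. x' = x \<longrightarrow> y \<in> U)"

text \<open>Testing \<open>act x\<close> on \<open>star (vec x)\<close> recovers
  \<open>norm (vec x)\<close> up to the scalar part. Definiteness and completeness of the norm both
  rest on this.\<close>

lemma norm_vec_le: "norm (vec x) \<le> onorm (act x) + cmod (scl x)"
proof -
  let ?v = "star (vec x)"
  have "norm (vec x) * norm (vec x) = norm (act x ?v - scl x *\<^sub>C ?v)"
    using cstar_identity'[of "vec x"] by (simp add: act_def power2_eq_square)
  also have "\<dots> \<le> norm (act x ?v) + norm (scl x *\<^sub>C ?v)" by (rule norm_triangle_ineq4)
  also have "\<dots> \<le> (onorm (act x) + cmod (scl x)) * norm (vec x)"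
    using onorm[OF bounded_linear_act, of x ?v] by (simp add: norm_scaleC distrib_right)
  finally show ?thesis
    using onorm_pos_le[OF bounded_linear_act, of x]
    by (cases "norm (vec x) = 0") (auto simp: mult_le_cancel_right)
qed

lemma norm_uz_le: "norm x \<le> norm (vec x) + cmod (scl x)"
proof -
  have "onorm (act x) \<le> norm (vec x) + cmod (scl x)"
  proof (rule onorm_bound)
    show "norm (act x y) \<le> (norm (vec x) + cmod (scl x)) * norm y" for y
      unfolding act_def distrib_right
      using norm_triangle_ineq[of "vec x * y" "scl x *\<^sub>C y"] norm_mult_ineq[of "vec x" y]
      by (simp add: norm_scaleC)
  qed simp
  then show ?thesis by (simp add: norm_uz_def)
qed

instance
proof
  fix x y :: "'a uz" and r :: real
  show "norm x = 0 \<longleftrightarrow> x = 0"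
  proof
    assume "norm x = 0"
    then have "scl x = 0" "onorm (act x) \<le> 0"
      unfolding norm_uz_def by (metis max.cobounded2 norm_le_zero_iff, metis max.cobounded1)
    moreover from this have "norm (vec x) \<le> 0"
      using order_trans[OF norm_vec_le[of x], of 0] by simp
    ultimately show "x = 0" by (simp add: uz_eq_iff)
  next
    assume "x = 0"
    then show "norm x = 0"
      using norm_uz_le[of x] max.cobounded2[of "cmod (scl x)" "onorm (act x)"]
      by (simp add: norm_uz_def)
  qed
  have "act (x + y) = (\<lambda>z. act x z + act y z)"
    by (auto simp: act_def distrib_right scaleC_add_left)
  then have "onorm (act (x + y)) \<le> onorm (act x) + onorm (act y)"
    using onorm_triangle[OF bounded_linear_act bounded_linear_act, of x y] by simp
  then show "norm (x + y) \<le> norm x + norm y"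
    unfolding norm_uz_def using norm_triangle_ineq[of "scl x" "scl y"] by (auto simp: max_def)
  have "act (r *\<^sub>R x) = (\<lambda>z. r *\<^sub>R act x z)"
    using act_scaleC[of "of_real r" x] by (auto simp: scaleC_real)
  then have "onorm (act (r *\<^sub>R x)) = \<bar>r\<bar> * onorm (act x)"
    using onorm_scaleR[OF bounded_linear_act, of r x] by simp
  then show "norm (r *\<^sub>R x) = \<bar>r\<bar> * norm x"
    by (simp add: norm_uz_def norm_mult max_mult_distrib_left)
qed (simp_all add: dist_uz_def sgn_uz_def uniformity_uz_def open_uz_def)

end

instance uz :: (cstar_algebra) unital_cstar_algebra
proof
  fix x y :: "'a uz" and c :: complex and r :: real and X :: "nat \<Rightarrow> 'a uz"
  show "r *\<^sub>R x * y = r *\<^sub>R (x * y)" "x * r *\<^sub>R y = r *\<^sub>R (x * y)"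
    by (simp_all add: mult_scaleC_left mult_scaleC_right flip: scaleC_real)
  have ole: "onorm (act x) \<le> norm x" for x :: "'a uz" by (simp add: norm_uz_def)
  have sle: "cmod (scl x) \<le> norm x" for x :: "'a uz" by (simp add: norm_uz_def)
  have opos: "0 \<le> onorm (act x)" for x :: "'a uz" by (rule onorm_pos_le[OF bounded_linear_act])
  have scale_le: "norm (c *\<^sub>C x) \<le> cmod c * norm x" for c and x :: "'a uz"
  proof -
    have "norm (act (c *\<^sub>C x) y) \<le> cmod c * onorm (act x) * norm y" for y
    proof -
      show ?thesis
        using act_scaleC[of c x y] onorm[OF bounded_linear_act, of x y] by (simp add: norm_scaleC mult.assoc mult_left_mono)
    qed
    then have "onorm (act (c *\<^sub>C x)) \<le> cmod c * onorm (act x)"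
      using opos[of x] by (intro onorm_bound) auto
    also have "\<dots> \<le> cmod c * norm x" using ole by (intro mult_left_mono) auto
    finally show ?thesis
      using sle[of x] by (auto simp: norm_uz_def[of "c *\<^sub>C x"] norm_mult intro: mult_left_mono)
  qed
  show "norm (c *\<^sub>C x) = cmod c * norm x"
  proof (cases "c = 0")
    case False
    have "norm x = norm (inverse c *\<^sub>C c *\<^sub>C x)" using False by (simp add: scaleC_scaleC)
    also have "\<dots> \<le> inverse (cmod c) * norm (c *\<^sub>C x)"
      using scale_le[of "inverse c" "c *\<^sub>C x"] by (simp add: norm_inverse)
    finally have "cmod c * norm x \<le> norm (c *\<^sub>C x)"
      using False by (simp add: field_simps)
    then show ?thesis using scale_le[of c x] by simp
  qed simp
  show "norm (1 :: 'a uz) = 1"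
    using norm_uz_le[of "1 :: 'a uz"] sle[of 1] by simp
  have mult_le: "norm (x * y) \<le> norm x * norm y" for x y :: "'a uz"
  proof -
    have "act (x * y) = act x \<circ> act y" by (auto simp: act_mult)
    then have "onorm (act (x * y)) \<le> onorm (act x) * onorm (act y)"
      using onorm_compose[OF bounded_linear_act bounded_linear_act, of x y] by simp
    also have "\<dots> \<le> norm x * norm y" by (intro mult_mono ole opos norm_ge_zero)
    finally show ?thesis
      unfolding norm_uz_def[of "x * y"]
      using mult_mono[OF sle[of x] sle[of y]] by (simp add: norm_mult)
  qed
  then show "norm (x * y) \<le> norm x * norm y" .
  \<comment> \<open>The C*-identity of the original algebra turns the square of
    \<open>norm (act x y)\<close> into the norm of \<open>star y * act (star x * x) y\<close>; the
    scalar part satisfies the inequality directly.\<close>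
  have sq_le: "(norm x)\<^sup>2 \<le> norm (star x * x)" for x :: "'a uz"
  proof -
    have "norm (act x y) \<le> sqrt (norm (star x * x)) * norm y" for y
    proof (rule power2_le_imp_le)
      have "(norm (act x y))\<^sup>2 = norm (star y * act (star x * x) y)"
        by (simp add: cstar_identity[symmetric] star_act_mult act_mult)
      also have "\<dots> \<le> norm y * (onorm (act (star x * x)) * norm y)"
        using norm_mult_ineq[of "star y" "act (star x * x) y"] onorm[OF bounded_linear_act, of "star x * x" y]
        by (simp add: mult_left_mono order_trans)
      also have "\<dots> \<le> norm y * (norm (star x * x) * norm y)"
        using ole by (intro mult_mono) (auto simp: opos)
      finally show "(norm (act x y))\<^sup>2 \<le> (sqrt (norm (star x * x)) * norm y)\<^sup>2"
        by (simp add: power_mult_distrib power2_eq_square[of "norm y"] ac_simps)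
    qed simp
    then have "onorm (act x) \<le> sqrt (norm (star x * x))"
      by (intro onorm_bound) auto
    moreover have "cmod (scl x) \<le> sqrt (norm (star x * x))"
      using sle[of "star x * x"] by (intro real_le_rsqrt) (simp add: norm_mult power2_eq_square)
    ultimately have "norm x \<le> sqrt (norm (star x * x))" by (simp add: norm_uz_def[of x])
    then show ?thesis by (metis norm_ge_zero power_mono real_sqrt_pow2)
  qed
  have star_le: "norm x \<le> norm (star x)" for x :: "'a uz"
  proof (cases "x = 0")
    case False
    have "norm x * norm x \<le> norm (star x) * norm x"
      using sq_le[of x] mult_le[of "star x" x] by (simp add: power2_eq_square)
    then show ?thesis using False by simp
  qed simp
  have "norm (star x) \<le> norm x" using star_le[of "star x"] by (simp add: star_star)
  then have "norm (star x * x) \<le> (norm x)\<^sup>2"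
    using mult_le[of "star x" x] mult_right_mono[of "norm (star x)" "norm x" "norm x"]
    by (simp add: power2_eq_square)
  then show "norm (star x * x) = (norm x)\<^sup>2" using sq_le[of x] by simp
  show "convergent X" if X: "Cauchy X"
  proof -
    have vle: "norm (vec x) \<le> 2 * norm x" for x :: "'a uz"
      using norm_vec_le[of x] ole[of x] sle[of x] by simp
    have "Cauchy (\<lambda>n. vec (X n))"
    proof (rule CauchyI)
      fix e :: real assume "0 < e"
      then obtain N where N: "\<And>m n. m \<ge> N \<Longrightarrow> n \<ge> N \<Longrightarrow> norm (X m - X n) < e / 2"
        using CauchyD[OF X, of "e / 2"] by auto
      have "norm (vec (X m) - vec (X n)) < e" if "m \<ge> N" "n \<ge> N" for m n
        using vle[of "X m - X n"] N[OF that] by simp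
      then show "\<exists>M. \<forall>m\<ge>M. \<forall>n\<ge>M. norm (vec (X m) - vec (X n)) < e" by blast
    qed
    then obtain a where a: "(\<lambda>n. vec (X n)) \<longlonglongrightarrow> a"
      using Cauchy_convergent_iff convergent_def by blast
    have "Cauchy (\<lambda>n. scl (X n))"
    proof (rule CauchyI)
      fix e :: real assume "0 < e"
      then obtain N where N: "\<And>m n. m \<ge> N \<Longrightarrow> n \<ge> N \<Longrightarrow> norm (X m - X n) < e"
        using CauchyD[OF X, of e] by auto
      have "norm (scl (X m) - scl (X n)) < e" if "m \<ge> N" "n \<ge> N" for m n
        using sle[of "X m - X n"] N[OF that] by simp
      then show "\<exists>M. \<forall>m\<ge>M. \<forall>n\<ge>M. norm (scl (X m) - scl (X n)) < e" by blast
    qed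
    then obtain l where l: "(\<lambda>n. scl (X n)) \<longlonglongrightarrow> l"
      using Cauchy_convergent_iff convergent_def by blast
    have "(\<lambda>n. norm (vec (X n) - a) + cmod (scl (X n) - l)) \<longlonglongrightarrow> 0"
      using tendsto_add[OF tendsto_norm[OF LIM_zero[OF a]] tendsto_norm[OF LIM_zero[OF l]]] by simp
    then have "(\<lambda>n. norm (X n - Uz a l)) \<longlonglongrightarrow> 0"
    proof (rule tendsto_sandwich[OF _ _ tendsto_const, rotated 2])
      show "\<forall>\<^sub>F n in sequentially. norm (X n - Uz a l) \<le> norm (vec (X n) - a) + cmod (scl (X n) - l)"
        using norm_uz_le[of "X n - Uz a l" for n] by simp
    qed simp
    then have "X \<longlonglongrightarrow> Uz a l"
      using LIM_zero_cancel tendsto_norm_zero_iff by blast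
    then show ?thesis by (auto simp: convergent_def)
  qed
qed

definition emb :: "'a::cstar_algebra \<Rightarrow> 'a uz"
  where "emb x = Uz x 0"

lemma emb_simps [simp]: "vec (emb x) = x" "scl (emb x) = 0"
  by (simp_all add: emb_def)

lemma emb_hom:
  fixes x y :: "'a::cstar_algebra"
  shows "emb (x + y) = emb x + emb y" "emb (x - y) = emb x - emb y" "emb (- x) = - emb x"
    "emb (r *\<^sub>R x) = r *\<^sub>R emb x" "emb (c *\<^sub>C x) = c *\<^sub>C emb x" "emb (x * y) = emb x * emb y"
    "emb (star x) = star (emb x)" "emb (0::'a) = 0"
  by (simp_all add: uz_eq_iff)

lemma emb_inject [simp]: "emb x = emb y \<longleftrightarrow> x = y"
  by (simp add: emb_def)

lemma norm_emb [simp]: "norm (emb x) = norm x"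
proof (rule antisym)
  show "norm (emb x) \<le> norm x" using norm_uz_le[of "emb x"] by simp
  show "norm x \<le> norm (emb x)" using norm_vec_le[of "emb x"] by (simp add: norm_uz_def)
qed

lemma scl_le: "cmod (scl x) \<le> norm x"
  by (simp add: norm_uz_def)

lemma emb_vec: "scl x = 0 \<Longrightarrow> emb (vec x) = x"
  by (simp add: uz_eq_iff)

section \<open>Positive elements\<close>

lemma star_one [simp]: "star (1::'a::unital_cstar_algebra) = 1"
  using star_mult[of "star 1" "1::'a"] by (simp add: star_star)

text \<open>By \<open>cposI\<close> and \<open>cposD\<close>, being a self-adjoint square is
  equivalent to the condition \<open>norm (t *\<^sub>R 1 - h) \<le> t\<close> for suitable
  \<open>t\<close>, which takes the place of a statement about the spectrum.\<close>

definition cpos :: "'a::unital_cstar_algebra \<Rightarrow> bool"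
  where "cpos h \<longleftrightarrow> (\<exists>k. star k = k \<and> h = k * k)"

lemma cpos_sa: "cpos h \<Longrightarrow> star h = h"
  by (auto simp: cpos_def star_mult)

lemma cpos_square: "star k = k \<Longrightarrow> cpos (k * k)"
  by (auto simp: cpos_def)

lemma norm_square_sa: "star k = k \<Longrightarrow> norm (k * k) = (norm (k::'a::cstar_algebra))\<^sup>2"
  using cstar_identity[of k] by simp

text \<open>Since \<open>u\<close> and \<open>v\<close> commute, \<open>star z * z\<close> for
  \<open>z = u + \<i> *\<^sub>C v\<close> is the sum of the two squares, and \<open>u\<close> is the
  real part of \<open>z\<close>, hence no larger in norm.\<close>

lemma norm_square_le_sum:
  fixes u v :: "'a::cstar_algebra"
  assumes u: "star u = u" and v: "star v = v" and uv: "u * v = v * u"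
  shows "norm (u * u) \<le> norm (u * u + v * v)"
proof -
  define z where "z = u + \<i> *\<^sub>C v"
  have sz: "star z = u - \<i> *\<^sub>C v" by (simp add: z_def star_simps u v)
  have "star z * z = u * u + v * v"
    unfolding sz by (simp add: z_def algebra_simps scaleC_algebra uv)
  then have n: "norm (u * u + v * v) = (norm z)\<^sup>2" using cstar_identity[of z] by simp
  have "z + star z = 2 *\<^sub>R u" unfolding sz by (simp add: z_def scaleR_2)
  then have "2 * norm u \<le> norm z + norm (star z)"
    using norm_triangle_ineq[of z "star z"] by simp
  then have "norm u \<le> norm z" by simp
  then show ?thesis unfolding n norm_square_sa[OF u] by (simp add: power_mono)
qed

text \<open>\<open>1 - k * k\<close> has a root \<open>r\<close> commuting with \<open>k\<close>,
  and \<open>r * r + k * k = 1\<close>, so the preceding inequality applies.\<close>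

lemma norm_one_minus_square:
  fixes k :: "'a::unital_cstar_algebra"
  assumes k: "star k = k" "norm k \<le> 1"
  shows "norm (1 - k * k) \<le> 1"
proof -
  have a: "star (k * k) = k * k" and b: "norm (k * k) \<le> 1"
    using k by (simp_all add: norm_square_sa power_le_one star_mult)
  obtain s where s: "s \<in> UNIV" "star s = s" "norm s \<le> 1" "s + s - s * s = k * k"
      "\<And>y. y * (k * k) = (k * k) * y \<Longrightarrow> y * s = s * y"
    using sqrt_one_minus[OF cstar_subalgebra_UNIV UNIV_I a b] by blast
  have ks: "k * s = s * k" by (rule s(5)) (simp add: mult.assoc)
  define r where "r = 1 - s"
  have "r * r = 1 - (s + s - s * s)" by (simp add: r_def algebra_simps)
  then have rr: "r * r = 1 - k * k" by (simp add: s(4))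
  have "norm (r * r) \<le> norm (r * r + k * k)"
    using ks by (intro norm_square_le_sum) (auto simp: r_def star_diff s k algebra_simps)
  then show ?thesis by (simp add: rr)
qed

lemma norm_minus_square:
  fixes k :: "'a::unital_cstar_algebra"
  assumes k: "star k = k" and t: "norm (k * k) \<le> t"
  shows "norm (t *\<^sub>R 1 - k * k) \<le> t"
proof (cases "t = 0")
  case True
  then show ?thesis using t by simp
next
  case False
  then have t0: "t > 0" using t norm_ge_zero[of "k * k"] by linarith
  define l where "l = inverse (sqrt t) *\<^sub>R k"
  have ll: "l * l = inverse t *\<^sub>R (k * k)"
    using t0 by (simp add: l_def flip: inverse_mult_distrib)
  have "star l = l" by (simp add: l_def star_scaleR k)
  moreover have "norm l \<le> 1"
  proof -
    have "(norm l)\<^sup>2 = norm (k * k) / t"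
      using norm_square_sa[OF \<open>star l = l\<close>] t0 by (simp add: ll field_simps)
    also have "\<dots> \<le> 1" using t t0 by simp
    finally show ?thesis by (simp add: power2_le_iff_abs_le abs_square_le_1)
  qed
  ultimately have "norm (1 - l * l) \<le> 1" by (rule norm_one_minus_square)
  then have "t * norm (1 - l * l) \<le> t" using t0 by simp
  moreover have "t *\<^sub>R 1 - k * k = t *\<^sub>R (1 - l * l)"
    using t0 by (simp add: ll scaleR_diff_right)
  ultimately show ?thesis using t0 by simp
qed

text \<open>Rescaling to \<open>u = 1 - inverse t *\<^sub>R h\<close> makes the root of
  \<open>1 - u\<close> available. The bound on the root is recorded because by \<open>cposI\<close>
  it makes the root itself positive, not merely self-adjoint.\<close>

lemma sqrt_of_norm_le:
  fixes h :: "'a::unital_cstar_algebra"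
  assumes h: "star h = h" and t: "norm (t *\<^sub>R 1 - h) \<le> t"
  obtains k where "star k = k" "k * k = h" "norm (sqrt t *\<^sub>R 1 - k) \<le> sqrt t"
    "\<And>y. y * h = h * y \<Longrightarrow> y * k = k * y"
proof (cases "t = 0")
  case True
  then show ?thesis using t by (intro that[of 0]) auto
next
  case False
  then have t0: "t > 0" using t norm_ge_zero[of "t *\<^sub>R 1 - h"] by linarith
  define u where "u = 1 - inverse t *\<^sub>R h"
  have "t *\<^sub>R u = t *\<^sub>R 1 - h" using t0 by (simp add: u_def scaleR_diff_right)
  then have "norm (t *\<^sub>R u) \<le> t" using t by simp
  then have a: "star u = u" and b: "norm u \<le> 1" using t0 by (simp_all add: u_def star_simps h)
  obtain s where s: "s \<in> UNIV" "star s = s" "norm s \<le> 1" "s + s - s * s = u" "\<And>y. y * u = u * y \<Longrightarrow> y * s = s * y"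
    using sqrt_one_minus[OF cstar_subalgebra_UNIV UNIV_I a b] by blast
  define k where "k = sqrt t *\<^sub>R (1 - s)"
  show ?thesis
  proof
    show "star k = k" by (simp add: k_def star_simps s(2))
    have "(1 - s) * (1 - s) = 1 - (s + s - s * s)" by (simp add: algebra_simps)
    moreover have "sqrt t * sqrt t = t" using t0 by simp
    ultimately show "k * k = h" using t0 by (simp add: k_def s(4) u_def flip: mult.assoc)
    have "sqrt t *\<^sub>R 1 - k = sqrt t *\<^sub>R s" by (simp add: k_def scaleR_diff_right)
    then show "norm (sqrt t *\<^sub>R 1 - k) \<le> sqrt t" using s(3) t0 by simp
    show "y * k = k * y" if "y * h = h * y" for y
    proof -
      have "y * u = u * y" using that by (simp add: u_def algebra_simps)
      then show ?thesis using s(5)[of y] by (simp add: k_def algebra_simps)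
    qed
  qed
qed

lemma cposI:
  assumes "star h = h" "norm (t *\<^sub>R 1 - h) \<le> t"
  shows "cpos h"
  using sqrt_of_norm_le[OF assms] unfolding cpos_def by metis

lemma cposD:
  assumes "cpos h" "norm h \<le> t"
  shows "norm (t *\<^sub>R 1 - h) \<le> t"
  using assms norm_minus_square unfolding cpos_def by blast

lemma cpos_sqrt:
  assumes "cpos h"
  obtains k where "cpos k" "k * k = h" "\<And>y. y * h = h * y \<Longrightarrow> y * k = k * y"
  using sqrt_of_norm_le[OF cpos_sa[OF assms] cposD[OF assms order_refl]] cposI by metis

text \<open>A sum of squares is not visibly a square, but the norm condition is stable under
  addition by the triangle inequality.\<close>

lemma cpos_add:
  assumes "cpos h" "cpos k"
  shows "cpos (h + k)"
proof (rule cposI)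
  show "star (h + k) = h + k" using assms by (simp add: star_add cpos_sa)
  have eq: "(norm h + norm k) *\<^sub>R 1 - (h + k) = (norm h *\<^sub>R 1 - h) + (norm k *\<^sub>R 1 - k)"
    by (simp add: scaleR_add_left)
  show "norm ((norm h + norm k) *\<^sub>R 1 - (h + k)) \<le> norm h + norm k"
    using norm_triangle_ineq[of "norm h *\<^sub>R 1 - h" "norm k *\<^sub>R 1 - k"]
      cposD[OF assms(1) order_refl] cposD[OF assms(2) order_refl] unfolding eq by linarith
qed

lemma cpos_scale: "cpos h \<Longrightarrow> 0 \<le> r \<Longrightarrow> cpos (r *\<^sub>R h)"
proof -
  assume "cpos h" "0 \<le> r"
  then obtain k where "star k = k" "h = k * k" by (auto simp: cpos_def)
  then show ?thesis using \<open>0 \<le> r\<close> unfolding cpos_def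
    by (intro exI[of _ "sqrt r *\<^sub>R k"]) (simp add: star_scaleR)
qed

lemma cpos_zero [simp]: "cpos 0" and cpos_one [simp]: "cpos 1"
  unfolding cpos_def by (rule exI[of _ 0], simp, rule exI[of _ 1], simp)

text \<open>The roots inherit all commutation relations, so the product is the square of the
  self-adjoint \<open>a * b\<close>.\<close>

lemma cpos_mult:
  assumes "cpos h" "cpos k" "h * k = k * h"
  shows "cpos (h * k)"
proof -
  obtain a where a: "cpos a" "a * a = h" "\<And>y. y * h = h * y \<Longrightarrow> y * a = a * y"
    using cpos_sqrt[OF assms(1)] by metis
  obtain b where b: "cpos b" "b * b = k" "\<And>y. y * k = k * y \<Longrightarrow> y * b = b * y"
    using cpos_sqrt[OF assms(2)] by metis
  have "k * a = a * k" using a(3) assms(3) by simp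
  then have ab: "a * b = b * a" using b(3) by metis
  have "h * k = (a * b) * (a * b)" unfolding a(2)[symmetric] b(2)[symmetric] by (metis ab mult.assoc)
  moreover have "star (a * b) = a * b" using ab by (simp add: star_mult cpos_sa a b)
  ultimately show ?thesis unfolding cpos_def by blast
qed

lemma cpos_norm_minus:
  assumes "star h = h" "norm h \<le> t"
  shows "cpos (t *\<^sub>R 1 - h)"
  using assms by (intro cposI[where t = t]) (auto simp: star_simps)

text \<open>States of a unital algebra in the form that Hahn-Banach produces; positivity is a
  consequence, see \<open>nstate_real\<close> and \<open>nstate_cpos\<close>.\<close>

definition nstate :: "('a::unital_cstar_algebra \<Rightarrow> complex) \<Rightarrow> bool"
  where "nstate \<phi> \<longleftrightarrow> clinear \<phi> \<and> \<phi> 1 = 1 \<and> (\<forall>x. cmod (\<phi> x) \<le> norm x)"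

lemma clinearD:
  assumes "clinear (\<phi> :: 'a::complex_vector \<Rightarrow> complex)"
  shows "\<phi> (x + y) = \<phi> x + \<phi> y" "\<phi> (x - y) = \<phi> x - \<phi> y" "\<phi> (- x) = - \<phi> x" "\<phi> 0 = 0"
    "\<phi> (c *\<^sub>C x) = c * \<phi> x" "\<phi> (r *\<^sub>R x) = of_real r * \<phi> x"
proof -
  note * = linear_functional_onD[of UNIV \<phi>, unfolded linear_functional_UNIV, OF assms complex_vector.subspace_UNIV]
  show "\<phi> (x + y) = \<phi> x + \<phi> y" "\<phi> (x - y) = \<phi> x - \<phi> y" "\<phi> (- x) = - \<phi> x" "\<phi> 0 = 0"
    "\<phi> (c *\<^sub>C x) = c * \<phi> x" "\<phi> (r *\<^sub>R x) = of_real r * \<phi> x"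
    using * by auto
qed

text \<open>Shifting \<open>h\<close> by an imaginary scalar of size \<open>s\<close> raises the
  squared norm by at most \<open>s\<^sup>2\<close>, whereas the squared imaginary part grows by
  \<open>2 * s * b + s\<^sup>2\<close>. For real \<open>s\<close> of either sign this forces
  \<open>b = 0\<close>.\<close>

lemma nstate_real:
  assumes \<phi>: "nstate \<phi>" and h: "star h = h"
  shows "\<phi> h \<in> \<real>"
proof -
  have lin: "clinear \<phi>" and one: "\<phi> 1 = 1" and le: "\<And>x. cmod (\<phi> x) \<le> norm x"
    using \<phi> by (auto simp: nstate_def)
  define b where "b = Im (\<phi> h)"
  have *: "2 * s * b \<le> (norm h)\<^sup>2" for s :: real
  proof -
    define z where "z = h + (\<i> * of_real s) *\<^sub>C 1"
    have "star z * z = h * h + (s * s) *\<^sub>R 1"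
      by (simp add: z_def star_simps h algebra_simps scaleC_algebra flip: scaleC_real)
    then have "(norm z)\<^sup>2 = norm (h * h + (s * s) *\<^sub>R 1)" using cstar_identity[of z] by simp
    also have "\<dots> \<le> (norm h)\<^sup>2 + s\<^sup>2"
      using norm_triangle_ineq[of "h * h" "(s * s) *\<^sub>R 1"] norm_square_sa[OF h]
      by (simp add: power2_eq_square)
    finally have z: "(norm z)\<^sup>2 \<le> (norm h)\<^sup>2 + s\<^sup>2" .
    have "\<phi> z = \<phi> h + \<i> * of_real s" by (simp add: z_def clinearD[OF lin] one)
    then have "b + s = Im (\<phi> z)" by (simp add: b_def)
    then have "\<bar>b + s\<bar> \<le> norm z" using abs_Im_le_cmod[of "\<phi> z"] le[of z] by simp
    then have "(b + s)\<^sup>2 \<le> (norm z)\<^sup>2" by (metis abs_ge_zero power2_abs power_mono)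
    moreover have "(b + s)\<^sup>2 = b\<^sup>2 + 2 * s * b + s\<^sup>2" by (simp add: power2_sum)
    ultimately show ?thesis using z zero_le_power2[of b] by linarith
  qed
  have "b = 0"
  proof (rule ccontr)
    assume "b \<noteq> 0"
    then have "2 * (((norm h)\<^sup>2 + 1) / (2 * b)) * b = (norm h)\<^sup>2 + 1" by simp
    then show False using *[of "((norm h)\<^sup>2 + 1) / (2 * b)"] by linarith
  qed
  then show ?thesis by (simp add: b_def complex_is_Real_iff)
qed

lemma nstate_cpos:
  assumes \<phi>: "nstate \<phi>" and h: "cpos h"
  shows "\<phi> h \<in> \<real>\<^sub>\<ge>\<^sub>0" "0 \<le> Re (\<phi> h)"
proof -
  have lin: "clinear \<phi>" and one: "\<phi> 1 = 1" and le: "\<And>x. cmod (\<phi> x) \<le> norm x"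
    using \<phi> by (auto simp: nstate_def)
  have r: "\<phi> h \<in> \<real>" by (rule nstate_real[OF \<phi> cpos_sa[OF h]])
  have "cmod (\<phi> (norm h *\<^sub>R 1 - h)) \<le> norm h"
    using order_trans[OF le cposD[OF h order_refl]] .
  then have "Re (\<phi> (norm h *\<^sub>R 1 - h)) \<le> norm h" using complex_Re_le_cmod[of "\<phi> (norm h *\<^sub>R 1 - h)"] by linarith
  then show "0 \<le> Re (\<phi> h)" by (simp add: clinearD[OF lin] one)
  then show "\<phi> h \<in> \<real>\<^sub>\<ge>\<^sub>0" using r by (simp add: complex_nonneg_Reals_iff complex_is_Real_iff)
qed

text \<open>Hahn-Banach is applied on the line through \<open>q = p + t *\<^sub>R 1\<close> with
  \<open>t = norm p\<close>, not through \<open>p\<close>: the norm of \<open>q\<close> is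
  \<open>2 * t\<close>, and a contractive functional that reaches it must satisfy
  \<open>F p = t\<close> and \<open>F 1 = 1\<close> simultaneously.\<close>

lemma nstate_norm_cpos:
  fixes p :: "'a::unital_cstar_algebra"
  assumes p: "cpos p"
  obtains \<phi> where "nstate \<phi>" "\<phi> p = norm p"
proof -
  define t where "t = norm p"
  have t0: "t \<ge> 0" by (simp add: t_def)
  define q where "q = p + t *\<^sub>R 1"
  have nq: "norm q = 2 * t"
  proof (rule antisym)
    show "norm q \<le> 2 * t" using norm_triangle_ineq[of p "t *\<^sub>R 1"] by (simp add: q_def t_def)
    obtain k where k: "star k = k" "p = k * k" using p by (auto simp: cpos_def)
    \<comment> \<open>With a root \<open>r\<close> of \<open>t - p\<close> that commutes with
      \<open>k\<close>, the element \<open>q\<close> is \<open>2 p + r * r\<close>, so the norm of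
      \<open>2 p\<close> bounds that of \<open>q\<close> from below.\<close>
    obtain r where r: "star r = r" "r * r = t *\<^sub>R 1 - p" "\<And>y. y * (t *\<^sub>R 1 - p) = (t *\<^sub>R 1 - p) * y \<Longrightarrow> y * r = r * y"
      using cpos_sqrt[OF cpos_norm_minus[of p t]] cpos_sa p t_def by (metis order_refl)
    have kr: "k * r = r * k" by (rule r(3)) (simp add: k algebra_simps)
    have "norm ((sqrt 2 *\<^sub>R k) * (sqrt 2 *\<^sub>R k)) \<le> norm ((sqrt 2 *\<^sub>R k) * (sqrt 2 *\<^sub>R k) + r * r)"
      by (rule norm_square_le_sum) (auto simp: star_scaleR k r kr)
    also have "(sqrt 2 *\<^sub>R k) * (sqrt 2 *\<^sub>R k) + r * r = q"
      by (simp add: r q_def k scaleR_2)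
    finally show "2 * t \<le> norm q" by (simp add: t_def k)
  qed
  show ?thesis
  proof (cases "t = 0")
    \<comment> \<open>Here \<open>p = 0\<close>, and any normalized contractive functional serves;
      one is extended from the scalars.\<close>
    case True
    define V :: "'a set" where "V = cspan {1}"
    have VC: "V = range (\<lambda>c. c *\<^sub>C 1)" by (simp add: V_def complex_vector.span_singleton)
    define f :: "'a \<Rightarrow> complex" where "f x = (THE c. x = c *\<^sub>C 1)" for x
    have f: "f (c *\<^sub>C 1) = c" for c
      unfolding f_def
    proof (rule the_equality)
      fix d assume "c *\<^sub>C (1::'a) = d *\<^sub>C 1"
      then have "norm ((c - d) *\<^sub>C (1::'a)) = 0" by (simp add: scaleC_diff)
      then show "d = c" by (simp add: norm_scaleC)
    qed simp
    obtain F where F: "clinear F" "\<And>x. x \<in> V \<Longrightarrow> F x = f x" "\<And>x. cmod (F x) \<le> norm x"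
    proof (rule hahn_banach[of V f])
      show "csubspace V" by (simp add: V_def complex_vector.subspace_span)
      show "linear_functional_on V f"
        by (auto simp: linear_functional_on_def VC f scaleC_scaleC simp flip: scaleC_add_left)
      show "cmod (f x) \<le> norm x" if "x \<in> V" for x using that by (auto simp: VC f norm_scaleC)
    qed auto
    have "F 1 = 1" using F(2)[of 1] f[of 1] by (simp add: V_def complex_vector.span_base)
    then have "nstate F" using F by (auto simp: nstate_def)
    moreover have "F p = norm p" using F(3)[of p] True by (simp add: t_def)
    ultimately show ?thesis by (rule that)
  next
    case False
    then have t0: "t > 0" using t0 by simp
    define V :: "'a set" where "V = cspan {q}"
    have VC: "V = range (\<lambda>c. c *\<^sub>C q)" by (simp add: V_def complex_vector.span_singleton)
    have q0: "q \<noteq> 0" using nq t0 by auto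
    define f :: "'a \<Rightarrow> complex" where "f x = (THE c. x = c *\<^sub>C q) * (2 * t)" for x
    have f: "f (c *\<^sub>C q) = c * (2 * t)" for c
    proof -
      have "(THE d. c *\<^sub>C q = d *\<^sub>C q) = c"
        using q0 by (intro the_equality) (auto simp: complex_vector.scale_cancel_right)
      then show ?thesis by (simp add: f_def)
    qed
    obtain F where F: "clinear F" "\<And>x. x \<in> V \<Longrightarrow> F x = f x" "\<And>x. cmod (F x) \<le> norm x"
    proof (rule hahn_banach[of V f])
      show "csubspace V" by (simp add: V_def complex_vector.subspace_span)
      show "linear_functional_on V f"
        by (auto simp: linear_functional_on_def VC f scaleC_scaleC simp flip: scaleC_add_left)
          (simp_all add: distrib_right)
      show "cmod (f x) \<le> norm x" if "x \<in> V" for x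
        using that t0 by (auto simp: VC f norm_scaleC nq norm_mult)
    qed auto
    have "F q = 2 * t" using F(2)[of q] f[of 1] by (simp add: V_def complex_vector.span_base)
    then have e: "F p + of_real t * F 1 = 2 * t" by (simp add: q_def clinearD[OF F(1)])
    have F1: "cmod (F 1) \<le> 1" and Fp: "cmod (F p) \<le> t" using F(3)[of 1] F(3)[of p] by (auto simp: t_def)
    have re: "Re (F p) + t * Re (F 1) = 2 * t" using arg_cong[OF e, of Re] by simp
    have "Re (F p) \<le> t" using complex_Re_le_cmod[of "F p"] Fp by linarith
    then have "t * Re (F 1) \<ge> t" using re by linarith
    then have "Re (F 1) \<ge> 1" using t0 by simp
    then have R1: "Re (F 1) = 1" using complex_Re_le_cmod[of "F 1"] F1 by linarith
    then have "1 + (Im (F 1))\<^sup>2 \<le> 1"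
      using power_mono[OF F1 norm_ge_zero, of 2] cmod_power2[of "F 1"] by simp
    then have one: "F 1 = 1" using R1 by (simp add: complex_eq_iff)
    then have "F p = norm p" using e by (simp add: t_def)
    moreover have "nstate F" using F one by (auto simp: nstate_def)
    ultimately show ?thesis using that by blast
  qed
qed

text \<open>A negative \<open>y\<^sup>* y = - q\<close> would make \<open>p = y y\<^sup>*\<close> positive and
  \<open>t p + p\<^sup>2 = y (t - q) y\<^sup>*\<close> of norm at most \<open>t\<^sup>2\<close> where \<open>t = \<parallel>p\<parallel>\<close>, although a state attaining the
  norm of \<open>p\<close> takes a value at least \<open>2 t\<^sup>2\<close> there. Apply this to \<open>y = x (\<bar>h\<bar> - h)\<close>, \<open>h = x\<^sup>* x\<close>.\<close>

lemma cpos_star_mult: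
  fixes x :: "'a::unital_cstar_algebra"
  shows "cpos (star x * x)"
proof -
  define h where "h = star x * x"
  have sh: "star h = h" by (simp add: h_def star_simps)
  obtain a where a: "cpos a" "a * a = h * h" "\<And>y. y * (h * h) = (h * h) * y \<Longrightarrow> y * a = a * y"
    using cpos_sqrt[OF cpos_square[OF sh]] by metis
  have ha: "h * a = a * h" by (rule a(3)) (simp add: mult.assoc)
  define m where "m = a - h"
  have sm: "star m = m" by (simp add: m_def star_simps cpos_sa a(1) sh)
  have hm: "h * m = - (a * m)" by (simp add: m_def algebra_simps ha a(2))
  have am: "m * a = a * m" by (simp add: m_def algebra_simps ha)
  obtain b where b: "cpos b" "b * b = a" "\<And>y. y * a = a * y \<Longrightarrow> y * b = b * y"
    using cpos_sqrt[OF a(1)] by metis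
  have bm: "m * b = b * m" using b(3)[OF am] .
  define y where "y = x * m"
  define q where "q = (b * m) * (b * m)"
  have sbm: "star (b * m) = b * m" by (simp add: star_mult sm cpos_sa b(1) bm)
  have q: "cpos q" unfolding q_def by (rule cpos_square[OF sbm])
  have yy: "star y * y = - q"
  proof -
    have "star y * y = m * (h * m)" by (simp add: y_def star_mult sm h_def mult.assoc)
    also have "\<dots> = - (m * a * m)" by (simp add: hm mult.assoc)
    also have "m * a * m = q" by (metis q_def b(2) bm mult.assoc)
    finally show ?thesis .
  qed
  have "y = 0"
  proof (rule ccontr)
    assume "y \<noteq> 0"
    define t where "t = (norm y)\<^sup>2"
    have t: "t > 0" using \<open>y \<noteq> 0\<close> by (simp add: t_def)
    define p where "p = y * star y"
    have sp: "star p = p" by (simp add: p_def star_simps)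
    have np: "norm p = t" by (simp add: p_def t_def cstar_identity')
    have nq: "norm q = t" using cstar_identity[of y] by (simp add: yy t_def)
    \<comment> \<open>Up to sign, \<open>u\<close> and \<open>v\<close> are twice the real and
      imaginary parts of \<open>y\<close>. Their squares sum to twice
      \<open>y * star y + star y * y\<close>, which exhibits \<open>p\<close> as a sum of positive
      elements.\<close>
    define u where "u = y + star y"
    define v where "v = \<i> *\<^sub>C (y - star y)"
    have "star u = u" by (simp add: u_def star_simps)
    have "star v = v" by (simp add: v_def star_simps scaleC_diff)
    have "u * u + v * v = 2 *\<^sub>R (p + star y * y)"
      unfolding u_def v_def p_def by (simp add: algebra_simps scaleC_algebra scaleR_2)
    then have "p = (1/2) *\<^sub>R (u * u + v * v) + q" by (simp add: yy)
    moreover have "cpos ((1/2) *\<^sub>R (u * u + v * v) + q)"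
      using \<open>star u = u\<close> \<open>star v = v\<close> q by (intro cpos_add cpos_scale cpos_square) auto
    ultimately have "cpos p" by simp
    then obtain \<phi> where \<phi>: "nstate \<phi>" "\<phi> p = norm p" by (rule nstate_norm_cpos)
    have lin: "clinear \<phi>" and one: "\<phi> 1 = 1" and le: "\<And>x. cmod (\<phi> x) \<le> norm x"
      using \<phi> by (auto simp: nstate_def)
    have "cpos ((t *\<^sub>R 1 - p) * (t *\<^sub>R 1 - p))"
      by (rule cpos_square) (simp add: star_simps sp)
    moreover have "(t *\<^sub>R 1 - p) * (t *\<^sub>R 1 - p) = (t * t) *\<^sub>R 1 - (2 * t) *\<^sub>R p + p * p"
      by (simp add: algebra_simps flip: scaleR_2)
    ultimately have "0 \<le> Re (\<phi> ((t * t) *\<^sub>R 1 - (2 * t) *\<^sub>R p + p * p))"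
      using nstate_cpos(2)[OF \<phi>(1)] by metis
    then have 1: "t * t \<le> Re (\<phi> (p * p))" by (simp add: clinearD[OF lin] one \<phi>(2) np)
    have "t *\<^sub>R p + p * p = y * (t *\<^sub>R 1 - q) * star y"
    proof -
      have "p * p = y * (star y * y) * star y" by (simp add: p_def mult.assoc)
      then show ?thesis by (simp add: yy p_def algebra_simps)
    qed
    then have "norm (t *\<^sub>R p + p * p) \<le> norm y * norm (t *\<^sub>R 1 - q) * norm y"
      using norm_mult_ineq[of "y * (t *\<^sub>R 1 - q)" "star y"]
        mult_right_mono[OF norm_mult_ineq[of y "t *\<^sub>R 1 - q"] norm_ge_zero[of y]] by simp
    also have "\<dots> \<le> norm y * t * norm y"
      using cposD[OF q, of t] nq by (intro mult_mono) (auto simp: t_def)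
    also have "\<dots> = t * t" by (simp add: t_def power2_eq_square)
    finally have "Re (\<phi> (t *\<^sub>R p + p * p)) \<le> t * t"
      using le[of "t *\<^sub>R p + p * p"] complex_Re_le_cmod[of "\<phi> (t *\<^sub>R p + p * p)"] by linarith
    then have "t * t + Re (\<phi> (p * p)) \<le> t * t" by (simp add: clinearD[OF lin] \<phi>(2) np)
    then show False using 1 t mult_pos_pos[OF t t] by linarith
  qed
  then have "q = 0" using yy by simp
  then have "b * m = 0" using norm_square_sa[OF sbm] by (simp add: q_def)
  then have am0: "a * m = 0" by (metis b(2) mult.assoc mult_zero_right)
  have "m * m = a * m - h * m" by (simp add: m_def left_diff_distrib)
  then have "m * m = 0" by (simp add: hm am0)
  then have "m = 0" using norm_square_sa[OF sm] by simp
  then show ?thesis using a(1) by (simp add: m_def h_def)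
qed

lemma nstate_star_mult:
  assumes "nstate \<phi>"
  shows "\<phi> (star x * x) \<in> \<real>\<^sub>\<ge>\<^sub>0"
  by (rule nstate_cpos(1)[OF assms cpos_star_mult])

text \<open>A state that attains the norm of \<open>q\<close> does not decrease in passing from
  \<open>q\<close> to \<open>p\<close>.\<close>

lemma norm_le_cpos:
  assumes "cpos q" "cpos (p - q)"
  shows "norm q \<le> norm p"
proof -
  obtain \<phi> where \<phi>: "nstate \<phi>" "\<phi> q = norm q" using nstate_norm_cpos[OF assms(1)] .
  then have lin: "clinear \<phi>" and le: "\<And>x. cmod (\<phi> x) \<le> norm x" by (auto simp: nstate_def)
  have "norm q \<le> Re (\<phi> p)"
    using nstate_cpos(2)[OF \<phi>(1) assms(2)] by (simp add: clinearD[OF lin] \<phi>(2))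
  then show ?thesis using le[of p] complex_Re_le_cmod[of "\<phi> p"] by linarith
qed

text \<open>Monotonicity of the norm, phrased with squares so that no order on a non-unital algebra
  has to be introduced; the comparison happens in the unitization.\<close>

lemma norm_le_sum_squares:
  fixes x y z :: "'a::cstar_algebra"
  assumes "star z * z = star x * x + star y * y"
  shows "norm x \<le> norm z"
proof -
  have "norm (star (emb x) * emb x) \<le> norm (star (emb z) * emb z)"
  proof (rule norm_le_cpos[OF cpos_star_mult])
    have "star (emb z) * emb z - star (emb x) * emb x = star (emb y) * emb y"
      by (simp add: assms flip: emb_hom)
    then show "cpos (star (emb z) * emb z - star (emb x) * emb x)" by (simp add: cpos_star_mult)
  qed
  then show ?thesis by (simp add: cstar_identity)
qed

lemma cpos_power: "cpos g \<Longrightarrow> cpos (g ^ n)"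
proof (induction n)
  case (Suc n)
  then show ?case using cpos_mult[of g "g ^ n"] by (simp add: power_commutes)
qed simp

text \<open>With \<open>g = 1 - h\<close>, the \<open>m + 1\<close> terms \<open>h * g ^ j\<close>,
  \<open>j \<le> m\<close>, telescope to \<open>1 - g ^ (m + 1)\<close>, and each dominates the last
  one. Hence \<open>m + 1\<close> copies of \<open>h * g ^ m\<close> stay below 1.\<close>

lemma norm_power_decay:
  fixes h :: "'a::unital_cstar_algebra"
  assumes h: "cpos h" "cpos (1 - h)"
  shows "norm (h * (1 - h) ^ m) \<le> 1 / (real m + 1)"
proof -
  define g where "g = 1 - h"
  have hg: "h = 1 - g" by (simp add: g_def)
  have g: "cpos g" using h by (simp add: g_def)
  have comm: "h * g ^ j = g ^ j * h" for j by (simp add: hg algebra_simps power_commutes)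
  have "norm g \<le> 1" using norm_le_cpos[OF g, of 1] h by (simp add: hg)
  then have "norm (g ^ j) \<le> 1" for j
    using norm_power_ineq[of g j] power_le_one[of "norm g" j] by simp
  then have one: "cpos (1 - g ^ j)" for j
    using cpos_norm_minus[of "g ^ j" 1] cpos_sa[OF cpos_power[OF g]] by simp
  have pos: "cpos (h * g ^ j)" for j
    using cpos_mult[OF h(1) cpos_power[OF g] comm] .
  have tel: "(\<Sum>j<n. h * g ^ j) = 1 - g ^ n" for n
    by (induction n) (simp_all add: hg algebra_simps)
  have diff: "cpos (h * g ^ j - h * g ^ m)" if "j \<le> m" for j
  proof -
    have "h * g ^ m = h * g ^ j * g ^ (m - j)" using that by (simp add: mult.assoc flip: power_add)
    then have "h * g ^ j - h * g ^ m = (h * g ^ j) * (1 - g ^ (m - j))" by (simp add: right_diff_distrib)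
    moreover have "(h * g ^ j) * (1 - g ^ (m - j)) = (1 - g ^ (m - j)) * (h * g ^ j)"
    proof -
      have "h * g ^ j * g ^ (m - j) = g ^ (m - j) * (h * g ^ j)"
        by (metis comm mult.assoc power_add add.commute)
      then show ?thesis by (simp add: algebra_simps)
    qed
    ultimately show ?thesis using cpos_mult[OF pos one] by metis
  qed
  have "cpos (\<Sum>j\<in>J. h * g ^ j - h * g ^ m)" if "finite J" "J \<subseteq> {..m}" for J
    using that by (induction J) (auto intro!: cpos_add diff)
  from this[of "{..<Suc m}"] have "cpos ((\<Sum>j<Suc m. h * g ^ j) - (\<Sum>j<Suc m. h * g ^ m))"
    by (simp only: sum_subtractf) (simp add: lessThan_Suc_atMost)
  then have "cpos (1 - g ^ Suc m - real (Suc m) *\<^sub>R (h * g ^ m))"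
    by (simp only: tel sum_constant_scaleR card_lessThan)
  from cpos_add[OF this cpos_power[OF g, of "Suc m"]]
  have "cpos (1 - real (Suc m) *\<^sub>R (h * g ^ m))" by simp
  then have "norm (real (Suc m) *\<^sub>R (h * g ^ m)) \<le> norm (1::'a)"
    by (intro norm_le_cpos cpos_scale pos) auto
  then have "real (Suc m) * norm (h * g ^ m) \<le> 1" by simp
  then show ?thesis by (simp add: g_def field_simps)
qed

section \<open>Quasi-states and characters\<close>

text \<open>Quasi-states restrict to quasi-states, whereas the restriction of a state may have smaller norm.\<close>

definition quasi_state_on :: "'a::cstar_algebra set \<Rightarrow> ('a \<Rightarrow> complex) \<Rightarrow> bool"
  where "quasi_state_on C f \<longleftrightarrow>
    linear_functional_on C f \<and> positive_on C f \<and> (\<forall>x\<in>C. cmod (f x) \<le> norm x)"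

definition character_on :: "'a::cstar_algebra set \<Rightarrow> ('a \<Rightarrow> complex) \<Rightarrow> bool"
  where "character_on C f \<longleftrightarrow> linear_functional_on C f \<and> (\<forall>x\<in>C. \<forall>y\<in>C. f (x * y) = f x * f y)"

section \<open>Cauchy-Schwarz inequality and approximate units\<close>

lemma cnj_mult_self: "cnj z * z = of_real ((cmod z)\<^sup>2)" "z * cnj z = of_real ((cmod z)\<^sup>2)"
  by (simp_all only: complex_norm_square mult.commute[of "cnj z"])

lemma nonneg_Reals_Re: "z \<in> \<real>\<^sub>\<ge>\<^sub>0 \<Longrightarrow> 0 \<le> Re z" "z \<in> \<real>\<^sub>\<ge>\<^sub>0 \<Longrightarrow> z = of_real (Re z)"
  by (auto simp: complex_nonneg_Reals_iff complex_eq_iff)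

text \<open>The coefficients are those of a positive sesquilinear form on two vectors. The values
  \<open>l = 1\<close> and \<open>l = \<i>\<close> give symmetry; \<open>l = - r * cnj b\<close>
  gives a real quadratic inequality in \<open>r\<close>, used at \<open>r = 1 / Re q\<close>, or at
  a large \<open>r\<close> if \<open>Re q = 0\<close>.\<close>

lemma psd_form:
  assumes form: "\<And>l. p + l * b + cnj l * c + of_real ((cmod l)\<^sup>2) * q \<in> \<real>\<^sub>\<ge>\<^sub>0"
    and p: "p \<in> \<real>\<^sub>\<ge>\<^sub>0" and q: "q \<in> \<real>\<^sub>\<ge>\<^sub>0"
  shows "c = cnj b" "(cmod b)\<^sup>2 \<le> Re p * Re q"
proof -
  have p': "Im p = 0" "0 \<le> Re p" and q': "Im q = 0" "0 \<le> Re q" using p q by (auto simp: complex_nonneg_Reals_iff)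
  have "Im (b + c) = 0" "Im (\<i> * b - \<i> * c) = 0"
    using form[of 1] form[of \<i>] by (auto simp: complex_nonneg_Reals_iff p' q')
  then show c: "c = cnj b" by (simp add: complex_eq_iff)
  have f: "0 \<le> Re p - 2 * r * (cmod b)\<^sup>2 + r\<^sup>2 * (cmod b)\<^sup>2 * Re q" for r :: real
  proof -
    have bb: "cnj b * b = of_real ((cmod b)\<^sup>2)" by (rule cnj_mult_self)
    have "p + (- of_real r * cnj b) * b + cnj (- of_real r * cnj b) * c + of_real ((cmod (- of_real r * cnj b))\<^sup>2) * q
      = p - 2 * of_real r * (cnj b * b) + of_real (r\<^sup>2 * (cmod b)\<^sup>2) * q"
      by (simp add: c norm_mult power_mult_distrib algebra_simps)
    also have "Re \<dots> = Re p - 2 * r * (cmod b)\<^sup>2 + r\<^sup>2 * (cmod b)\<^sup>2 * Re q"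
      unfolding bb by simp
    finally show ?thesis using form[of "- of_real r * cnj b"] nonneg_Reals_Re(1) by metis
  qed
  show "(cmod b)\<^sup>2 \<le> Re p * Re q"
  proof (cases "Re q = 0")
    case True
    have "(cmod b)\<^sup>2 = 0"
    proof (rule ccontr)
      assume "(cmod b)\<^sup>2 \<noteq> 0"
      then show False using f[of "(Re p + 1) / (2 * (cmod b)\<^sup>2)"] True by simp
    qed
    then show ?thesis using True by simp
  next
    case False
    then have "Re q > 0" using q' by simp
    then show ?thesis using f[of "1 / Re q"] by (simp add: field_simps power2_eq_square)
  qed
qed

lemma positive_onD: "positive_on C f \<Longrightarrow> x \<in> C \<Longrightarrow> f (star x * x) \<in> \<real>\<^sub>\<ge>\<^sub>0"
  by (simp add: positive_on_def)

lemma positive_form: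
  assumes C: "cstar_subalgebra C" and lin: "linear_functional_on C f" and pos: "positive_on C f"
    and x: "x \<in> C" and y: "y \<in> C"
  shows "f (star y * x) = cnj (f (star x * y))"
    and "(cmod (f (star x * y)))\<^sup>2 \<le> Re (f (star x * x)) * Re (f (star y * y))"
proof -
  note lf = linear_functional_onD[OF lin cstar_subalgebraD(1)[OF C]]
  note cl = cstar_subalgebraD[OF C]
  have form: "f (star x * x) + l * f (star x * y) + cnj l * f (star y * x) + of_real ((cmod l)\<^sup>2) * f (star y * y) \<in> \<real>\<^sub>\<ge>\<^sub>0" for l
  proof -
    have "star (x + l *\<^sub>C y) * (x + l *\<^sub>C y) = star x * x + l *\<^sub>C (star x * y) + cnj l *\<^sub>C (star y * x) + (cnj l * l) *\<^sub>C (star y * y)"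
      by (simp add: star_simps scaleC_algebra distrib_left distrib_right mult.commute)
    also have "cnj l * l = of_real ((cmod l)\<^sup>2)" by (rule cnj_mult_self)
    finally have "f (star (x + l *\<^sub>C y) * (x + l *\<^sub>C y)) =
        f (star x * x) + l * f (star x * y) + cnj l * f (star y * x) + of_real ((cmod l)\<^sup>2) * f (star y * y)"
      using x y by (simp add: lf cl del: of_real_power)
    then show ?thesis using positive_onD[OF pos, of "x + l *\<^sub>C y"] x y by (simp add: cl)
  qed
  show "f (star y * x) = cnj (f (star x * y))"
    and "(cmod (f (star x * y)))\<^sup>2 \<le> Re (f (star x * x)) * Re (f (star y * y))"
    using psd_form[OF form] positive_onD[OF pos] x y by auto
qed

text \<open>Take \<open>e = 1 - (1 - h) ^ n\<close> with \<open>h\<close> the normalized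
  \<open>x * star x\<close>; as a polynomial in \<open>h\<close> without constant term it lies in
  \<open>C\<close>. The error is \<open>- (1 - h) ^ n * x\<close>, whose squared norm is
  \<open>M\<close> times the norm of \<open>h * (1 - h) ^ (2 * n)\<close>.\<close>

lemma approximate_left_unit:
  assumes C: "cstar_subalgebra C" and x: "x \<in> C" and e: "\<epsilon> > 0"
  obtains e where "e \<in> C" "star e = e" "norm e \<le> 1" "norm (e * x - x) < \<epsilon>"
proof (cases "x = 0")
  case True
  then show ?thesis using e by (intro that[of 0]) (auto simp: cstar_subalgebraD[OF C])
next
  case False
  note cl = cstar_subalgebraD[OF C]
  define M where "M = (norm x)\<^sup>2"
  have M: "M > 0" using False by (simp add: M_def)
  define k where "k = inverse M *\<^sub>R (x * star x)"
  have k: "k \<in> C" by (simp add: k_def cl x)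
  define h where "h = emb k"
  have h_eq: "h = inverse M *\<^sub>R (star (star (emb x)) * star (emb x))"
    by (simp add: h_def k_def star_star flip: emb_hom)
  have h: "cpos h" unfolding h_eq using M by (intro cpos_scale cpos_star_mult) auto
  have "norm h = 1" using M by (simp add: h_def k_def cstar_identity' M_def)
  then have h1: "cpos (1 - h)" using cpos_norm_minus[OF cpos_sa[OF h], of 1] by simp
  define g where "g = 1 - h"
  have hg: "h = 1 - g" by (simp add: g_def)
  have g: "cpos g" using h1 by (simp add: g_def)
  have sg: "star (g ^ n) = g ^ n" for n by (rule cpos_sa[OF cpos_power[OF g]])
  have "norm g \<le> 1" using norm_le_cpos[OF g, of 1] h by (simp add: g_def)
  then have ng: "norm (g ^ n) \<le> 1" for n
    using norm_power_ineq[of g n] power_le_one[of "norm g" n] by simp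
  have ex: "\<exists>e\<in>C. emb e = 1 - g ^ n" for n
  proof (induction n)
    case 0
    then show ?case using cl by (intro bexI[of _ 0]) (auto simp: emb_hom)
  next
    case (Suc n)
    then obtain e where e: "e \<in> C" "emb e = 1 - g ^ n" by blast
    have "1 - g ^ Suc n = emb (e + k - e * k)"
      by (simp add: emb_hom e(2) flip: h_def) (simp add: hg algebra_simps power_commutes)
    then show ?case using cl e k by (metis (no_types))
  qed
  obtain n where n: "M / (2 * real n + 1) < \<epsilon>\<^sup>2"
  proof -
    obtain n where "M / \<epsilon>\<^sup>2 < real n" using reals_Archimedean2 by blast
    then have "M < \<epsilon>\<^sup>2 * real n" using e by (simp add: field_simps)
    also have "\<dots> \<le> \<epsilon>\<^sup>2 * (2 * real n + 1)" by (intro mult_left_mono) auto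
    finally show ?thesis using that[of n] by (simp add: divide_less_eq add_pos_nonneg)
  qed
  obtain e where e1: "e \<in> C" "emb e = 1 - g ^ n" using ex by blast
  show ?thesis
  proof (rule that)
    show "e \<in> C" by fact
    have "emb (star e) = emb e" by (simp add: emb_hom e1 star_diff sg)
    then show "star e = e" by simp
    have "norm (1 - g ^ n) \<le> 1" using cposD[OF cpos_power[OF g, of n] ng] by simp
    then show "norm e \<le> 1" by (metis norm_emb e1(2))
    have "emb (e * x - x) = - (g ^ n * emb x)" by (simp add: emb_hom e1 left_diff_distrib)
    then have "norm (e * x - x) = norm (g ^ n * emb x)" by (metis norm_emb norm_minus_cancel)
    then have "(norm (e * x - x))\<^sup>2 = norm ((g ^ n * emb x) * star (g ^ n * emb x))"
      by (simp only: cstar_identity')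
    also have "(g ^ n * emb x) * star (g ^ n * emb x) = M *\<^sub>R (g ^ n * h * g ^ n)"
      using M by (simp add: star_mult sg h_eq star_star mult.assoc)
    also have "g ^ n * h * g ^ n = h * (1 - h) ^ (2 * n)"
    proof -
      have "g ^ n * h = h * g ^ n" by (simp add: hg algebra_simps power_commutes)
      then show ?thesis by (simp add: mult.assoc mult_2 power_add flip: g_def)
    qed
    also have "norm (M *\<^sub>R (h * (1 - h) ^ (2 * n))) \<le> M * (1 / (real (2 * n) + 1))"
      using norm_power_decay[OF h h1, of "2 * n"] M mult_left_mono[of _ _ M] by fastforce
    also have "\<dots> < \<epsilon>\<^sup>2" using n by simp
    finally show "norm (e * x - x) < \<epsilon>" using e by (simp add: power2_less_imp_less)
  qed
qed

lemma quasi_stateD: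
  assumes "quasi_state_on C f"
  shows "linear_functional_on C f" "positive_on C f" "x \<in> C \<Longrightarrow> cmod (f x) \<le> norm x"
  using assms by (auto simp: quasi_state_on_def)

text \<open>With a unit in \<open>C\<close> both claims would follow from Cauchy-Schwarz against it.
  Here an approximate unit \<open>e\<close> of norm at most 1 stands in, and
  \<open>f (e * x)\<close> is close to \<open>f x\<close>.\<close>

lemma quasi_state_star:
  assumes C: "cstar_subalgebra C" and f: "quasi_state_on C f" and x: "x \<in> C"
  shows "f (star x) = cnj (f x)"
    and "(cmod (f x))\<^sup>2 \<le> Re (f (star x * x))"
proof -
  note cl = cstar_subalgebraD[OF C]
  note lf = linear_functional_onD[OF quasi_stateD(1)[OF f] cl(1)]
  have approx: "\<exists>e\<in>C. star e = e \<and> norm e \<le> 1 \<and> cmod (f (e * x) - f x) < \<epsilon> \<and> cmod (f (star x * e) - f (star x)) < \<epsilon>"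
    if \<epsilon>: "\<epsilon> > 0" for \<epsilon> :: real
  proof -
    obtain e where e: "e \<in> C" "star e = e" "norm e \<le> 1" "norm (e * x - x) < \<epsilon>"
      using approximate_left_unit[OF C x \<epsilon>] .
    have "norm (star (e * x - x)) < \<epsilon>" using e(4) by (simp only: norm_star)
    then have "norm (star x * e - star x) < \<epsilon>" by (simp add: star_simps e)
    then have "cmod (f (star x * e - star x)) < \<epsilon>" "cmod (f (e * x - x)) < \<epsilon>"
      using quasi_stateD(3)[OF f] e x cl by (meson le_less_trans)+
    then show ?thesis using e x by (intro bexI[of _ e]) (auto simp: lf cl)
  qed
  have "dist (f (star x)) (cnj (f x)) < \<epsilon>" if \<epsilon>: "\<epsilon> > 0" for \<epsilon> :: real
  proof -
    obtain e where e: "e \<in> C" "star e = e" "cmod (f (e * x) - f x) < \<epsilon> / 2" "cmod (f (star x * e) - f (star x)) < \<epsilon> / 2"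
      using approx[of "\<epsilon> / 2"] \<epsilon> by auto
    have "f (star x * e) = cnj (f (e * x))"
      using positive_form(1)[OF C quasi_stateD(1,2)[OF f] e(1) x] e(2) by simp
    then have "cmod (cnj (f (e * x)) - f (star x)) < \<epsilon> / 2" using e by simp
    moreover have "cmod (cnj (f (e * x)) - cnj (f x)) < \<epsilon> / 2"
      using e(3) by (metis complex_cnj_diff complex_mod_cnj)
    ultimately show ?thesis
      using dist_triangle_half_l[of "f (star x)" "cnj (f (e * x))" \<epsilon> "cnj (f x)"]
      by (simp add: dist_norm norm_minus_commute)
  qed
  then show "f (star x) = cnj (f x)" by (metis dist_pos_lt less_irrefl)
  have "cmod (f x) \<le> sqrt (Re (f (star x * x)))"
  proof (rule field_le_epsilon)
    fix \<epsilon> :: real assume "\<epsilon> > 0"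
    then obtain e where e: "e \<in> C" "star e = e" "norm e \<le> 1" "cmod (f (e * x) - f x) < \<epsilon>"
      using approx by blast
    have xx: "0 \<le> Re (f (star x * x))" using nonneg_Reals_Re(1) positive_onD[OF quasi_stateD(2)[OF f] x] by blast
    have "Re (f (e * e)) \<le> norm (e * e)"
      using complex_Re_le_cmod[of "f (e * e)"] quasi_stateD(3)[OF f, of "e * e"] cl(3)[OF e(1) e(1)] by simp
    also have "\<dots> \<le> 1" using e by (simp add: norm_square_sa power_le_one)
    finally have "Re (f (e * e)) * Re (f (star x * x)) \<le> 1 * Re (f (star x * x))"
      by (intro mult_right_mono xx)
    then have "(cmod (f (e * x)))\<^sup>2 \<le> Re (f (star x * x))"
      using positive_form(2)[OF C quasi_stateD(1,2)[OF f] e(1) x] e(2) by simp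
    then have "cmod (f (e * x)) \<le> sqrt (Re (f (star x * x)))" by (rule real_le_rsqrt)
    moreover have "cmod (f x) \<le> cmod (f (e * x)) + \<epsilon>"
      using e(4) norm_triangle_ineq4[of "f (e * x)" "f (e * x) - f x"] by simp
    ultimately show "cmod (f x) \<le> sqrt (Re (f (star x * x))) + \<epsilon>" by linarith
  qed
  moreover have "0 \<le> Re (f (star x * x))" using nonneg_Reals_Re(1) positive_onD[OF quasi_stateD(2)[OF f] x] by blast
  ultimately show "(cmod (f x))\<^sup>2 \<le> Re (f (star x * x))"
    by (metis norm_ge_zero power_mono real_sqrt_pow2)
qed

section \<open>Extension of quasi-states to the unitization\<close>

definition unitize :: "'a::cstar_algebra set \<Rightarrow> 'a uz set"
  where "unitize C = {z. vec z \<in> C}"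

lemma bounded_linear_vec: "bounded_linear (vec :: 'a::cstar_algebra uz \<Rightarrow> 'a)"
proof (rule bounded_linear_intro[where K = 2])
  show "norm (vec x) \<le> norm x * 2" for x :: "'a uz"
    using norm_vec_le[of x] scl_le[of x] by (simp add: norm_uz_def)
qed auto

lemma cstar_subalgebra_unitize:
  assumes C: "cstar_subalgebra C"
  shows "cstar_subalgebra (unitize C)"
proof -
  note cl = cstar_subalgebraD[OF C]
  have "unitize C = vec -` C" by (auto simp: unitize_def)
  then have "closed (unitize C)"
    using continuous_closed_vimage[OF cl(2), of vec] linear_continuous_at[OF bounded_linear_vec] by auto
  then show ?thesis
    by (auto simp: cstar_subalgebra_def complex_vector.subspace_def unitize_def cl)
qed

lemma unitize_simps [simp]: "emb x \<in> unitize C \<longleftrightarrow> x \<in> C" "1 \<in> unitize C \<longleftrightarrow> (0::'a::cstar_algebra) \<in> C"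
  for C :: "'a::cstar_algebra set"
  by (auto simp: unitize_def)

lemma linear_functional_unitize:
  assumes C: "cstar_subalgebra C" and f: "linear_functional_on C f"
  shows "linear_functional_on (unitize C) (\<lambda>z. f (vec z) + scl z)"
  using linear_functional_onD[OF f cstar_subalgebraD(1)[OF C]]
  by (auto simp: linear_functional_on_def unitize_def algebra_simps)

lemma nstate_extension:
  assumes C: "cstar_subalgebra C" and f: "linear_functional_on C f"
    and le: "\<And>z. vec z \<in> C \<Longrightarrow> cmod (f (vec z) + scl z) \<le> norm z"
  obtains F where "nstate F" "\<And>x. x \<in> C \<Longrightarrow> F (emb x) = f x"
proof -
  note cl = cstar_subalgebraD[OF C]
  obtain F where F: "clinear F" "\<And>z. z \<in> unitize C \<Longrightarrow> F z = f (vec z) + scl z" "\<And>z. cmod (F z) \<le> norm z"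
    using hahn_banach[OF cstar_subalgebraD(1)[OF cstar_subalgebra_unitize[OF C]] linear_functional_unitize[OF C f]] le
    unfolding unitize_def by auto
  have "F 1 = 1" using F(2)[of 1] linear_functional_onD(6)[OF f cl(1)] cl by simp
  then have "nstate F" using F by (simp add: nstate_def)
  then show ?thesis using that F(2)[of "emb x" for x] by simp
qed

text \<open>The value 1 at the adjoined unit keeps the functional positive, because the squared
  modulus of \<open>f v\<close> is at most \<open>f (star v * v)\<close> and the cross term is
  absorbed in a square. Positivity on \<open>unitize C\<close> gives contractivity there, and only
  then does Hahn-Banach extend to the whole unitization.\<close>

lemma quasi_state_nstate:
  assumes C: "cstar_subalgebra C" and f: "quasi_state_on C f"
  obtains F where "nstate F" "\<And>x. x \<in> C \<Longrightarrow> F (emb x) = f x"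
proof -
  note cl = cstar_subalgebraD[OF C]
  note lf = linear_functional_onD[OF quasi_stateD(1)[OF f] cl(1)]
  define B where "B = unitize C"
  have B: "cstar_subalgebra B" unfolding B_def by (rule cstar_subalgebra_unitize[OF C])
  note clB = cstar_subalgebraD[OF B]
  define f' where "f' z = f (vec z) + scl z" for z
  have lin: "linear_functional_on B f'"
    unfolding B_def f'_def by (rule linear_functional_unitize[OF C quasi_stateD(1)[OF f]])
  note lf' = linear_functional_onD[OF lin clB(1)]
  have one: "1 \<in> B" "f' 1 = 1" using cl lf by (simp_all add: B_def f'_def)
  have pos: "positive_on B f'"
    unfolding positive_on_def
  proof
    fix z assume "z \<in> B"
    define v s where "v = vec z" and "s = scl z"
    have v: "v \<in> C" using \<open>z \<in> B\<close> by (simp add: v_def B_def unitize_def)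
    have "f' (star z * z) = f (star v * v) + (s * cnj (f v) + cnj (s * cnj (f v))) + of_real ((cmod s)\<^sup>2)"
      using v quasi_state_star(1)[OF C f v]
      by (simp add: f'_def lf cl flip: v_def s_def) (simp add: mult.commute cnj_mult_self)
    also have "\<dots> = of_real (Re (f (star v * v)) + 2 * Re (s * cnj (f v)) + (cmod s)\<^sup>2)"
      using nonneg_Reals_Re(2)[OF positive_onD[OF quasi_stateD(2)[OF f] v]]
      by (simp add: complex_add_cnj del: complex_cnj_mult)
    also have "\<dots> \<in> \<real>\<^sub>\<ge>\<^sub>0"
    proof -
      have "- Re (s * cnj (f v)) \<le> cmod s * cmod (f v)"
        using abs_Re_le_cmod[of "s * cnj (f v)"] by (simp add: norm_mult)
      moreover have "0 \<le> (cmod (f v) - cmod s)\<^sup>2" by simp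
      ultimately show ?thesis
        using quasi_state_star(2)[OF C f v] by (simp add: power2_diff algebra_simps del: of_real_add)
    qed
    finally show "f' (star z * z) \<in> \<real>\<^sub>\<ge>\<^sub>0" .
  qed
  have "cmod (f' z) \<le> norm z" if z: "z \<in> B" for z
  proof (cases "z = 0")
    case True
    then show ?thesis using lf' by simp
  next
    case False
    define M where "M = (norm z)\<^sup>2"
    have M: "M > 0" using False by (simp add: M_def)
    \<comment> \<open>\<open>1 - u\<close> is \<open>star r * r\<close> with \<open>r\<close> in
      \<open>B\<close> itself, so positivity on \<open>B\<close> suffices to bound the value at
      \<open>u\<close> by 1.\<close>
    define u where "u = inverse M *\<^sub>R (star z * z)"
    have u: "u \<in> B" "star u = u" "norm u \<le> 1"
      using z M by (auto simp: u_def clB star_simps cstar_identity M_def)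
    obtain s where s: "s \<in> B" "star s = s" "s + s - s * s = u"
      using sqrt_one_minus[OF B u] by blast
    define r where "r = 1 - s"
    have "star r * r = 1 - u" by (simp add: r_def star_simps s algebra_simps flip: s(3))
    then have "f' (1 - u) \<in> \<real>\<^sub>\<ge>\<^sub>0" using positive_onD[OF pos, of r] s one clB by (simp add: r_def)
    then have "Re (f' u) \<le> 1" using nonneg_Reals_Re(1) lf'(5)[OF one(1) u(1)] one(2) by force
    then have "Re (f' (star z * z)) \<le> M" using M z by (simp add: u_def lf' clB field_simps)
    moreover have "(cmod (f' z))\<^sup>2 \<le> Re (f' (star z * z))"
      using positive_form(2)[OF B lin pos one(1) z] by (simp add: one)
    ultimately have "(cmod (f' z))\<^sup>2 \<le> (norm z)\<^sup>2" unfolding M_def by linarith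
    then show ?thesis by (rule power2_le_imp_le) simp
  qed
  then have "cmod (f (vec z) + scl z) \<le> norm z" if "vec z \<in> C" for z
    using that by (simp add: B_def f'_def unitize_def)
  from nstate_extension[OF C quasi_stateD(1)[OF f] this] show ?thesis using that by blast
qed

lemma nstate_quasi_state:
  assumes "nstate F"
  shows "quasi_state_on UNIV (\<lambda>x. F (emb x))"
proof -
  have lin: "clinear F" and le: "\<And>x. cmod (F x) \<le> norm x" using assms by (auto simp: nstate_def)
  show ?thesis
    unfolding quasi_state_on_def linear_functional_on_def positive_on_def
    using le[of "emb x" for x] nstate_star_mult[OF assms, of "emb x" for x]
    by (auto simp: emb_hom clinearD[OF lin])
qed

lemma quasi_state_subset:
  "quasi_state_on D f \<Longrightarrow> C \<subseteq> D \<Longrightarrow> quasi_state_on C f"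
  by (simp add: quasi_state_on_def linear_functional_on_def positive_on_def subset_iff)

lemma quasi_state_normalize:
  assumes "linear_functional_on C g" "positive_on C g" "\<And>x. x \<in> C \<Longrightarrow> cmod (g x) \<le> K * norm x" "0 < K"
  shows "quasi_state_on C (\<lambda>x. of_real (inverse K) * g x)"
proof -
  have "of_real (inverse K) * z \<in> \<real>\<^sub>\<ge>\<^sub>0" if "z \<in> \<real>\<^sub>\<ge>\<^sub>0" for z :: complex
    using that assms(4) by (simp add: complex_nonneg_Reals_iff del: of_real_inverse)
  moreover have "cmod (of_real (inverse K) * g x) \<le> norm x" if "x \<in> C" for x
  proof -
    have "cmod (of_real (inverse K) * g x) = cmod (g x) / K"
      using assms(4) by (simp add: norm_mult norm_inverse divide_inverse mult.commute)
    then show ?thesis using assms(3)[OF that] assms(4) by (simp add: divide_le_eq mult.commute)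
  qed
  ultimately show ?thesis
    using assms(1,2) unfolding quasi_state_on_def positive_on_def linear_functional_on_def
    by (simp add: distrib_left mult.left_commute)
qed

lemma quasi_state_cong:
  assumes "cstar_subalgebra C" "\<And>x. x \<in> C \<Longrightarrow> f x = g x"
  shows "quasi_state_on C f \<longleftrightarrow> quasi_state_on C g"
  using assms(2) cstar_subalgebraD[OF assms(1)]
  by (auto simp: quasi_state_on_def linear_functional_on_def positive_on_def)

lemma quasi_state_extension:
  assumes C: "cstar_subalgebra C" and f: "quasi_state_on C f"
  obtains g where "quasi_state_on UNIV g" "\<And>x. x \<in> C \<Longrightarrow> g x = f x"
  using quasi_state_nstate[OF C f] nstate_quasi_state by metis

text \<open>The hypothesis says that \<open>w\<close> has variance 0:
  \<open>F (y * star y) = 0\<close> for \<open>y = w - G w\<close> in the unitization.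
  Cauchy-Schwarz then kills \<open>F (y * x)\<close> for every \<open>x\<close>.\<close>

lemma quasi_state_multiplicative_domain:
  assumes C: "cstar_subalgebra C" and G: "quasi_state_on C G" and w: "w \<in> C" and x: "x \<in> C"
    and eq: "G (w * star w) = G w * cnj (G w)"
  shows "G (w * x) = G w * G x"
proof -
  note cl = cstar_subalgebraD[OF C]
  obtain F where F: "nstate F" "\<And>x. x \<in> C \<Longrightarrow> F (emb x) = G x" using quasi_state_nstate[OF C G] by blast
  have lin: "clinear F" and one: "F 1 = 1" using F by (auto simp: nstate_def)
  define y where "y = emb w - G w *\<^sub>C 1"
  have "y * star y = emb (w * star w) - cnj (G w) *\<^sub>C emb w - G w *\<^sub>C emb (star w) + (G w * cnj (G w)) *\<^sub>C 1"
    by (simp add: y_def star_simps emb_hom algebra_simps scaleC_algebra)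
  then have "F (y * star y) = 0"
    using w cl by (simp add: clinearD[OF lin] one F(2) eq quasi_state_star(1)[OF C G w])
  moreover have "(cmod (F (star (star y) * emb x)))\<^sup>2 \<le> Re (F (star (star y) * star y)) * Re (F (star (emb x) * emb x))"
    using lin nstate_star_mult[OF F(1)]
    by (intro positive_form(2)[where C = UNIV]) (auto simp: linear_functional_UNIV positive_on_def)
  ultimately have "F (y * emb x) = 0" by (simp add: star_star)
  then show ?thesis
    using w x cl linear_functional_onD[OF quasi_stateD(1)[OF G] cl(1)]
    by (simp add: y_def left_diff_distrib clinearD[OF lin] mult_scaleC_left F(2) flip: emb_hom)
qed

lemma quasi_state_square_real:
  assumes "quasi_state_on C f" "x \<in> C"
  shows "f (star x * x) = of_real (Re (f (star x * x)))" "0 \<le> Re (f (star x * x))"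
  using nonneg_Reals_Re positive_onD[OF quasi_stateD(2)[OF assms(1)] assms(2)] by auto

text \<open>Trades the supremum, whose use requires boundedness each time, for elements that nearly
  norm \<open>f\<close>.\<close>

lemma state_on_iff:
  assumes C: "cstar_subalgebra C"
  shows "state_on C f \<longleftrightarrow> quasi_state_on C f \<and> (\<forall>e>0. \<exists>x\<in>C. norm x \<le> 1 \<and> 1 - e < cmod (f x))"
proof
  note cl = cstar_subalgebraD[OF C]
  let ?S = "{x \<in> C. norm x \<le> 1}"
  have ne: "?S \<noteq> {}" using cl(5) by force
  {
    assume f: "state_on C f"
    then obtain K where K: "\<And>x. x \<in> C \<Longrightarrow> cmod (f x) \<le> K * norm x" by (auto simp: state_on_def bounded_on_def)
    have lin: "linear_functional_on C f" and sup: "(SUP x\<in>?S. cmod (f x)) = 1"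
      using f by (auto simp: state_on_def functional_norm_on_def)
    note lf = linear_functional_onD[OF lin cl(1)]
    have bdd: "bdd_above ((\<lambda>x. cmod (f x)) ` ?S)"
    proof (rule bdd_aboveI2)
      fix x assume "x \<in> ?S"
      then have "cmod (f x) \<le> K * norm x" using K by auto
      also have "\<dots> \<le> \<bar>K\<bar> * norm x" by (intro mult_right_mono) auto
      also have "\<dots> \<le> \<bar>K\<bar> * 1" using \<open>x \<in> ?S\<close> by (intro mult_left_mono) auto
      finally have "cmod (f x) \<le> \<bar>K\<bar> * 1" .
      then show "cmod (f x) \<le> \<bar>K\<bar>" by simp
    qed
    have "cmod (f x) \<le> norm x" if x: "x \<in> C" for x
    proof (cases "x = 0")
      case False
      then have "cmod (f (inverse (norm x) *\<^sub>R x)) \<le> 1"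
        using cSUP_upper[OF _ bdd, of "inverse (norm x) *\<^sub>R x"] x cl by (simp add: sup)
      then show ?thesis using False x by (simp add: lf norm_mult norm_inverse norm_divide field_simps)
    qed (simp add: lf)
    moreover have "\<exists>x\<in>C. norm x \<le> 1 \<and> 1 - e < cmod (f x)" if "e > 0" for e
      using less_cSUP_iff[OF ne bdd, of "1 - e"] that by (auto simp: sup)
    ultimately show "quasi_state_on C f \<and> (\<forall>e>0. \<exists>x\<in>C. norm x \<le> 1 \<and> 1 - e < cmod (f x))"
      using f by (auto simp: state_on_def quasi_state_on_def)
  }
  {
    assume f: "quasi_state_on C f \<and> (\<forall>e>0. \<exists>x\<in>C. norm x \<le> 1 \<and> 1 - e < cmod (f x))"
    then have le: "cmod (f x) \<le> norm x" if "x \<in> C" for x using that by (auto simp: quasi_state_on_def)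
    have bdd: "bdd_above ((\<lambda>x. cmod (f x)) ` ?S)"
      using le by (intro bdd_aboveI2[where M = 1]) force
    have "functional_norm_on C f = 1"
      unfolding functional_norm_on_def
    proof (rule antisym)
      show "(SUP x\<in>?S. cmod (f x)) \<le> 1" using ne le by (intro cSUP_least) force+
      show "1 \<le> (SUP x\<in>?S. cmod (f x))"
      proof (rule field_le_epsilon)
        fix e :: real assume "e > 0"
        then obtain x where x: "x \<in> C" "norm x \<le> 1" "1 - e < cmod (f x)" using f by blast
        then have "cmod (f x) \<le> (SUP x\<in>?S. cmod (f x))" by (intro cSUP_upper bdd) auto
        then show "1 \<le> (SUP x\<in>?S. cmod (f x)) + e" using x by linarith
      qed
    qed
    then show "state_on C f"
      using f le unfolding state_on_def quasi_state_on_def bounded_on_def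
      by (auto intro!: exI[of _ 1])
  }
qed

lemma state_onD:
  assumes "cstar_subalgebra C" "state_on C f"
  shows "quasi_state_on C f" "e > 0 \<Longrightarrow> \<exists>x\<in>C. norm x \<le> 1 \<and> 1 - e < cmod (f x)"
  using assms state_on_iff by blast+

lemma pure_stateD:
  assumes "cstar_subalgebra C" "pure_state_on C f"
  shows "state_on C f" "quasi_state_on C f"
  using assms state_onD(1) by (auto simp: pure_state_on_def)

lemma pure_state_nonzero:
  assumes C: "cstar_subalgebra C" and f: "pure_state_on C f"
  obtains x where "x \<in> C" "f x \<noteq> 0"
  using state_onD(2)[OF C pure_stateD(1)[OF C f], of 1] by force

lemma state_on_extends:
  assumes "cstar_subalgebra C" "state_on C f" "cstar_subalgebra D" "C \<subseteq> D"
    "quasi_state_on D g" "\<And>x. x \<in> C \<Longrightarrow> g x = f x"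
  shows "state_on D g"
  unfolding state_on_iff[OF assms(3)]
  using assms(4,5,6) state_onD(2)[OF assms(1,2)] by fastforce

text \<open>Purity compares states only, so \<open>g\<close> and \<open>h\<close> must first be seen
  to have norm 1: where \<open>f\<close> exceeds \<open>1 - t * e\<close> on the unit ball,
  \<open>g\<close> exceeds \<open>1 - e\<close>, as \<open>h\<close> contributes at most
  \<open>1 - t\<close>.\<close>

lemma pure_state_convex_combination:
  assumes C: "cstar_subalgebra C" and f: "pure_state_on C f"
    and g: "quasi_state_on C g" and h: "quasi_state_on C h" and t: "0 < t" "t < 1"
    and eq: "\<And>x. x \<in> C \<Longrightarrow> f x = complex_of_real t * g x + complex_of_real (1 - t) * h x"
  shows "x \<in> C \<Longrightarrow> g x = f x" "x \<in> C \<Longrightarrow> h x = f x"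
proof -
  have st: "state_on C f" using f by (simp add: pure_state_on_def)
  have *: "\<exists>x\<in>C. norm x \<le> 1 \<and> 1 - e < cmod (g x)"
    if e: "e > 0" and g: "quasi_state_on C g" and h: "quasi_state_on C h" and t: "0 < t" "t < 1"
      and eq: "\<And>x. x \<in> C \<Longrightarrow> f x = complex_of_real t * g x + complex_of_real (1 - t) * h x" for e g h t
  proof -
    obtain x where x: "x \<in> C" "norm x \<le> 1" "1 - t * e < cmod (f x)"
      using state_onD(2)[OF C st, of "t * e"] t e by auto
    have "cmod (f x) \<le> t * cmod (g x) + (1 - t) * cmod (h x)"
      unfolding eq[OF x(1)] using t
      by (intro order_trans[OF norm_triangle_ineq]) (simp add: norm_mult del: of_real_diff)
    also have "(1 - t) * cmod (h x) \<le> (1 - t) * 1"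
      using quasi_stateD(3)[OF h x(1)] x(2) t by (intro mult_left_mono) auto
    finally have "t * (1 - e) < t * cmod (g x)" using x by (simp add: algebra_simps)
    then show ?thesis using x t by auto
  qed
  have "state_on C g" unfolding state_on_iff[OF C] using g *[OF _ g h t eq] by blast
  moreover have "state_on C h" unfolding state_on_iff[OF C]
    using h *[OF _ h g, of _ "1 - t"] t eq by (auto simp: add.commute)
  ultimately show "x \<in> C \<Longrightarrow> g x = f x" "x \<in> C \<Longrightarrow> h x = f x"
    using f t eq unfolding pure_state_on_def by blast+
qed

text \<open>A violation can be scaled to \<open>norm u < 1\<close> and \<open>f u = 1\<close>. The
  sum \<open>s\<close> of all positive powers of \<open>u\<close> then lies in \<open>C\<close> and
  satisfies \<open>u * s = s - u\<close>, whence \<open>f s = f s - 1\<close>.\<close>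

lemma character_contractive:
  assumes C: "cstar_subalgebra C" and f: "character_on C f" and x: "x \<in> C"
  shows "cmod (f x) \<le> norm x"
proof (rule ccontr)
  assume n: "\<not> ?thesis"
  note cl = cstar_subalgebraD[OF C]
  have lin: "linear_functional_on C f" and mult: "\<And>x y. x \<in> C \<Longrightarrow> y \<in> C \<Longrightarrow> f (x * y) = f x * f y"
    using f by (auto simp: character_on_def)
  note lf = linear_functional_onD[OF lin cl(1)]
  define u where "u = inverse (f x) *\<^sub>C x"
  have fx: "f x \<noteq> 0" "0 < cmod (f x)" using n norm_ge_zero[of x] by (auto simp: not_le)
  have u: "u \<in> C" "f u = 1" using fx x cl by (auto simp: u_def lf)
  have "norm u = norm x / cmod (f x)" by (simp add: u_def norm_scaleC norm_inverse divide_inverse mult.commute)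
  also have "\<dots> < 1" using n fx(2) by simp
  finally have nu: "norm u < 1" .
  define p where "p = rec_nat u (\<lambda>n s. u * s)"
  have p: "p 0 = u" "p (Suc n) = u * p n" for n by (simp_all add: p_def)
  have pC: "p n \<in> C" for n by (induction n) (auto simp: p u cl)
  have "norm (p n) \<le> norm u ^ Suc n" for n
  proof (induction n)
    case (Suc n)
    then show ?case using order_trans[OF norm_mult_ineq[of u "p n"] mult_left_mono[OF Suc]] by (simp add: p)
  qed (simp add: p)
  then have sm: "summable p"
    using summable_comparison_test'[of "\<lambda>n. norm u ^ Suc n" 0 p] nu summable_mult[OF summable_geometric[of "norm u"], of "norm u"] by simp
  define s where "s = suminf p"
  have sC: "s \<in> C"
  proof (rule closed_sequentially[OF cl(2)])
    show "(\<lambda>n. sum p {..<n}) \<longlonglongrightarrow> s" unfolding s_def by (rule summable_LIMSEQ[OF sm])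
    show "sum p {..<n} \<in> C" for n by (induction n) (auto simp: cl pC)
  qed
  have "u * s = (\<Sum>n. p (Suc n))" unfolding s_def p by (rule suminf_mult[OF sm, symmetric])
  also have "\<dots> = s - u" using suminf_split_head[OF sm] by (simp add: s_def p)
  finally have "f (u * s) = f (s - u)" by simp
  then show False using u sC cl by (simp add: mult lf)
qed

lemma character_on_unitize:
  assumes C: "cstar_subalgebra C" and f: "character_on C f"
  shows "character_on (unitize C) (\<lambda>z. f (vec z) + scl z)"
proof -
  have lin: "linear_functional_on C f" and mult: "\<And>x y. x \<in> C \<Longrightarrow> y \<in> C \<Longrightarrow> f (x * y) = f x * f y"
    using f by (auto simp: character_on_def)
  note lf = linear_functional_onD[OF lin cstar_subalgebraD(1)[OF C]]
  show ?thesis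
    unfolding character_on_def
    using linear_functional_unitize[OF C lin]
    by (auto simp: unitize_def lf cstar_subalgebraD[OF C] mult algebra_simps)
qed

text \<open>Contractivity on \<open>C\<close> alone would not give positivity; contractivity on the
  unitization, where the extended character is 1 at the unit, does.\<close>

lemma character_quasi_state:
  assumes C: "cstar_subalgebra C" and f: "character_on C f"
  shows "quasi_state_on C f"
proof -
  have lin: "linear_functional_on C f" using f by (simp add: character_on_def)
  from character_contractive[OF cstar_subalgebra_unitize[OF C] character_on_unitize[OF C f]]
  obtain F where F: "nstate F" "\<And>x. x \<in> C \<Longrightarrow> F (emb x) = f x"
    using nstate_extension[OF C lin] by (auto simp: unitize_def)
  show ?thesis
    using quasi_state_subset[OF nstate_quasi_state[OF F(1)], of C] quasi_state_cong[OF C] F(2) by (metis subset_UNIV)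
qed

text \<open>Extremality is strict convexity of the squared modulus: \<open>f (star x * x)\<close>
  equals the squared modulus of \<open>f x\<close>, while for \<open>g\<close> and \<open>h\<close>
  there is only an inequality, and the gap is \<open>t * (1 - t)\<close> times the squared distance
  of \<open>g x\<close> and \<open>h x\<close>. Norm 1 comes from an approximate unit for
  \<open>x0\<close>.\<close>

lemma character_pure_state:
  assumes C: "cstar_subalgebra C" and f: "character_on C f" and x0: "x0 \<in> C" "f x0 \<noteq> 0"
  shows "pure_state_on C f"
proof -
  note cl = cstar_subalgebraD[OF C]
  have mult: "\<And>x y. x \<in> C \<Longrightarrow> y \<in> C \<Longrightarrow> f (x * y) = f x * f y"
    using f by (auto simp: character_on_def)
  have q: "quasi_state_on C f" by (rule character_quasi_state[OF C f])
  note lf = linear_functional_onD[OF quasi_stateD(1)[OF q] cl(1)]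
  have "\<exists>x\<in>C. norm x \<le> 1 \<and> 1 - e < cmod (f x)" if e: "e > 0" for e
  proof -
    have "e * cmod (f x0) > 0" using e x0 by simp
    from approximate_left_unit[OF C x0(1) this]
    obtain d where d: "d \<in> C" "norm d \<le> 1" "norm (d * x0 - x0) < e * cmod (f x0)" by blast
    have "cmod (f (d * x0 - x0)) \<le> norm (d * x0 - x0)"
      using quasi_stateD(3)[OF q] d x0 cl by simp
    then have "cmod (f d * f x0 - f x0) < e * cmod (f x0)" using d x0 cl by (simp add: lf mult)
    then have "cmod ((f d - 1) * f x0) < e * cmod (f x0)" by (simp add: algebra_simps)
    then have "cmod (f d - 1) < e" using x0 by (simp add: norm_mult)
    then have "1 - e < cmod (f d)" using norm_triangle_ineq2[of 1 "1 - f d"] by (simp add: norm_minus_commute)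
    then show ?thesis using d by blast
  qed
  then have st: "state_on C f" using q by (simp add: state_on_iff[OF C])
  have "g x = f x \<and> h x = f x"
    if g: "state_on C g" and h: "state_on C h" and t: "0 < t" "t < 1" and x: "x \<in> C"
      and eq: "\<forall>x\<in>C. f x = complex_of_real t * g x + complex_of_real (1 - t) * h x" for g h t x
  proof -
    note qg = state_onD(1)[OF C g] and qh = state_onD(1)[OF C h]
    have xx: "star x * x \<in> C" using x cl by simp
    have "f (star x * x) = of_real ((cmod (f x))\<^sup>2)"
      using x cl by (simp add: mult quasi_state_star(1)[OF C q] cnj_mult_self)
    then have 1: "(cmod (f x))\<^sup>2 = t * Re (g (star x * x)) + (1 - t) * Re (h (star x * x))"
      using arg_cong[OF bspec[OF eq xx], of Re] by simp
    have 2: "f x = complex_of_real t * g x + complex_of_real (1 - t) * h x" using eq x by blast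
    have "t * (cmod (g x))\<^sup>2 + (1 - t) * (cmod (h x))\<^sup>2 \<le> (cmod (f x))\<^sup>2"
      unfolding 1 using quasi_state_star(2)[OF C qg x] quasi_state_star(2)[OF C qh x] t
      by (intro add_mono mult_left_mono) auto
    moreover have "t * (cmod (g x))\<^sup>2 + (1 - t) * (cmod (h x))\<^sup>2 - (cmod (f x))\<^sup>2 = t * (1 - t) * (cmod (g x - h x))\<^sup>2"
      unfolding 2 cmod_power2 by (simp add: power2_eq_square algebra_simps)
    ultimately have "t * (1 - t) * (cmod (g x - h x))\<^sup>2 \<le> 0" by linarith
    moreover have "0 < t * (1 - t)" using t by simp
    ultimately have "(cmod (g x - h x))\<^sup>2 \<le> 0" using t by (simp add: mult_le_0_iff)
    then have "g x = h x" by simp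
    then show ?thesis using 2 by (simp add: algebra_simps)
  qed
  then show ?thesis using st unfolding pure_state_on_def by blast
qed

text \<open>Cauchy-Schwarz for \<open>r\<close> and \<open>z * r\<close>, combined with positivity
  of \<open>(norm z)\<^sup>2 *\<^sub>R 1 - star z * z\<close> compressed by
  \<open>r\<close>.\<close>

lemma nstate_compression:
  assumes F: "nstate F" and r: "star r = r"
  shows "cmod (F (r * z * r)) \<le> Re (F (r * r)) * norm z"
proof -
  have lin: "clinear F" using F by (simp add: nstate_def)
  have C: "linear_functional_on UNIV F" "positive_on UNIV F"
    using lin nstate_star_mult[OF F] by (auto simp: linear_functional_UNIV positive_on_def)
  have "cpos ((norm z)\<^sup>2 *\<^sub>R 1 - star z * z)"
    by (rule cpos_norm_minus) (simp_all add: star_simps cstar_identity)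
  then obtain k where k: "star k = k" "(norm z)\<^sup>2 *\<^sub>R 1 - star z * z = k * k" by (auto simp: cpos_def)
  have "star (k * r) * (k * r) = r * (k * k) * r" by (simp add: star_simps k r mult.assoc)
  also have "\<dots> = (norm z)\<^sup>2 *\<^sub>R (r * r) - star (z * r) * (z * r)"
    unfolding k(2)[symmetric] by (simp add: algebra_simps star_simps r)
  finally have 1: "Re (F (star (z * r) * (z * r))) \<le> (norm z)\<^sup>2 * Re (F (r * r))"
    using nonneg_Reals_Re(1)[OF nstate_star_mult[OF F, of "k * r"]] by (simp add: clinearD[OF lin])
  have rr: "0 \<le> Re (F (r * r))"
    using nonneg_Reals_Re(1)[OF nstate_star_mult[OF F, of r]] r by simp
  have "(cmod (F (r * z * r)))\<^sup>2 \<le> Re (F (r * r)) * Re (F (star (z * r) * (z * r)))"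
    using positive_form(2)[OF cstar_subalgebra_UNIV C UNIV_I UNIV_I, of r "z * r"] r by (simp add: mult.assoc)
  also have "\<dots> \<le> Re (F (r * r)) * ((norm z)\<^sup>2 * Re (F (r * r)))"
    by (rule mult_left_mono[OF 1 rr])
  also have "\<dots> = (Re (F (r * r)) * norm z)\<^sup>2" by (simp add: power2_eq_square)
  finally show ?thesis using rr by (auto intro: power2_le_imp_le)
qed

text \<open>With \<open>r = f a\<close>, the functional \<open>f\<close> is a convex combination of
  \<open>g 1\<close> divided by \<open>1 + r\<close> and \<open>g (- 1)\<close> divided by
  \<open>1 - r\<close>, where \<open>g \<sigma>\<close> is \<open>f\<close> after multiplication by
  \<open>1 + \<sigma> a\<close>. A root of \<open>1 + \<sigma> a\<close>, placed on both sides of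
  the argument, shows that these are quasi-states; purity forces
  \<open>g 1 = (1 + r) f\<close>.\<close>

lemma pure_state_mult_selfadjoint:
  assumes C: "cstar_subalgebra C" and ab: "abelian C" and f: "pure_state_on C f"
    and a: "a \<in> C" "star a = a" "norm a \<le> 1" and x: "x \<in> C"
  shows "f (a * x) = f a * f x"
proof -
  note cl = cstar_subalgebraD[OF C]
  have comm: "x * y = y * x" if "x \<in> C" "y \<in> C" for x y using ab that by (auto simp: abelian_def)
  note q = pure_stateD(2)[OF C f]
  note lf = linear_functional_onD[OF quasi_stateD(1)[OF q] cl(1)]
  define r where "r = Re (f a)"
  have fa: "f a = of_real r"
    using quasi_state_star(1)[OF C q a(1)] a(2) by (simp add: r_def complex_eq_iff)
  have "\<bar>r\<bar> \<le> 1" using quasi_stateD(3)[OF q a(1)] a(3) by (simp add: fa)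
  define g where "g \<sigma> x = f x + of_real \<sigma> * f (a * x)" for \<sigma> :: real and x
  have g_lin: "linear_functional_on C (g \<sigma>)" for \<sigma>
    unfolding linear_functional_on_def g_def
    using a by (auto simp: lf cl distrib_left mult_scaleC_right algebra_simps)
  have g_ok: "positive_on C (g \<sigma>) \<and> (\<forall>x\<in>C. cmod (g \<sigma> x) \<le> (1 + \<sigma> * r) * norm x)"
    if \<sigma>: "\<sigma> = 1 \<or> \<sigma> = - 1" for \<sigma>
  proof -
    \<comment> \<open>This sign makes \<open>1 - s\<close> a root of \<open>1 + \<sigma> a\<close>.
      The root itself lies in the unitization, hence the expanded products in
      \<open>g_eq\<close>.\<close>
    define u where "u = (- \<sigma>) *\<^sub>R a"
    have u: "u \<in> C" "star u = u" "norm u \<le> 1" using a that by (auto simp: u_def cl star_scaleR)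
    obtain s where s: "s \<in> C" "star s = s" "s + s - s * s = u"
      using sqrt_one_minus[OF C u] by blast
    have g_eq: "g \<sigma> x = f ((x - s * x) - (x - s * x) * s)" if x: "x \<in> C" for x
    proof -
      have "(x - s * x) * s = s * (x - s * x)" using comm[of "x - s * x" s] x s cl by simp
      then have "(x - s * x) - (x - s * x) * s = x - (s + s - s * s) * x" by (simp add: algebra_simps)
      also have "\<dots> = x + \<sigma> *\<^sub>R (a * x)" by (simp add: s(3) u_def)
      finally have "f ((x - s * x) - (x - s * x) * s) = f (x + \<sigma> *\<^sub>R (a * x))" by (rule arg_cong)
      then show ?thesis using x a by (simp add: g_def lf(1,3) cl)
    qed
    have "positive_on C (g \<sigma>)"
      unfolding positive_on_def
    proof
      fix x assume x: "x \<in> C"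
      define w where "w = x - x * s"
      have "star x * x * s = star x * s * x" using comm[OF x s(1)] by (simp add: mult.assoc)
      moreover have "s * (star x * x) = star x * s * x" using comm[OF s(1) cl(4)[OF x]] by (metis mult.assoc)
      ultimately have "star w * w = (star x * x - s * (star x * x)) - (star x * x - s * (star x * x)) * s"
        using comm[OF x s(1)] by (simp add: w_def star_simps s algebra_simps)
      then have "g \<sigma> (star x * x) = f (star w * w)" using g_eq[of "star x * x"] x cl by simp
      then show "g \<sigma> (star x * x) \<in> \<real>\<^sub>\<ge>\<^sub>0"
        using positive_onD[OF quasi_stateD(2)[OF q], of w] x s cl by (simp add: w_def)
    qed
    moreover have "cmod (g \<sigma> x) \<le> (1 + \<sigma> * r) * norm x" if x: "x \<in> C" for x
    proof -
      obtain F where F: "nstate F" "\<And>x. x \<in> C \<Longrightarrow> F (emb x) = f x" using quasi_state_nstate[OF C q] by blast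
      have lin: "clinear F" and one: "F 1 = 1" using F by (auto simp: nstate_def)
      define k where "k = 1 - emb s"
      have sk: "star k = k" by (simp add: k_def star_simps s flip: emb_hom)
      have "k * k = 1 - emb u" unfolding s(3)[symmetric] by (simp add: k_def emb_hom algebra_simps)
      moreover have "f u = - of_real (\<sigma> * r)" using lf(3)[OF a(1), of "- \<sigma>"] by (simp add: u_def fa)
      ultimately have "F (k * k) = 1 + of_real (\<sigma> * r)"
        using u by (simp add: clinearD[OF lin] one F(2))
      moreover have "k * emb x * k = emb ((x - s * x) - (x - s * x) * s)"
        by (simp add: k_def emb_hom algebra_simps)
      then have "F (k * emb x * k) = g \<sigma> x"
        using F(2)[of "(x - s * x) - (x - s * x) * s"] x s cl by (simp add: g_eq)
      ultimately show ?thesis using nstate_compression[OF F(1) sk, of "emb x"] by simp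
    qed
    ultimately show ?thesis by blast
  qed
  \<comment> \<open>At the two ends one weight is 0 and cannot be normalized, but then the norm
    bound already makes the corresponding functional vanish.\<close>
  consider "r = 1" | "r = - 1" | "\<bar>r\<bar> < 1" using \<open>\<bar>r\<bar> \<le> 1\<close> by linarith
  then show ?thesis
  proof cases
    case 1
    then have "g (- 1) x = 0" using g_ok[of "- 1"] x by auto
    then show ?thesis by (simp add: g_def fa 1)
  next
    case 2
    then have "g 1 x = 0" using g_ok[of 1] x by auto
    then show ?thesis by (simp add: g_def fa 2 add_eq_0_iff)
  next
    case 3
    then have r: "0 < 1 + r" "0 < 1 - r" by auto
    have qg: "quasi_state_on C (\<lambda>x. of_real (inverse (1 + \<sigma> * r)) * g \<sigma> x)"
      if \<sigma>: "\<sigma> = 1 \<or> \<sigma> = - 1" for \<sigma>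
      using g_ok[OF \<sigma>] g_lin \<sigma> r by (intro quasi_state_normalize) auto
    have "of_real (inverse (1 + 1 * r)) * g 1 x = f x"
    proof (rule pure_state_convex_combination(1)[OF C f qg[of 1] qg[of "- 1"], of "(1 + 1 * r) / 2"])
      fix y
      have half: "complex_of_real (w / 2) * (of_real (inverse w) * z) = z / 2" if "w \<noteq> 0" for w z
      proof -
        have "complex_of_real (w / 2) * (of_real (inverse w) * z) = of_real (w / 2 * inverse w) * z"
          by (simp only: of_real_mult mult.assoc)
        then show ?thesis using that by simp
      qed
      have e: "1 - (1 + 1 * r) / 2 = (1 + - 1 * r) / 2" by (simp add: field_simps)
      show "f y = complex_of_real ((1 + 1 * r) / 2) * (of_real (inverse (1 + 1 * r)) * g 1 y)
          + complex_of_real (1 - (1 + 1 * r) / 2) * (of_real (inverse (1 + - 1 * r)) * g (- 1) y)"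
        unfolding e using r by (subst (1 2) half) (auto simp: g_def field_simps)
    qed (use r x in auto)
    then have "g 1 x = of_real (1 + r) * f x" using r by (simp add: field_simps del: of_real_add)
    then show ?thesis by (simp add: g_def fa algebra_simps)
  qed
qed

lemma selfadjoint_decomposition:
  fixes a :: "'a::complex_star_algebra"
  shows "a = (1/2) *\<^sub>R (a + star a) + \<i> *\<^sub>C ((1/2) *\<^sub>R ((- \<i>) *\<^sub>C (a - star a)))"
    "star ((1/2) *\<^sub>R (a + star a)) = (1/2) *\<^sub>R (a + star a)"
    "star ((1/2) *\<^sub>R ((- \<i>) *\<^sub>C (a - star a))) = (1/2) *\<^sub>R ((- \<i>) *\<^sub>C (a - star a))"
proof -
  have "\<i> *\<^sub>C ((1/2) *\<^sub>R ((- \<i>) *\<^sub>C (a - star a))) = (1/2) *\<^sub>R (a - star a)"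
    by (simp only: scaleC_scaleC flip: scaleC_real) simp
  then show "a = (1/2) *\<^sub>R (a + star a) + \<i> *\<^sub>C ((1/2) *\<^sub>R ((- \<i>) *\<^sub>C (a - star a)))"
    by (simp flip: scaleR_add_right scaleR_2)
qed (simp_all add: star_simps scaleC_diff algebra_simps)

lemma pure_state_character:
  assumes C: "cstar_subalgebra C" and ab: "abelian C" and f: "pure_state_on C f"
  shows "character_on C f"
proof -
  note cl = cstar_subalgebraD[OF C]
  note q = pure_stateD(2)[OF C f]
  note lf = linear_functional_onD[OF quasi_stateD(1)[OF q] cl(1)]
  have sa: "f (a * x) = f a * f x" if a: "a \<in> C" "star a = a" and x: "x \<in> C" for a x
  proof -
    define c where "c = 1 + norm a"
    have c: "c > 0" "norm a \<le> c" by (auto simp: c_def add_pos_nonneg)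
    have "f ((inverse c *\<^sub>R a) * x) = f (inverse c *\<^sub>R a) * f x"
      using a c x by (intro pure_state_mult_selfadjoint[OF C ab f]) (auto simp: cl star_scaleR field_simps)
    then show ?thesis using a c x by (simp add: lf cl)
  qed
  have "f (a * x) = f a * f x" if a: "a \<in> C" and x: "x \<in> C" for a x
  proof -
    define p r where "p = (1/2) *\<^sub>R (a + star a)" and "r = (1/2) *\<^sub>R ((- \<i>) *\<^sub>C (a - star a))"
    have e: "a = p + \<i> *\<^sub>C r" and s: "star p = p" "star r = r"
      unfolding p_def r_def by (fact selfadjoint_decomposition)+
    have "p \<in> C" "r \<in> C" using a by (auto simp: p_def r_def cl)
    then show ?thesis using x s unfolding e by (simp add: distrib_right mult_scaleC_left lf cl sa)
  qed
  then show ?thesis using quasi_stateD(1)[OF q] by (auto simp: character_on_def)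
qed

section \<open>Compactness in the topology of pointwise convergence\<close>

lemma compact_pointwise_bounded: "compact {f :: 'a \<Rightarrow> complex. \<forall>x. cmod (f x) \<le> b x}"
proof -
  have "{f :: 'a \<Rightarrow> complex. \<forall>x. cmod (f x) \<le> b x} = PiE UNIV (\<lambda>x. cball 0 (b x))"
    by (auto simp: PiE_def)
  moreover have "compactin (product_topology (\<lambda>_. euclidean) UNIV) (PiE UNIV (\<lambda>x. cball (0::complex) (b x)))"
    unfolding compactin_PiE by auto
  ultimately show ?thesis by (simp add: euclidean_product_topology)
qed

lemma continuous_on_eval [continuous_intros]: "continuous_on S (\<lambda>f :: 'a \<Rightarrow> 'b::topological_space. f x)"
  by (rule continuous_on_subset[OF continuous_on_product_coordinates]) simp

section \<open>Extreme quasi-states\<close>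

definition quasi_states :: "'a::cstar_algebra set \<Rightarrow> ('a \<Rightarrow> complex) set"
  where "quasi_states C = {f. quasi_state_on C f \<and> (\<forall>x. x \<notin> C \<longrightarrow> f x = 0)}"

lemma compact_quasi_states:
  assumes C: "cstar_subalgebra C"
  shows "compact (quasi_states C)" "closed (quasi_states C)"
proof -
  note cl = cstar_subalgebraD[OF C]
  let ?B = "{f :: 'a \<Rightarrow> complex. \<forall>x. cmod (f x) \<le> norm x}"
  let ?R = "((\<Inter>x\<in>C. \<Inter>y\<in>C. {f. f (x + y) = f x + f y}) \<inter>
      (\<Inter>c. \<Inter>x\<in>C. {f. f (c *\<^sub>C x) = c * f x}) \<inter> (\<Inter>x\<in>C. (\<lambda>f. f (star x * x)) -` \<real>\<^sub>\<ge>\<^sub>0) \<inter>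
      (\<Inter>x\<in>-C. {f. f x = 0}))"
  have eq: "quasi_states C = ?B \<inter> ?R"
    by (auto simp: quasi_states_def quasi_state_on_def linear_functional_on_def positive_on_def)
  have R: "closed ?R"
    by (intro closed_Int closed_INT ballI closed_Collect_eq closed_vimage closed_nonneg_Reals_complex continuous_intros)
  have "?B = (\<Inter>x. {f. cmod (f x) \<le> norm x})" by auto
  moreover have "closed (\<Inter>x. {f :: 'a \<Rightarrow> complex. cmod (f x) \<le> norm x})"
    by (intro closed_INT ballI closed_Collect_le continuous_intros)
  ultimately have "closed ?B" by simp
  then show "closed (quasi_states C)" unfolding eq by (intro closed_Int R)
  show "compact (quasi_states C)" unfolding eq by (intro compact_Int_closed compact_pointwise_bounded R)
qed

lemma truncate_quasi_state:
  assumes C: "cstar_subalgebra C" and f: "quasi_state_on C f"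
  shows "(\<lambda>x. if x \<in> C then f x else 0) \<in> quasi_states C"
  using f quasi_state_cong[OF C, of "\<lambda>x. if x \<in> C then f x else 0" f] by (simp add: quasi_states_def)

text \<open>Closed extreme subsets in the sense of the Krein-Milman theorem; the extreme points are
  the singletons among them.\<close>

definition face :: "'a::cstar_algebra set \<Rightarrow> ('a \<Rightarrow> complex) set \<Rightarrow> bool"
  where "face C K \<longleftrightarrow> K \<subseteq> quasi_states C \<and> closed K \<and> K \<noteq> {} \<and>
    (\<forall>g\<in>quasi_states C. \<forall>h\<in>quasi_states C. \<forall>t. 0 < t \<and> t < 1 \<and>
      (\<lambda>x. complex_of_real t * g x + complex_of_real (1 - t) * h x) \<in> K \<longrightarrow> g \<in> K \<and> h \<in> K)"

lemma faceD:
  assumes "face C K" "g \<in> quasi_states C" "h \<in> quasi_states C" "0 < t" "t < 1"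
    "(\<lambda>x. complex_of_real t * g x + complex_of_real (1 - t) * h x) \<in> K"
  shows "g \<in> K" "h \<in> K"
  using assms unfolding face_def by blast+

lemma face_compact: "cstar_subalgebra C \<Longrightarrow> face C K \<Longrightarrow> compact K"
  using compact_Int_closed[OF compact_quasi_states(1), of C K] by (simp add: face_def inf.absorb2)

lemma face_maximize:
  assumes C: "cstar_subalgebra C" and K: "face C K"
  shows "face C {f \<in> K. \<forall>g\<in>K. Re (g x) \<le> Re (f x)}"
proof -
  have Kne: "K \<noteq> {}" and Kcl: "closed K" and Ksub: "K \<subseteq> quasi_states C" using K by (auto simp: face_def)
  obtain f0 where f0: "f0 \<in> K" "\<And>g. g \<in> K \<Longrightarrow> Re (g x) \<le> Re (f0 x)"
    using continuous_attains_sup[OF face_compact[OF C K] Kne continuous_on_Re[OF continuous_on_eval], of x] by blast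
  then have eq: "{f \<in> K. \<forall>g\<in>K. Re (g x) \<le> Re (f x)} = K \<inter> {f. Re (f0 x) \<le> Re (f x)}"
    by (auto intro: order_trans)
  show ?thesis
    unfolding eq face_def
  proof (intro conjI ballI allI impI)
    show "closed (K \<inter> {f. Re (f0 x) \<le> Re (f x)})"
      by (intro closed_Int Kcl closed_Collect_le continuous_intros)
    show "K \<inter> {f. Re (f0 x) \<le> Re (f x)} \<noteq> {}" using f0 by auto
    fix g h t
    assume gh: "g \<in> quasi_states C" "h \<in> quasi_states C" and
      a: "0 < t \<and> t < 1 \<and> (\<lambda>x. complex_of_real t * g x + complex_of_real (1 - t) * h x) \<in> K \<inter> {f. Re (f0 x) \<le> Re (f x)}"
    then have gK: "g \<in> K" and hK: "h \<in> K" using faceD[OF K gh, of t] by auto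
    have m: "Re (f0 x) \<le> t * Re (g x) + (1 - t) * Re (h x)" and t: "0 < t" "t < 1" using a by auto
    have g: "Re (g x) \<le> Re (f0 x)" and h: "Re (h x) \<le> Re (f0 x)" using f0 gK hK by auto
    have "(1 - t) * Re (h x) \<le> (1 - t) * Re (f0 x)" "t * Re (g x) \<le> t * Re (f0 x)"
      using g h t by (auto intro: mult_left_mono)
    then have "t * Re (f0 x) \<le> t * Re (g x)" "(1 - t) * Re (f0 x) \<le> (1 - t) * Re (h x)"
      using m by (auto simp: algebra_simps)
    then have "Re (f0 x) \<le> Re (g x)" "Re (f0 x) \<le> Re (h x)" using t by auto
    then show "g \<in> K \<inter> {f. Re (f0 x) \<le> Re (f x)}" "h \<in> K \<inter> {f. Re (f0 x) \<le> Re (f x)}" using gK hK by auto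
  qed (use Ksub in auto)
qed

text \<open>A minimal face is unchanged by maximizing the real part at any point, so its members
  share all real parts and, through \<open>\<i> *\<^sub>C x\<close>, all imaginary parts.\<close>

lemma face_contains_extreme:
  assumes C: "cstar_subalgebra C" and K: "face C K"
  obtains f where "f \<in> K" "face C {f}"
proof -
  note cl = cstar_subalgebraD[OF C]
  \<comment> \<open>Complements turn the search for a minimal face into one for a maximal set;
    compactness of \<open>K\<close> keeps intersections of chains nonempty.\<close>
  define \<A> where "\<A> = uminus ` {K'. face C K' \<and> K' \<subseteq> K}"
  have "\<A> \<noteq> {}" using K by (auto simp: \<A>_def)
  moreover have "\<Union>\<C> \<in> \<A>" if ne: "\<C> \<noteq> {}" and ch: "subset.chain \<A> \<C>" for \<C>
  proof -
    define \<F> where "\<F> = uminus ` \<C>"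
    have F: "face C L" "L \<subseteq> K" if "L \<in> \<F>" for L
      using that ch by (auto simp: \<F>_def \<A>_def subset.chain_def)
    have lin: "L \<subseteq> L' \<or> L' \<subseteq> L" if "L \<in> \<F>" "L' \<in> \<F>" for L L'
      using that ch by (auto simp: \<F>_def subset_chain_def)
    have Fne: "\<F> \<noteq> {}" using ne by (simp add: \<F>_def)
    have low: "\<exists>L\<in>\<F>. L \<subseteq> \<Inter>F'" if "finite F'" "F' \<subseteq> \<F>" for F'
      using that
    proof (induction F')
      case empty
      then show ?case using Fne by auto
    next
      case (insert M F')
      then obtain L where L: "L \<in> \<F>" "L \<subseteq> \<Inter>F'" by auto
      show ?case
      proof (cases "L \<subseteq> M")
        case True
        then show ?thesis using L by (intro bexI[of _ L]) auto
      next
        case False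
        then have "M \<subseteq> L" using lin[of L M] insert(4) L by auto
        then show ?thesis using L insert(4) by (intro bexI[of _ M]) auto
      qed
    qed
    have "K \<inter> \<Inter>\<F> \<noteq> {}"
    proof (rule compact_imp_fip[OF face_compact[OF C K]])
      show "closed L" if "L \<in> \<F>" for L using F(1)[OF that] by (simp add: face_def)
      show "K \<inter> \<Inter>F' \<noteq> {}" if F': "finite F'" "F' \<subseteq> \<F>" for F'
      proof -
        obtain L where L: "L \<in> \<F>" "L \<subseteq> \<Inter>F'" using low[OF F'] by blast
        then show ?thesis using F[OF L(1)] unfolding face_def by blast
      qed
    qed
    have "face C (\<Inter>\<F>)"
      unfolding face_def
    proof (intro conjI ballI allI impI)
      show "\<Inter>\<F> \<subseteq> quasi_states C" using F(1) Fne unfolding face_def by blast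
      show "closed (\<Inter>\<F>)" using F(1) by (auto simp: face_def)
      show "\<Inter>\<F> \<noteq> {}" using \<open>K \<inter> \<Inter>\<F> \<noteq> {}\<close> by blast
      fix g h t
      assume "g \<in> quasi_states C" "h \<in> quasi_states C" "0 < t \<and> t < 1 \<and> (\<lambda>x. complex_of_real t * g x + complex_of_real (1 - t) * h x) \<in> \<Inter>\<F>"
      then have "g \<in> L \<and> h \<in> L" if "L \<in> \<F>" for L
        using faceD[OF F(1)[OF that], of g h t] that by simp
      then show "g \<in> \<Inter>\<F>" "h \<in> \<Inter>\<F>" by blast+
    qed
    moreover have "\<Inter>\<F> \<subseteq> K" using F Fne by auto
    moreover have "\<Union>\<C> = - \<Inter>\<F>" by (auto simp: \<F>_def)
    ultimately show ?thesis by (auto simp: \<A>_def)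
  qed
  ultimately obtain M where M: "M \<in> \<A>" "\<And>X. X \<in> \<A> \<Longrightarrow> M \<subseteq> X \<Longrightarrow> X = M"
    using subset_Zorn_nonempty[of \<A>] by blast
  define L where "L = - M"
  have L: "face C L" "L \<subseteq> K" using M by (auto simp: L_def \<A>_def)
  have min: "L' = L" if "face C L'" "L' \<subseteq> L" for L'
    using M(2)[of "- L'"] that L by (auto simp: L_def \<A>_def)
  obtain f where f: "f \<in> L" using L by (auto simp: face_def)
  have "g = f" if g: "g \<in> L" for g
  proof
    fix x
    have re: "Re (g y) = Re (f y)" for y
    proof -
      have "{f \<in> L. \<forall>g\<in>L. Re (g y) \<le> Re (f y)} = L"
        by (rule min[OF face_maximize[OF C L(1)]]) auto
      then show ?thesis using f g by (intro antisym) blast+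
    qed
    have qs: "g \<in> quasi_states C" "f \<in> quasi_states C" using f g L by (auto simp: face_def)
    show "g x = f x"
    proof (cases "x \<in> C")
      case True
      have "h (\<i> *\<^sub>C x) = \<i> * h x" if "h \<in> quasi_states C" for h
        using that True by (auto simp: quasi_states_def quasi_state_on_def linear_functional_on_def)
      then show ?thesis using re[of x] re[of "\<i> *\<^sub>C x"] qs by (simp add: complex_eq_iff)
    qed (use qs in \<open>simp add: quasi_states_def\<close>)
  qed
  then have "L = {f}" using f by blast
  then show ?thesis using that f L by auto
qed

lemma face_quasi_states:
  assumes C: "cstar_subalgebra C"
  shows "face C (quasi_states C)"
proof -
  have "(\<lambda>x. 0) \<in> quasi_states C"
    by (simp add: quasi_states_def quasi_state_on_def linear_functional_on_def positive_on_def)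
  then show ?thesis
    using compact_quasi_states(2)[OF C] by (auto simp: face_def)
qed

text \<open>A nonzero extreme quasi-state has norm 1: with norm at most \<open>1 - e\<close> it
  would lie strictly between 0 and its multiple by \<open>inverse (1 - e)\<close>.\<close>

lemma extreme_pure_state:
  assumes C: "cstar_subalgebra C" and K: "face C {f}" and nz: "z \<in> C" "f z \<noteq> 0"
  shows "pure_state_on C f"
proof -
  note cl = cstar_subalgebraD[OF C]
  have f: "f \<in> quasi_states C" and f0: "\<And>x. x \<notin> C \<Longrightarrow> f x = 0" and q: "quasi_state_on C f"
    using K by (auto simp: face_def quasi_states_def)
  note lf = linear_functional_onD[OF quasi_stateD(1)[OF q] cl(1)]
  have ext: "g = f \<and> h = f" if "g \<in> quasi_states C" "h \<in> quasi_states C" "0 < t" "t < 1"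
    "(\<lambda>x. complex_of_real t * g x + complex_of_real (1 - t) * h x) = f" for g h t
    using faceD[OF K that(1-4)] that(5) by simp
  have "state_on C f"
    unfolding state_on_iff[OF C]
  proof (intro conjI q allI impI)
    fix e :: real assume e: "e > 0"
    show "\<exists>x\<in>C. norm x \<le> 1 \<and> 1 - e < cmod (f x)"
    proof (rule ccontr)
      assume "\<not> ?thesis"
      then have b: "cmod (f x) \<le> 1 - e" if "x \<in> C" "norm x \<le> 1" for x using that by force
      have b': "cmod (f x) \<le> (1 - e) * norm x" if x: "x \<in> C" for x
      proof (cases "x = 0")
        case False
        then have "cmod (f (inverse (norm x) *\<^sub>R x)) \<le> 1 - e" using b[of "inverse (norm x) *\<^sub>R x"] x cl by simp
        then have "cmod (f x) / norm x \<le> 1 - e" using x by (simp add: lf norm_mult norm_inverse divide_inverse mult.commute)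
        then show ?thesis using False by (simp add: divide_le_eq)
      qed (simp add: lf)
      have t: "0 < 1 - e"
      proof (rule ccontr)
        assume "\<not> 0 < 1 - e"
        then have "(1 - e) * norm z \<le> 0" by (simp add: mult_le_0_iff)
        then show False using b'[OF nz(1)] nz(2) by (smt (verit) zero_less_norm_iff)
      qed
      define g where "g x = of_real (inverse (1 - e)) * f x" for x
      have "g \<in> quasi_states C"
        using quasi_state_normalize[OF quasi_stateD(1,2)[OF q] b' t] f0
        by (simp add: quasi_states_def g_def[abs_def] del: of_real_inverse)
      moreover have "(\<lambda>x. 0) \<in> quasi_states C"
        by (simp add: quasi_states_def quasi_state_on_def linear_functional_on_def positive_on_def)
      moreover have "(\<lambda>x. complex_of_real (1 - e) * g x + complex_of_real (1 - (1 - e)) * 0) = f"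
      proof
        fix x
        have "complex_of_real (1 - e) * g x = of_real ((1 - e) * inverse (1 - e)) * f x"
          unfolding g_def by (simp only: of_real_mult mult.assoc)
        then show "complex_of_real (1 - e) * g x + complex_of_real (1 - (1 - e)) * 0 = f x" using t by simp
      qed
      ultimately have "(\<lambda>x. 0) = f" using ext[of g "\<lambda>x. 0" "1 - e"] e t by auto
      then show False using nz fun_cong[of "\<lambda>x. 0" f z] by simp
    qed
  qed
  moreover have "g x = f x \<and> h x = f x"
    if g: "state_on C g" and h: "state_on C h" and t: "0 < t" "t < 1" and x: "x \<in> C"
      and eq: "\<forall>x\<in>C. f x = complex_of_real t * g x + complex_of_real (1 - t) * h x" for g h t x
  proof -
    have gh: "(\<lambda>x. if x \<in> C then g x else 0) = f \<and> (\<lambda>x. if x \<in> C then h x else 0) = f"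
      using eq f0 t by (intro ext truncate_quasi_state C state_onD(1)[OF C g] state_onD(1)[OF C h]) auto
    show ?thesis using fun_cong[OF conjunct1[OF gh], of x] fun_cong[OF conjunct2[OF gh], of x] x by simp
  qed
  ultimately show ?thesis unfolding pure_state_on_def by blast
qed

text \<open>The quasi-states with the largest real value at \<open>star x * x\<close> form a face; a
  state that norms this element shows what the value is, and an extreme point of the face is
  pure.\<close>

lemma norming_pure_state:
  assumes C: "cstar_subalgebra C" and x: "x \<in> C" "x \<noteq> 0"
  obtains f where "pure_state_on C f" "f (star x * x) = of_real ((norm x)\<^sup>2)"
proof -
  note cl = cstar_subalgebraD[OF C]
  obtain \<phi> where \<phi>: "nstate \<phi>" "\<phi> (star (emb x) * emb x) = norm (star (emb x) * emb x)"
    using nstate_norm_cpos[OF cpos_star_mult] .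
  then have \<phi>x: "\<phi> (emb (star x * x)) = of_real ((norm x)\<^sup>2)" by (simp add: emb_hom cstar_identity)
  let ?y = "star x * x"
  have y: "?y \<in> C" using x cl by simp
  let ?\<psi> = "\<lambda>x. if x \<in> C then \<phi> (emb x) else 0"
  have \<psi>: "?\<psi> \<in> quasi_states C"
    by (intro truncate_quasi_state C quasi_state_subset[OF nstate_quasi_state[OF \<phi>(1)]]) simp
  obtain f where f: "f \<in> quasi_states C" "\<forall>g\<in>quasi_states C. Re (g ?y) \<le> Re (f ?y)" "face C {f}"
    using face_contains_extreme[OF C face_maximize[OF C face_quasi_states[OF C]], of ?y] by blast
  have q: "quasi_state_on C f" using f by (simp add: quasi_states_def)
  have "(norm x)\<^sup>2 \<le> Re (f ?y)" using bspec[OF f(2) \<psi>] y \<phi>x by simp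
  moreover have "Re (f ?y) \<le> (norm x)\<^sup>2"
    using complex_Re_le_cmod[of "f ?y"] quasi_stateD(3)[OF q y] by (simp add: cstar_identity)
  ultimately have fy: "f ?y = of_real ((norm x)\<^sup>2)" using quasi_state_square_real(1)[OF q x(1)] by simp
  moreover have "pure_state_on C f" using x fy by (intro extreme_pure_state[OF C f(3) y]) auto
  ultimately show ?thesis by (rule that[rotated])
qed

section \<open>The extension property\<close>

lemma pure_state_extensions_face:
  assumes C: "cstar_subalgebra C" and f: "pure_state_on C f"
  shows "face UNIV {g \<in> quasi_states UNIV. \<forall>x\<in>C. g x = f x}"
proof -
  have eq: "{g \<in> quasi_states UNIV. \<forall>x\<in>C. g x = f x} = quasi_states UNIV \<inter> (\<Inter>x\<in>C. {g. g x = f x})"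
    by auto
  have sub: "quasi_state_on C g" if "g \<in> quasi_states UNIV" for g
    using that quasi_state_subset[of UNIV g C] by (simp add: quasi_states_def)
  obtain g where "quasi_state_on UNIV g" "\<And>x. x \<in> C \<Longrightarrow> g x = f x"
    using quasi_state_extension[OF C pure_stateD(2)[OF C f]] by blast
  then have ne: "{g \<in> quasi_states UNIV. \<forall>x\<in>C. g x = f x} \<noteq> {}" by (auto simp: quasi_states_def)
  have cl: "closed {g \<in> quasi_states UNIV. \<forall>x\<in>C. g x = f x}"
    unfolding eq
    by (intro closed_Int compact_quasi_states(2) closed_INT ballI closed_Collect_eq continuous_intros) simp
  show ?thesis
    unfolding face_def
  proof (intro conjI ballI allI impI)
    fix g h t
    assume gh: "g \<in> quasi_states UNIV" "h \<in> quasi_states UNIV" and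
      a: "0 < t \<and> t < 1 \<and> (\<lambda>x. complex_of_real t * g x + complex_of_real (1 - t) * h x) \<in> {g \<in> quasi_states UNIV. \<forall>x\<in>C. g x = f x}"
    have "f x = complex_of_real t * g x + complex_of_real (1 - t) * h x" if "x \<in> C" for x using a that by simp
    from pure_state_convex_combination[OF C f sub[OF gh(1)] sub[OF gh(2)] _ _ this] a
    show "g \<in> {g \<in> quasi_states UNIV. \<forall>x\<in>C. g x = f x}" "h \<in> {g \<in> quasi_states UNIV. \<forall>x\<in>C. g x = f x}"
      using gh by auto
  qed (use ne cl in auto)
qed

text \<open>Among the quasi-state extensions there are pure ones that maximize and minimize the real
  part at a given \<open>y\<close>. The extension property makes them equal, so the real part at
  \<open>y\<close> is constant on all extensions.\<close>

lemma extension_property_unique: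
  assumes C: "cstar_subalgebra C" and EP: "extension_property C" and f: "pure_state_on C f"
    and g: "quasi_state_on UNIV g" "\<And>x. x \<in> C \<Longrightarrow> g x = f x"
    and h: "quasi_state_on UNIV h" "\<And>x. x \<in> C \<Longrightarrow> h x = f x"
  shows "g = h"
proof -
  define K where "K = {g \<in> quasi_states UNIV. \<forall>x\<in>C. g x = f x}"
  have K: "face UNIV K" unfolding K_def by (rule pure_state_extensions_face[OF C f])
  obtain x0 where x0: "x0 \<in> C" "f x0 \<noteq> 0" using pure_state_nonzero[OF C f] .
  have ex: "\<exists>k. pure_state_on UNIV k \<and> k \<in> K \<and> (\<forall>l\<in>K. Re (l y) \<le> Re (k y))" for y
  proof -
    obtain k where k: "k \<in> K" "\<forall>l\<in>K. Re (l y) \<le> Re (k y)" "face UNIV {k}"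
      using face_contains_extreme[OF cstar_subalgebra_UNIV face_maximize[OF cstar_subalgebra_UNIV K]] by blast
    have "pure_state_on UNIV k"
      using k x0 by (intro extreme_pure_state[where z = x0]) (auto simp: K_def)
    then show ?thesis using k by blast
  qed
  have gK: "g \<in> K" and hK: "h \<in> K" using g h by (auto simp: K_def quasi_states_def)
  have glin: "clinear g" and hlin: "clinear h"
    using g h by (auto simp: quasi_state_on_def linear_functional_UNIV)
  have re: "Re (g y) = Re (h y)" for y
  proof -
    obtain k where k: "pure_state_on UNIV k" "k \<in> K" "\<And>l. l \<in> K \<Longrightarrow> Re (l y) \<le> Re (k y)" using ex by blast
    obtain k' where k': "pure_state_on UNIV k'" "k' \<in> K" "\<And>l. l \<in> K \<Longrightarrow> Re (l (- y)) \<le> Re (k' (- y))" using ex by blast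
    have "k' = k" using EP f k(1,2) k'(1,2) unfolding extension_property_def K_def by blast
    moreover have "clinear k" using k(2) by (simp add: K_def quasi_states_def quasi_state_on_def linear_functional_UNIV)
    ultimately have "Re (l y) = Re (k y)" if "l \<in> K" for l
      using k(3)[OF that] k'(3)[OF that] that
      by (simp add: clinearD K_def quasi_states_def quasi_state_on_def linear_functional_UNIV)
    then show ?thesis using gK hK by simp
  qed
  show ?thesis
  proof
    fix y
    show "g y = h y" using re[of y] re[of "\<i> *\<^sub>C y"] by (simp add: clinearD[OF glin] clinearD[OF hlin] complex_eq_iff)
  qed
qed

section \<open>Masas, commutants and nondegeneracy\<close>

lemma masa_subalgebra: "masa C \<Longrightarrow> cstar_subalgebra C" and masa_abelian: "masa C \<Longrightarrow> abelian C"
  by (auto simp: masa_def)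

definition commutant :: "'a::times set \<Rightarrow> 'a set"
  where "commutant S = {z. \<forall>s\<in>S. z * s = s * z}"

lemma cstar_subalgebra_commutant:
  fixes S :: "'a::cstar_algebra set"
  assumes S: "\<And>s. s \<in> S \<Longrightarrow> star s \<in> S"
  shows "cstar_subalgebra (commutant S)"
proof -
  have "commutant S = (\<Inter>s\<in>S. {z. z * s = s * z})" by (auto simp: commutant_def)
  moreover have "closed (\<Inter>s\<in>S. {z. z * s = s * z})"
    by (intro closed_INT ballI closed_Collect_eq continuous_intros)
  ultimately have "closed (commutant S)" by simp
  moreover have "star z \<in> commutant S" if "z \<in> commutant S" for z
    unfolding commutant_def
  proof (intro CollectI ballI)
    fix s assume "s \<in> S"
    then have "star (z * star s) = star (star s * z)" using that S by (simp add: commutant_def)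
    then show "star z * s = s * star z" by (simp add: star_simps)
  qed
  moreover have "x * y * s = s * (x * y)" if "x * s = s * x" "y * s = s * y" for x y s :: 'a
    using that by (metis mult.assoc)
  ultimately show ?thesis
    by (auto simp: cstar_subalgebra_def complex_vector.subspace_def commutant_def distrib_left distrib_right
        mult_scaleC_left mult_scaleC_right)
qed

text \<open>For self-adjoint \<open>k\<close> commuting with \<open>C\<close>, the set
  \<open>insert k C\<close> is commutative, so its double commutant lies in its commutant and is
  abelian; maximality puts \<open>k\<close> into \<open>C\<close>. A general \<open>y\<close> is
  split into self-adjoint parts, which also commute with \<open>C\<close>.\<close>

lemma masa_commutant:
  assumes C: "masa C" and y: "\<And>c. c \<in> C \<Longrightarrow> y * c = c * y"
  shows "y \<in> C"
proof -
  note Csub = masa_subalgebra[OF C]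
  note cl = cstar_subalgebraD[OF Csub]
  have comm: "x * y = y * x" if "x \<in> C" "y \<in> C" for x y
    using masa_abelian[OF C] that by (auto simp: abelian_def)
  have sa: "k \<in> C" if k: "star k = k" "\<And>c. c \<in> C \<Longrightarrow> k * c = c * k" for k
  proof -
    define S where "S = insert k C"
    have S: "star s \<in> S" if "s \<in> S" for s using that k cl by (auto simp: S_def)
    define S1 where "S1 = commutant S"
    have S1: "cstar_subalgebra S1" unfolding S1_def by (rule cstar_subalgebra_commutant[OF S])
    have SS1: "S \<subseteq> S1" using k(2) comm by (auto simp: S1_def S_def commutant_def)
    define B where "B = commutant S1"
    have B: "cstar_subalgebra B"
      unfolding B_def by (rule cstar_subalgebra_commutant) (rule cstar_subalgebraD(4)[OF S1])
    have "B \<subseteq> S1" using SS1 by (auto simp: B_def S1_def commutant_def)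
    then have "abelian B" by (auto simp: abelian_def B_def commutant_def)
    moreover have "S \<subseteq> B" by (auto simp: B_def S1_def commutant_def)
    ultimately have "B = C" using C B by (auto simp: masa_def S_def)
    then show ?thesis using \<open>S \<subseteq> B\<close> by (auto simp: S_def)
  qed
  have y': "star y * c = c * star y" if "c \<in> C" for c
  proof -
    have "star (y * star c) = star (star c * y)" using y[of "star c"] that cl by simp
    then show ?thesis by (simp add: star_simps)
  qed
  have "(1/2) *\<^sub>R (y + star y) \<in> C"
    by (rule sa[OF selfadjoint_decomposition(2)]) (simp add: y y' distrib_left distrib_right)
  moreover have "(1/2) *\<^sub>R ((- \<i>) *\<^sub>C (y - star y)) \<in> C"
    by (rule sa[OF selfadjoint_decomposition(3)])
      (simp add: y y' left_diff_distrib right_diff_distrib mult_scaleC_left mult_scaleC_right)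
  ultimately have "(1/2) *\<^sub>R (y + star y) + \<i> *\<^sub>C ((1/2) *\<^sub>R ((- \<i>) *\<^sub>C (y - star y))) \<in> C" by (simp only: cl)
  then show ?thesis using selfadjoint_decomposition(1)[of y] by simp
qed

lemma quasi_state_vanish_unit:
  assumes g: "quasi_state_on UNIV g" and u: "\<And>x. u * x = x \<and> x * u = x" and gu: "g u = 0"
  shows "g x = 0"
proof -
  have "star u = u" using u[of "star u"] u[of "star (star u)"] by (metis star_mult star_star)
  then have "star u * u = u" using u by simp
  have "(cmod (g (star u * x)))\<^sup>2 \<le> Re (g (star u * u)) * Re (g (star x * x))"
    by (rule positive_form(2)[OF cstar_subalgebra_UNIV quasi_stateD(1,2)[OF g]]) auto
  then show ?thesis using \<open>star u = u\<close> \<open>star u * u = u\<close> gu u by simp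
qed

text \<open>The definition excludes only pure states. The quasi-states annihilating \<open>C\<close>
  form a face, since the components of such a combination are nonnegative on squares from
  \<open>C\<close> and hence vanish there; a nonzero member would produce a nonzero extreme one. If
  there is a unit, the masa contains it.\<close>

lemma extension_property_vanish:
  fixes C :: "'a::cstar_algebra set"
  assumes M: "masa C" and EP: "extension_property C"
    and g: "quasi_state_on UNIV g" "\<And>x. x \<in> C \<Longrightarrow> g x = 0"
  shows "g x = 0"
proof (cases "unital TYPE('a)")
  case True
  then obtain u :: 'a where u: "\<And>x. u * x = x \<and> x * u = x" by (auto simp: unital_def)
  then have "u \<in> C" by (intro masa_commutant[OF M]) simp
  then show ?thesis using quasi_state_vanish_unit[OF g(1) u] g(2) by blast
next
  case False
  note C = masa_subalgebra[OF M]
  note cl = cstar_subalgebraD[OF C]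
  define K where "K = {g \<in> quasi_states UNIV. \<forall>x\<in>C. g x = 0}"
  have eq: "K = quasi_states UNIV \<inter> (\<Inter>x\<in>C. {g. g x = 0})" by (auto simp: K_def)
  have gK: "g \<in> K" using g by (auto simp: K_def quasi_states_def)
  have "closed K" unfolding eq
    by (intro closed_Int compact_quasi_states(2) closed_INT ballI closed_Collect_eq continuous_intros) simp
  have vanish: "k x = 0" if "k \<in> quasi_states UNIV" "\<And>x. x \<in> C \<Longrightarrow> Re (k (star x * x)) \<le> 0" "x \<in> C" for k x
  proof -
    have "quasi_state_on UNIV k" using that by (simp add: quasi_states_def)
    from quasi_state_star(2)[OF cstar_subalgebra_UNIV this UNIV_I, of x] that(2)[OF that(3)]
    have "(cmod (k x))\<^sup>2 \<le> 0" by linarith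
    then show ?thesis by simp
  qed
  have K: "face UNIV K"
    unfolding face_def
  proof (intro conjI ballI allI impI)
    fix k l t
    assume kl: "k \<in> quasi_states UNIV" "l \<in> quasi_states UNIV" and
      a: "0 < t \<and> t < 1 \<and> (\<lambda>x. complex_of_real t * k x + complex_of_real (1 - t) * l x) \<in> K"
    have q: "quasi_state_on UNIV k" "quasi_state_on UNIV l" using kl by (auto simp: quasi_states_def)
    have le: "Re (k (star x * x)) \<le> 0 \<and> Re (l (star x * x)) \<le> 0" if "x \<in> C" for x
    proof -
      have "star x * x \<in> C" using that cl by simp
      then have "complex_of_real t * k (star x * x) + complex_of_real (1 - t) * l (star x * x) = 0"
        using a unfolding K_def by blast
      from arg_cong[OF this, of Re] have "t * Re (k (star x * x)) + (1 - t) * Re (l (star x * x)) = 0" by simp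
      moreover have "0 \<le> Re (k (star x * x))" "0 \<le> Re (l (star x * x))"
        using quasi_state_square_real(2)[OF q(1), of x] quasi_state_square_real(2)[OF q(2), of x] by auto
      ultimately have "t * Re (k (star x * x)) = 0 \<and> (1 - t) * Re (l (star x * x)) = 0"
        using a by (subst add_nonneg_eq_0_iff[symmetric]) auto
      then show ?thesis using a by auto
    qed
    show "k \<in> K" "l \<in> K" using vanish[of k] vanish[of l] le kl by (auto simp: K_def)
  qed (use gK \<open>closed K\<close> in \<open>auto simp: K_def\<close>)
  show ?thesis
  proof (rule ccontr)
    assume nz: "g x \<noteq> 0"
    \<comment> \<open>Rotated so that \<open>g y > 0\<close>; the maximizing extreme point is then
      nonzero at \<open>y\<close>.\<close>
    define y where "y = cnj (g x) *\<^sub>C x"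
    have "g y = of_real ((cmod (g x))\<^sup>2)"
      using linear_functional_onD(2)[OF quasi_stateD(1)[OF g(1)] complex_vector.subspace_UNIV, of x "cnj (g x)"]
      by (simp add: y_def cnj_mult_self)
    then have gy: "Re (g y) > 0" using nz by simp
    obtain k where k: "k \<in> K" "\<forall>l\<in>K. Re (l y) \<le> Re (k y)" "face UNIV {k}"
      using face_contains_extreme[OF cstar_subalgebra_UNIV face_maximize[OF cstar_subalgebra_UNIV K]] by blast
    have "k y \<noteq> 0" using bspec[OF k(2) gK] gy by auto
    then have "pure_state_on UNIV k" using k by (intro extreme_pure_state[where z = y]) auto
    then show False using EP False k(1) unfolding extension_property_def K_def by blast
  qed
qed

text \<open>Uniqueness among quasi-states makes the extension pure: in a decomposition of
  \<open>g\<close> both components restrict to the pure \<open>f\<close>, and so both equal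
  \<open>g\<close>.\<close>

lemma extension_propertyI:
  fixes C :: "'a::cstar_algebra set"
  assumes C: "cstar_subalgebra C"
    and uniq: "\<And>f g h. pure_state_on C f \<Longrightarrow> quasi_state_on UNIV g \<Longrightarrow> quasi_state_on UNIV h \<Longrightarrow>
      (\<And>x. x \<in> C \<Longrightarrow> g x = f x) \<Longrightarrow> (\<And>x. x \<in> C \<Longrightarrow> h x = f x) \<Longrightarrow> g = h"
    and vanish: "\<And>g x. quasi_state_on UNIV g \<Longrightarrow> (\<And>x. x \<in> C \<Longrightarrow> g x = 0) \<Longrightarrow> g x = 0"
  shows "extension_property C"
  unfolding extension_property_def
proof (intro conjI allI impI)
  fix f assume f: "pure_state_on C f"
  obtain g where g: "quasi_state_on UNIV g" "\<And>x. x \<in> C \<Longrightarrow> g x = f x"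
    using quasi_state_extension[OF C pure_stateD(2)[OF C f]] by blast
  have qC: "quasi_state_on C k" if "state_on UNIV k" for k
    using quasi_state_subset[OF state_onD(1)[OF cstar_subalgebra_UNIV that], of C] by simp
  have st: "state_on UNIV g"
    by (rule state_on_extends[OF C pure_stateD(1)[OF C f] cstar_subalgebra_UNIV _ g]) simp
  have "pure_state_on UNIV g"
    unfolding pure_state_on_def
  proof (intro conjI st allI impI)
    fix k l t
    assume a: "state_on UNIV k \<and> state_on UNIV l \<and> 0 < t \<and> t < 1 \<and>
      (\<forall>x\<in>UNIV. g x = complex_of_real t * k x + complex_of_real (1 - t) * l x)"
    then have kl: "quasi_state_on UNIV k" "quasi_state_on UNIV l" and t: "0 < t" "t < 1"
      using state_onD(1)[OF cstar_subalgebra_UNIV] by auto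
    have "f x = complex_of_real t * k x + complex_of_real (1 - t) * l x" if "x \<in> C" for x
      using a g(2)[OF that] by simp
    from pure_state_convex_combination[OF C f quasi_state_subset[OF kl(1)] quasi_state_subset[OF kl(2)] t this]
    have klC: "k x = f x" "l x = f x" if "x \<in> C" for x using that by auto
    have "k = g" by (rule uniq[OF f kl(1) g(1) klC(1) g(2)])
    moreover have "l = g" by (rule uniq[OF f kl(2) g(1) klC(2) g(2)])
    ultimately show "\<forall>x\<in>UNIV. k x = g x \<and> l x = g x" by simp
  qed
  then show "\<exists>!g. pure_state_on UNIV g \<and> (\<forall>x\<in>C. g x = f x)"
  proof (intro ex1I[of _ g] conjI ballI)
    fix h assume h: "pure_state_on UNIV h \<and> (\<forall>x\<in>C. h x = f x)"
    then show "h = g"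
      using uniq[OF f pure_stateD(2)[OF cstar_subalgebra_UNIV] g(1) _ g(2)] by blast
  qed (use g in auto)
next
  show "\<nexists>g. pure_state_on UNIV g \<and> (\<forall>x\<in>C. g x = 0)"
  proof
    assume "\<exists>g. pure_state_on UNIV g \<and> (\<forall>x\<in>C. g x = 0)"
    then obtain g where g: "pure_state_on UNIV g" "\<And>x. x \<in> C \<Longrightarrow> g x = 0" by blast
    obtain x where "g x \<noteq> 0" using pure_state_nonzero[OF cstar_subalgebra_UNIV g(1)] by blast
    then show False using vanish[OF pure_stateD(2)[OF cstar_subalgebra_UNIV g(1)] g(2)] by blast
  qed
qed

text \<open>Polarization extends the vanishing to all \<open>star y * z\<close>, and an approximate
  unit writes \<open>x\<close> as a limit of such products.\<close>

lemma functional_vanish_on_squares: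
  assumes C: "cstar_subalgebra C" and d: "linear_functional_on C d"
    and le: "\<And>x. x \<in> C \<Longrightarrow> cmod (d x) \<le> K * norm x"
    and sq: "\<And>y. y \<in> C \<Longrightarrow> d (star y * y) = 0" and x: "x \<in> C"
  shows "d x = 0"
proof -
  note cl = cstar_subalgebraD[OF C]
  note lf = linear_functional_onD[OF d cl(1)]
  have pol: "d (star y * z) = 0" if y: "y \<in> C" and z: "z \<in> C" for y z
  proof -
    have 1: "d (star (y + z) * (y + z)) = 0" and 2: "d (star (y + \<i> *\<^sub>C z) * (y + \<i> *\<^sub>C z)) = 0"
      using y z cl by (auto intro!: sq)
    have "d (star y * z) + d (star z * y) = 0"
      using 1 y z cl by (simp add: star_simps distrib_left distrib_right lf sq add.commute)
    moreover have "\<i> * d (star y * z) - \<i> * d (star z * y) = 0"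
      using 2 y z cl by (simp add: star_simps distrib_left distrib_right mult_scaleC_left mult_scaleC_right left_diff_distrib lf sq scaleC_scaleC)
    ultimately show ?thesis by (simp add: algebra_simps)
  qed
  have "cmod (d x) \<le> 0 + \<epsilon>" if e: "\<epsilon> > 0" for \<epsilon> :: real
  proof -
    have "\<epsilon> / (\<bar>K\<bar> + 1) > 0" using e by (simp add: add_nonneg_pos)
    from approximate_left_unit[OF C x this]
    obtain e where e': "e \<in> C" "star e = e" "norm (e * x - x) < \<epsilon> / (\<bar>K\<bar> + 1)" by blast
    have "d (e * x - x) = - d x" using pol[OF e'(1) x] e' x cl by (simp add: lf)
    then have "cmod (d x) \<le> K * norm (e * x - x)" using le[of "e * x - x"] e' x cl by simp
    also have "\<dots> \<le> (\<bar>K\<bar> + 1) * norm (e * x - x)" by (intro mult_right_mono) auto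
    also have "\<dots> \<le> (\<bar>K\<bar> + 1) * (\<epsilon> / (\<bar>K\<bar> + 1))" using e' by (intro mult_left_mono) auto
    finally show ?thesis by (simp add: add_nonneg_pos)
  qed
  then have "cmod (d x) \<le> 0" by (rule field_le_epsilon)
  then show ?thesis by simp
qed

lemma character_normalized:
  assumes C: "cstar_subalgebra C" and f: "character_on C f" and x: "x \<in> C" "f x \<noteq> 0"
  obtains c where "c \<in> C" "star c = c" "f c = 1"
proof
  note cl = cstar_subalgebraD[OF C]
  have q: "quasi_state_on C f" by (rule character_quasi_state[OF C f])
  note lf = linear_functional_onD[OF quasi_stateD(1)[OF q] cl(1)]
  define s where "s = (cmod (f x))\<^sup>2"
  have s: "s \<noteq> 0" using x by (simp add: s_def)
  have "f (star x * x) = of_real s"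
    using f x cl quasi_state_star(1)[OF C q x(1)] by (simp add: character_on_def cnj_mult_self s_def)
  then show "f (inverse s *\<^sub>R (star x * x)) = 1" using x cl s by (simp add: lf)
  show "inverse s *\<^sub>R (star x * x) \<in> C" using x cl by simp
  show "star (inverse s *\<^sub>R (star x * x)) = inverse s *\<^sub>R (star x * x)" by (simp add: star_simps)
qed

text \<open>Compress by \<open>c \<in> C\<close> with \<open>f c = 1\<close>. The compressed functional is a multiple of a state and
  extends \<open>\<kappa> f\<close>; the complementary compression by \<open>1 - c\<close> vanishes on \<open>C\<close>, hence everywhere, and the
  mixed terms then vanish by the Cauchy-Schwarz inequality.\<close>

lemma positive_extension_unique:
  assumes M: "masa C" and EP: "extension_property C" and f: "pure_state_on C f"
    and g: "quasi_state_on UNIV g" "\<And>x. x \<in> C \<Longrightarrow> g x = f x"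
    and \<psi>: "linear_functional_on UNIV \<psi>" "positive_on UNIV \<psi>" "\<And>x. cmod (\<psi> x) \<le> K * norm x"
    and \<psi>f: "\<And>x. x \<in> C \<Longrightarrow> \<psi> x = \<kappa> * f x"
  shows "\<psi> x = \<kappa> * g x"
proof -
  note C = masa_subalgebra[OF M]
  note cl = cstar_subalgebraD[OF C]
  have char: "character_on C f" by (rule pure_state_character[OF C masa_abelian[OF M] f])
  then have fm: "f (x * y) = f x * f y" if "x \<in> C" "y \<in> C" for x y using that by (auto simp: character_on_def)
  note lf = linear_functional_onD[OF quasi_stateD(1)[OF pure_stateD(2)[OF C f]] cl(1)]
  \<comment> \<open>The added 1 gives a positive normalizing constant whatever the sign of
    \<open>K\<close>.\<close>
  define L where "L = \<bar>K\<bar> + 1"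
  have L: "L > 0" by (simp add: L_def add_nonneg_pos)
  define \<psi>1 where "\<psi>1 x = of_real (inverse L) * \<psi> x" for x
  have q: "quasi_state_on UNIV \<psi>1"
    unfolding \<psi>1_def[abs_def]
  proof (rule quasi_state_normalize[OF \<psi>(1,2) _ L])
    show "cmod (\<psi> x) \<le> L * norm x" for x
      by (rule order_trans[OF \<psi>(3)]) (auto simp: L_def intro: mult_right_mono)
  qed
  define \<kappa>1 where "\<kappa>1 = of_real (inverse L) * \<kappa>"
  have \<psi>1f: "\<psi>1 x = \<kappa>1 * f x" if "x \<in> C" for x using \<psi>f[OF that] by (simp add: \<psi>1_def \<kappa>1_def)
  have "\<exists>F. nstate F \<and> (\<forall>x. F (emb x) = \<psi>1 x)"
    by (rule quasi_state_nstate[OF cstar_subalgebra_UNIV q]) (intro exI conjI allI, assumption, simp)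
  then obtain F where F: "nstate F" "\<And>x. F (emb x) = \<psi>1 x" by blast
  have lin: "clinear F" and one: "F 1 = 1" using F(1) by (auto simp: nstate_def)
  have Fpos: "linear_functional_on UNIV F" "positive_on UNIV F"
    using lin nstate_star_mult[OF F(1)] by (auto simp: linear_functional_UNIV positive_on_def)
  obtain z where z: "z \<in> C" "f z \<noteq> 0" using pure_state_nonzero[OF C f] .
  obtain c0 where c0: "c0 \<in> C" "star c0 = c0" "f c0 = 1" using character_normalized[OF C char z] .
  define c where "c = emb c0"
  define d where "d = 1 - c"
  have sc: "star c = c" and sd: "star d = d" by (simp_all add: c_def d_def c0 star_simps flip: emb_hom)
  have Fcc: "F (c * c) = \<kappa>1" using c0 cl by (simp add: c_def F(2) \<psi>1f fm flip: emb_hom)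
  \<comment> \<open>The factor \<open>\<kappa>\<close> is an arbitrary complex number; as a value at
    \<open>star c * c\<close> its normalized form turns out real and nonnegative.\<close>
  define k where "k = Re (F (c * c))"
  have k0: "0 \<le> k" and \<kappa>1: "\<kappa>1 = of_real k"
    using nonneg_Reals_Re(1)[OF nstate_star_mult[OF F(1), of c]] nonneg_Reals_Re(2)[OF nstate_star_mult[OF F(1), of c]]
    unfolding sc k_def Fcc[symmetric] by blast+
  note Fcc = Fcc[unfolded \<kappa>1]
  have comp: "F (c * emb a * c) = \<kappa>1 * g a" for a
  proof (cases "k = 0")
    case True
    then have "cmod (F (c * emb a * c)) \<le> 0"
      using nstate_compression[OF F(1) sc, of "emb a"] by (simp add: Fcc)
    then show ?thesis using True by (simp add: \<kappa>1)
  next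
    case False
    then have pos: "k > 0" using k0 by simp
    have "quasi_state_on UNIV (\<lambda>a. of_real (inverse (k)) * F (c * emb a * c))"
    proof (rule quasi_state_normalize[OF _ _ _ pos])
      show "linear_functional_on UNIV (\<lambda>a. F (c * emb a * c))"
        by (simp add: linear_functional_on_def emb_hom distrib_left distrib_right mult_scaleC_left
            mult_scaleC_right clinearD[OF lin])
      show "positive_on UNIV (\<lambda>a. F (c * emb a * c))"
        using nstate_star_mult[OF F(1), of "emb a * c" for a]
        by (simp add: positive_on_def emb_hom star_simps sc mult.assoc)
      show "cmod (F (c * emb a * c)) \<le> k * norm a" for a
        using nstate_compression[OF F(1) sc, of "emb a"] by (simp add: Fcc)
    qed
    moreover have "of_real (inverse (k)) * F (c * emb a * c) = f a" if "a \<in> C" for a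
    proof -
      have "F (c * emb a * c) = of_real (k) * f a"
        using that c0 cl by (simp add: c_def F(2) \<psi>1f fm \<kappa>1 flip: emb_hom)
      then show ?thesis using pos by simp
    qed
    ultimately have "(\<lambda>a. of_real (inverse (k)) * F (c * emb a * c)) = g"
      by (rule extension_property_unique[OF C EP f _ _ g])
    from fun_cong[OF this, of a] show ?thesis
      using pos by (simp add: \<kappa>1 field_simps)
  qed
  have dd0: "F (d * emb a * d) = 0" for a
  proof -
    define N where "N = Re (F (d * d)) + 1"
    have "0 \<le> Re (F (d * d))" using nonneg_Reals_Re(1)[OF nstate_star_mult[OF F(1), of d]] by (simp add: sd)
    then have N: "N > 0" by (simp add: N_def)
    have "quasi_state_on UNIV (\<lambda>a. of_real (inverse N) * F (d * emb a * d))"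
    proof (rule quasi_state_normalize[OF _ _ _ N])
      show "linear_functional_on UNIV (\<lambda>a. F (d * emb a * d))"
        by (simp add: linear_functional_on_def emb_hom distrib_left distrib_right mult_scaleC_left
            mult_scaleC_right clinearD[OF lin])
      show "positive_on UNIV (\<lambda>a. F (d * emb a * d))"
        using nstate_star_mult[OF F(1), of "emb a * d" for a]
        by (simp add: positive_on_def emb_hom star_simps sd mult.assoc)
      show "cmod (F (d * emb a * d)) \<le> N * norm a" for a
        using nstate_compression[OF F(1) sd, of "emb a"] by (simp add: N_def distrib_right add_increasing2)
    qed
    moreover have "of_real (inverse N) * F (d * emb a * d) = 0" if "a \<in> C" for a
    proof -
      have "d * emb a * d = emb (a - c0 * a - a * c0 + c0 * a * c0)"
        by (simp add: d_def c_def emb_hom algebra_simps)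
      then show ?thesis using that c0 cl by (simp add: F(2) \<psi>1f fm lf)
    qed
    ultimately have "of_real (inverse N) * F (d * emb a * d) = 0" by (rule extension_property_vanish[OF M EP])
    then show ?thesis using N by simp
  qed
  have CS: "(cmod (F (star u * v)))\<^sup>2 \<le> Re (F (star u * u)) * Re (F (star v * v))" for u v
    by (rule positive_form(2)[OF cstar_subalgebra_UNIV Fpos]) auto
  have "F (c * emb a * d) = 0" for a
    using CS[of c "emb a * d"] dd0[of "star a * a"] by (simp add: star_simps sc sd emb_hom mult.assoc)
  moreover have "F (d * emb a * c) = 0" for a
    using CS[of "star (emb a) * d" c] dd0[of "a * star a"] by (simp add: star_simps sc sd emb_hom mult.assoc)
  moreover have "emb x = c * emb x * c + c * emb x * d + d * emb x * c + d * emb x * d"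
    by (simp add: d_def algebra_simps)
  ultimately have "F (emb x) = \<kappa>1 * g x"
    using dd0[of x] comp[of x] clinearD(1)[OF lin] by (metis add.right_neutral)
  then have "of_real (inverse L) * \<psi> x = of_real (inverse L) * (\<kappa> * g x)" by (simp add: F(2) \<psi>1_def \<kappa>1_def)
  then show ?thesis using L by simp
qed

section \<open>A Stone-Weierstrass theorem\<close>

text \<open>Function spaces are not an instance of Hausdorff spaces in the library, so functionals are
  wrapped in a type of their own.\<close>

datatype 'a functional = Functional (app: "'a \<Rightarrow> complex")

instantiation functional :: (type) t2_space
begin

definition open_functional :: "'a functional set \<Rightarrow> bool"
  where "open_functional U \<longleftrightarrow> open (Functional -` U)"

instance
proof
  show "open (UNIV :: 'a functional set)" by (simp add: open_functional_def)
  show "open (S \<inter> T)" if "open S" "open T" for S T :: "'a functional set"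
    using that by (simp add: open_functional_def vimage_Int open_Int)
  show "open (\<Union>K)" if "\<forall>S\<in>K. open S" for K :: "'a functional set set"
    using that by (auto simp: open_functional_def vimage_Union)
  fix f g :: "'a functional"
  assume "f \<noteq> g"
  then have "app f \<noteq> app g" using functional.expand by blast
  then obtain x where x: "app f x \<noteq> app g x" by (auto simp: fun_eq_iff)
  obtain U V where UV: "open U" "open V" "app f x \<in> U" "app g x \<in> V" "U \<inter> V = {}"
    using hausdorff[OF x] by blast
  have "open ((\<lambda>f. app f x) -` W)" if W: "open W" for W
  proof -
    have "open ((\<lambda>f :: 'a \<Rightarrow> complex. f x) -` W)" using W by (intro open_vimage) auto
    moreover have "Functional -` ((\<lambda>f. app f x) -` W) = (\<lambda>f :: 'a \<Rightarrow> complex. f x) -` W" by auto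
    ultimately show ?thesis by (simp add: open_functional_def)
  qed
  then show "\<exists>U V. open U \<and> open V \<and> f \<in> U \<and> g \<in> V \<and> U \<inter> V = {}"
    using UV by (intro exI[of _ "(\<lambda>f. app f x) -` U"] exI[of _ "(\<lambda>f. app f x) -` V"]) auto
qed

end

lemma continuous_on_app: "continuous_on S (\<lambda>f. app f x)"
proof (rule continuous_on_subset[OF _ subset_UNIV])
  show "continuous_on UNIV (\<lambda>f. app f x)"
    unfolding continuous_on_open_vimage[OF open_UNIV] Int_UNIV_right
  proof (intro allI impI)
    fix W :: "complex set" assume W: "open W"
    have "open ((\<lambda>f :: 'a \<Rightarrow> complex. f x) -` W)" using W by (intro open_vimage) auto
    moreover have "Functional -` ((\<lambda>f. app f x) -` W) = (\<lambda>f :: 'a \<Rightarrow> complex. f x) -` W" by auto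
    ultimately show "open ((\<lambda>f. app f x) -` W)" by (simp add: open_functional_def)
  qed
qed

lemma continuous_on_Functional: "continuous_on S Functional"
  by (rule continuous_on_subset[OF _ subset_UNIV])
    (auto simp: continuous_on_open_vimage open_functional_def)

text \<open>The functions are the real parts of self-adjoint elements of \<open>C\<close> plus
  constants, on the compact space of all characters of \<open>B\<close>, zero included. Norms in
  \<open>B\<close> are attained at characters, since norming pure states are characters, so uniform
  approximation is approximation in norm.\<close>

theorem stone_weierstrass_abelian:
  fixes B :: "'a::cstar_algebra set"
  assumes B: "cstar_subalgebra B" and ab: "abelian B" and C: "cstar_subalgebra C" and CB: "C \<subseteq> B"
    and sep: "\<And>q q'. character_on B q \<Longrightarrow> character_on B q' \<Longrightarrow> (\<And>x. x \<in> C \<Longrightarrow> q x = q' x) \<Longrightarrow>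
      (\<And>x. x \<in> B \<Longrightarrow> q x = q' x)"
  shows "B = C"
proof
  show "C \<subseteq> B" by fact
  note cl = cstar_subalgebraD[OF C] and bl = cstar_subalgebraD[OF B]
  have comm: "x * y = y * x" if "x \<in> B" "y \<in> B" for x y using ab that by (auto simp: abelian_def)
  define X where "X = {q \<in> quasi_states B. \<forall>x\<in>B. \<forall>y\<in>B. q (x * y) = q x * q y}"
  have X: "character_on B q" "quasi_state_on B q" "\<And>x. x \<notin> B \<Longrightarrow> q x = 0" if "q \<in> X" for q
    using that by (auto simp: X_def quasi_states_def character_on_def quasi_state_on_def)
  have lfX: "q (x + y) = q x + q y" "q (r *\<^sub>R x) = of_real r * q x" "q (x - y) = q x - q y" "q 0 = 0"
      "q (c *\<^sub>C x) = c * q x" "q (x * y) = q x * q y" "q (star x) = cnj (q x)"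
    if "q \<in> X" "x \<in> B" "y \<in> B" for q x y r c
    using linear_functional_onD[OF quasi_stateD(1)[OF X(2)[OF that(1)]] bl(1)] that X(1)[OF that(1)]
      quasi_state_star(1)[OF B X(2)[OF that(1)] that(2)]
    by (auto simp: character_on_def)
  have real: "q x = of_real (Re (q x))" if "q \<in> X" "x \<in> B" "star x = x" for q x
    using lfX(7)[OF that(1,2,2)] that(3) by (simp add: complex_eq_iff)
  have "X = quasi_states B \<inter> (\<Inter>x\<in>B. \<Inter>y\<in>B. {q. q (x * y) = q x * q y})" by (auto simp: X_def)
  then have "compact X"
    by (simp only:) (intro compact_Int_closed compact_quasi_states(1)[OF B] closed_INT ballI closed_Collect_eq continuous_intros)
  then have S: "compact (Functional ` X)" by (intro compact_continuous_image continuous_on_Functional)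
  define R where "R = {f. continuous_on (Functional ` X) f \<and>
    (\<exists>c r. c \<in> C \<and> star c = c \<and> (\<forall>q\<in>X. f (Functional q) = Re (q c) + r))}"
  have contR: "continuous_on (Functional ` X) f" if "f \<in> R" for f using that by (simp add: R_def)
  have RI: "f \<in> R" if "continuous_on (Functional ` X) f" "c \<in> C" "star c = c"
      "\<And>q. q \<in> X \<Longrightarrow> f (Functional q) = Re (q c) + r" for f c r
    using that unfolding R_def by blast
  interpret R: function_ring_on R "Functional ` X"
  proof
    show "compact (Functional ` X)" by fact
    show "continuous_on (Functional ` X) f" if "f \<in> R" for f
      by (rule contR[OF that])
    show "(\<lambda>q. f q + g q) \<in> R" if fg: "f \<in> R" "g \<in> R" for f g
    proof -
      obtain c r c' r' where f: "c \<in> C" "star c = c" "\<And>q. q \<in> X \<Longrightarrow> f (Functional q) = Re (q c) + r"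
        and g: "c' \<in> C" "star c' = c'" "\<And>q. q \<in> X \<Longrightarrow> g (Functional q) = Re (q c') + r'"
        using fg unfolding R_def by blast
      have "c \<in> B" "c' \<in> B" using f g CB by auto
      then have "f (Functional q) + g (Functional q) = Re (q (c + c')) + (r + r')" if "q \<in> X" for q
        using that by (simp add: lfX f g)
      then show ?thesis using f(1,2) g(1,2) cl
        by (intro RI[OF continuous_on_add[OF contR[OF fg(1)] contR[OF fg(2)]], of "c + c'" "r + r'"]) (auto simp: star_simps)
    qed
    show "(\<lambda>q. f q * g q) \<in> R" if fg: "f \<in> R" "g \<in> R" for f g
    proof -
      obtain c r c' r' where f: "c \<in> C" "star c = c" "\<And>q. q \<in> X \<Longrightarrow> f (Functional q) = Re (q c) + r"
        and g: "c' \<in> C" "star c' = c'" "\<And>q. q \<in> X \<Longrightarrow> g (Functional q) = Re (q c') + r'"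
        using fg unfolding R_def by blast
      have cB: "c \<in> B" "c' \<in> B" using f g CB by auto
      have "f (Functional q) * g (Functional q) = Re (q (c * c' + r' *\<^sub>R c + r *\<^sub>R c')) + r * r'" if q: "q \<in> X" for q
      proof -
        have "q c = of_real (Re (q c))" "q c' = of_real (Re (q c'))"
          using real[OF q cB(1) f(2)] real[OF q cB(2) g(2)] .
        then have "Im (q c) = 0" "Im (q c') = 0" by (metis Im_complex_of_real)+
        then show ?thesis using q cB bl by (simp add: lfX f g algebra_simps)
      qed
      moreover have "star (c * c' + r' *\<^sub>R c + r *\<^sub>R c') = c * c' + r' *\<^sub>R c + r *\<^sub>R c'"
        using comm[OF cB] by (simp add: star_simps f g)
      ultimately show ?thesis using f(1,2) g(1,2) cl
        by (intro RI[OF continuous_on_mult[OF contR[OF fg(1)] contR[OF fg(2)]], of "c * c' + r' *\<^sub>R c + r *\<^sub>R c'" "r * r'"]) auto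
    qed
    show "(\<lambda>q. r) \<in> R" for r
      using cl(5) by (intro RI[OF continuous_on_const, of 0 _ r]) (auto dest: lfX(4)[OF _ bl(5) bl(5)])
    show "\<exists>f\<in>R. f x \<noteq> f y" if xy: "x \<in> Functional ` X" "y \<in> Functional ` X" "x \<noteq> y" for x y
    proof -
      obtain q q' where q: "q \<in> X" "q' \<in> X" "x = Functional q" "y = Functional q'" using xy by auto
      have "\<exists>c\<in>C. q c \<noteq> q' c"
      proof (rule ccontr)
        assume "\<not> ?thesis"
        then have "q z = q' z" if "z \<in> B" for z
          using sep[OF X(1)[OF q(1)] X(1)[OF q(2)] _ that] by blast
        then have "q = q'" using X(3)[OF q(1)] X(3)[OF q(2)] by (intro ext) metis
        then show False using xy q by simp
      qed
      then obtain a where a: "a \<in> C" "q a \<noteq> q' a" by blast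
      define p r where "p = (1/2) *\<^sub>R (a + star a)" and "r = (1/2) *\<^sub>R ((- \<i>) *\<^sub>C (a - star a))"
      have e: "a = p + \<i> *\<^sub>C r" and s: "star p = p" "star r = r"
        unfolding p_def r_def by (fact selfadjoint_decomposition)+
      have pr: "p \<in> C" "r \<in> C" using a by (auto simp: p_def r_def cl)
      then have prB: "p \<in> B" "r \<in> B" using CB by auto
      have "q p \<noteq> q' p \<or> q r \<noteq> q' r"
        using a(2) prB q bl by (auto simp: e lfX)
      then obtain c where c: "c \<in> C" "star c = c" "q c \<noteq> q' c" using pr s by blast
      then have cB: "c \<in> B" using CB by auto
      have "Re (q c) \<noteq> Re (q' c)"
        using real[OF q(1) cB c(2)] real[OF q(2) cB c(2)] c(3) by metis
      moreover have "(\<lambda>q. Re (app q c)) \<in> R"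
        using c by (intro RI[OF continuous_on_Re[OF continuous_on_app], of c _ 0]) auto
      ultimately show ?thesis using q by (intro bexI) auto
    qed
  qed
  have sa: "T \<in> C" if T: "T \<in> B" "star T = T" for T
  proof -
    have "\<exists>c\<in>C. dist c T < e" if e: "e > 0" for e
    proof -
      have "continuous_on (Functional ` X) (\<lambda>q. Re (app q T))"
        by (intro continuous_intros continuous_on_app)
      from R.Stone_Weierstrass_basic[OF this, of "e / 2"] e
      obtain g where "g \<in> R" and g: "\<And>q. q \<in> X \<Longrightarrow> \<bar>Re (q T) - g (Functional q)\<bar> < e / 2" by auto
      then obtain c r where c: "c \<in> C" "star c = c" "\<And>q. q \<in> X \<Longrightarrow> g (Functional q) = Re (q c) + r"
        unfolding R_def by blast
      have cB: "c \<in> B" using c CB by auto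
      have "(\<lambda>x. 0) \<in> X"
        by (simp add: X_def quasi_states_def quasi_state_on_def linear_functional_on_def positive_on_def)
      from g[OF this] c(3)[OF this] have r: "\<bar>r\<bar> < e / 2" by simp
      have "norm (T - c) < e"
      proof (cases "T - c = 0")
        case False
        have TcB: "T - c \<in> B" using T cB bl by simp
        obtain f where f: "pure_state_on B f" "f (star (T - c) * (T - c)) = of_real ((norm (T - c))\<^sup>2)"
          using norming_pure_state[OF B TcB False] .
        define q where "q = (\<lambda>x. if x \<in> B then f x else 0)"
        have "q \<in> quasi_states B" unfolding q_def by (rule truncate_quasi_state[OF B pure_stateD(2)[OF B f(1)]])
        moreover have "\<forall>x\<in>B. \<forall>y\<in>B. q (x * y) = q x * q y"
          using pure_state_character[OF B ab f(1)] bl by (auto simp: q_def character_on_def)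
        ultimately have q: "q \<in> X" by (simp add: X_def)
        have "of_real ((norm (T - c))\<^sup>2) = q (star (T - c) * (T - c))"
          using f(2) TcB bl by (simp add: q_def)
        also have "\<dots> = of_real ((cmod (q (T - c)))\<^sup>2)"
          using TcB bl q by (simp add: lfX cnj_mult_self)
        finally have "(norm (T - c))\<^sup>2 = (cmod (q (T - c)))\<^sup>2" by (simp only: of_real_eq_iff)
        then have "norm (T - c) = cmod (q (T - c))" by simp
        also have "q (T - c) = of_real (Re (q (T - c)))"
          by (rule real[OF q TcB]) (simp add: star_simps T c)
        also have "cmod (of_real (Re (q (T - c)))) = \<bar>Re (q (T - c))\<bar>" by (rule norm_of_real)
        also have "Re (q (T - c)) = Re (q T) - Re (q c)" using lfX(3)[OF q T(1) cB] by simp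
        finally have "norm (T - c) = \<bar>Re (q T) - Re (q c)\<bar>" .
        then show ?thesis using g[OF q] c(3)[OF q] r by linarith
      qed (use e in simp)
      then show ?thesis using c by (intro bexI[of _ c]) (auto simp: dist_norm norm_minus_commute)
    qed
    then have "T \<in> closure C" by (simp add: closure_approachable)
    then show ?thesis using cl(2) by simp
  qed
  show "B \<subseteq> C"
  proof
    fix a assume a: "a \<in> B"
    define p r where "p = (1/2) *\<^sub>R (a + star a)" and "r = (1/2) *\<^sub>R ((- \<i>) *\<^sub>C (a - star a))"
    have e: "a = p + \<i> *\<^sub>C r" and s: "star p = p" "star r = r"
      unfolding p_def r_def by (fact selfadjoint_decomposition)+
    have "p \<in> B" "r \<in> B" using a by (auto simp: p_def r_def bl)
    then show "a \<in> C" unfolding e using s by (intro cl sa)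
  qed
qed

section \<open>The tensor product\<close>

definition tensor_lift :: "('a::complex_vector \<Rightarrow> 'b::complex_vector \<Rightarrow> 'v::complex_vector) \<Rightarrow> 'a \<odot> 'b \<Rightarrow> 'v"
  where "tensor_lift \<Phi> = (THE F. clinear F \<and> (\<forall>a b. F (a \<otimes> b) = \<Phi> a b))"

lemma tensor_lift:
  assumes "cbilinear \<Phi>"
  shows "clinear (tensor_lift \<Phi>)" "tensor_lift \<Phi> (a \<otimes> b) = \<Phi> a b"
  using theI'[OF tensor_universal[OF assms]] by (auto simp: tensor_lift_def)

lemma clinear_simps:
  assumes "clinear (F :: 'a::complex_vector \<Rightarrow> 'b::complex_vector)"
  shows "F (x + y) = F x + F y" "F (c *\<^sub>C x) = c *\<^sub>C F x" "F 0 = 0" "F (x - y) = F x - F y" "F (- x) = - F x"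
    "F (r *\<^sub>R x) = r *\<^sub>R F x"
proof -
  interpret Vector_Spaces.linear scaleC scaleC F by fact
  show "F (x + y) = F x + F y" "F (c *\<^sub>C x) = c *\<^sub>C F x" "F 0 = 0" "F (x - y) = F x - F y" "F (- x) = - F x"
    by (rule add scale zero diff neg)+
  show "F (r *\<^sub>R x) = r *\<^sub>R F x" by (simp add: scale flip: scaleC_real)
qed

lemma tensor_bilinear:
  fixes a a' :: "'a::complex_vector" and b b' :: "'b::complex_vector"
  shows "(a + a') \<otimes> b = a \<otimes> b + a' \<otimes> b" "(c *\<^sub>C a) \<otimes> b = c *\<^sub>C (a \<otimes> b)"
    "a \<otimes> (b + b') = a \<otimes> b + a \<otimes> b'" "a \<otimes> (c *\<^sub>C b) = c *\<^sub>C (a \<otimes> b)"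
  using cbilinear_tensor_elem[where 'a = 'a and 'b = 'b] by (auto simp: cbilinear_iff)

lemma tensor_elem_nonzero:
  fixes a :: "'a::complex_vector" and b :: "'b::complex_vector"
  assumes "a \<noteq> 0" "b \<noteq> 0"
  shows "a \<otimes> b \<noteq> 0"
proof
  assume ab: "a \<otimes> b = 0"
  obtain \<phi> :: "'a \<Rightarrow> complex" where \<phi>: "clinear \<phi>" "\<phi> a \<noteq> 0" using clinear_separating[OF assms(1)] by blast
  obtain \<psi> :: "'b \<Rightarrow> complex" where \<psi>: "clinear \<psi>" "\<psi> b \<noteq> 0" using clinear_separating[OF assms(2)] by blast
  have bil: "cbilinear (\<lambda>u v. \<phi> u * \<psi> v)"
    by (simp add: cbilinear_iff clinearD[OF \<phi>(1)] clinearD[OF \<psi>(1)] scaleC_complex_def algebra_simps)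
  from clinear_simps(3)[OF tensor_lift(1)[OF bil]] tensor_lift(2)[OF bil, of a b] ab \<phi>(2) \<psi>(2)
  show False by simp
qed

text \<open>Left multiplication by \<open>a \<otimes> 1\<close>, which need not be an element of the
  tensor product.\<close>

definition lmul :: "'a::complex_star_algebra \<Rightarrow> 'a \<odot> 'b::complex_star_algebra \<Rightarrow> 'a \<odot> 'b"
  where "lmul a = tensor_lift (\<lambda>u v. (a * u) \<otimes> v)"

text \<open>Acts on the right factor, but still by multiplication from the left: it stands for
  \<open>1 \<otimes> b\<close>.\<close>

definition rmul :: "'b::complex_star_algebra \<Rightarrow> 'a::complex_star_algebra \<odot> 'b \<Rightarrow> 'a \<odot> 'b"
  where "rmul b = tensor_lift (\<lambda>u v. u \<otimes> (b * v))"

lemma lmul: "clinear (lmul a)" "lmul a (u \<otimes> v) = (a * u) \<otimes> v"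
proof -
  have "cbilinear (\<lambda>u v. (a * u) \<otimes> v)"
    by (simp add: cbilinear_iff tensor_bilinear distrib_left mult_scaleC_right)
  then show "clinear (lmul a)" "lmul a (u \<otimes> v) = (a * u) \<otimes> v"
    unfolding lmul_def by (rule tensor_lift)+
qed

lemma rmul: "clinear (rmul b)" "rmul b (u \<otimes> v) = u \<otimes> (b * v)"
proof -
  have "cbilinear (\<lambda>u v. u \<otimes> (b * v))"
    by (simp add: cbilinear_iff tensor_bilinear distrib_left mult_scaleC_right)
  then show "clinear (rmul b)" "rmul b (u \<otimes> v) = u \<otimes> (b * v)"
    unfolding rmul_def by (rule tensor_lift)+
qed

lemma lmul_action:
  "lmul (a + a') x = lmul a x + lmul a' x" "lmul (c *\<^sub>C a) x = c *\<^sub>C lmul a x"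
  "lmul (a * a') x = lmul a (lmul a' x)" "star (lmul a x) * y = star x * lmul (star a) y"
proof -
  show "lmul (a + a') x = lmul a x + lmul a' x" "lmul (c *\<^sub>C a) x = c *\<^sub>C lmul a x"
    "lmul (a * a') x = lmul a (lmul a' x)"
    by (induction x rule: tensor_induct)
      (simp_all add: lmul(2) clinear_simps[OF lmul(1)] tensor_bilinear distrib_right mult_scaleC_left scaleC_add_right mult.assoc)
  have "star (lmul a (u \<otimes> v)) * y = star (u \<otimes> v) * lmul (star a) y" for u v
    by (induction y rule: tensor_induct)
      (simp_all add: lmul(2) clinear_simps[OF lmul(1)] distrib_left star_tensor_elem tensor_elem_mult star_mult mult.assoc)
  then show "star (lmul a x) * y = star x * lmul (star a) y"
    by (induction x rule: tensor_induct) (simp_all add: clinear_simps[OF lmul(1)] star_add distrib_right)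
qed

lemma rmul_action:
  "rmul (a + a') x = rmul a x + rmul a' x" "rmul (c *\<^sub>C a) x = c *\<^sub>C rmul a x"
  "rmul (a * a') x = rmul a (rmul a' x)" "star (rmul a x) * y = star x * rmul (star a) y"
proof -
  show "rmul (a + a') x = rmul a x + rmul a' x" "rmul (c *\<^sub>C a) x = c *\<^sub>C rmul a x"
    "rmul (a * a') x = rmul a (rmul a' x)"
    by (induction x rule: tensor_induct)
      (simp_all add: rmul(2) clinear_simps[OF rmul(1)] tensor_bilinear distrib_right mult_scaleC_left scaleC_add_right mult.assoc)
  have "star (rmul a (u \<otimes> v)) * y = star (u \<otimes> v) * rmul (star a) y" for u v
    by (induction y rule: tensor_induct)
      (simp_all add: rmul(2) clinear_simps[OF rmul(1)] distrib_left star_tensor_elem tensor_elem_mult star_mult mult.assoc)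
  then show "star (rmul a x) * y = star x * rmul (star a) y"
    by (induction x rule: tensor_induct) (simp_all add: clinear_simps[OF rmul(1)] star_add distrib_right)
qed

text \<open>For \<open>norm b = 1\<close> choose \<open>s\<close> such that \<open>1 - s\<close> is
  a root of \<open>1 - star b * b\<close>. Then \<open>star x * x\<close> is the sum of the squares
  of \<open>L b x\<close> and \<open>x - L s x\<close>, an identity inside the algebraic object, so
  every C*-norm respects it.\<close>

lemma action_bound:
  fixes L :: "'c::cstar_algebra \<Rightarrow> 't::complex_star_algebra \<Rightarrow> 't" and \<iota> :: "'t \<Rightarrow> 'd::cstar_algebra"
  assumes add: "\<And>a b x. L (a + b) x = L a x + L b x" and scale: "\<And>c a x. L (c *\<^sub>C a) x = c *\<^sub>C L a x"
    and mult: "\<And>a b x. L (a * b) x = L a (L b x)" and adj: "\<And>a x y. star (L a x) * y = star x * L (star a) y"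
    and \<iota>: "clinear \<iota>" "\<And>x y. \<iota> (x * y) = \<iota> x * \<iota> y" "\<And>x. \<iota> (star x) = star (\<iota> x)"
  shows "norm (\<iota> (L a x)) \<le> norm a * norm (\<iota> x)"
proof (cases "a = 0")
  case True
  have "L 0 x = 0" using scale[of 0 0 x] by simp
  then show ?thesis using True by (simp add: clinear_simps[OF \<iota>(1)])
next
  case False
  define b where "b = inverse (complex_of_real (norm a)) *\<^sub>C a"
  have ab: "a = complex_of_real (norm a) *\<^sub>C b" using False by (simp add: b_def scaleC_scaleC)
  have nb: "norm b = 1" using False by (simp add: b_def norm_scaleC norm_inverse)
  define u where "u = star b * b"
  have u: "star u = u" "norm u \<le> 1" by (simp_all add: u_def star_simps cstar_identity nb)
  obtain s where s: "star s = s" "s + s - s * s = u"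
    using sqrt_one_minus[OF cstar_subalgebra_UNIV UNIV_I u] by blast
  define y where "y = x - L s x"
  have "s + s = u + s * s" using s(2) by (simp add: algebra_simps)
  then have ss: "L s x + L s x = L u x + L s (L s x)" by (metis add mult)
  have "star (L b x) * L b x = star x * L u x" by (simp add: adj u_def mult)
  moreover have "star y * y = star x * (x - (L s x + L s x) + L s (L s x))"
  proof -
    have "star (L s x) * x = star x * L s x" "star (L s x) * L s x = star x * L s (L s x)"
      by (simp_all add: adj s(1))
    then show ?thesis by (simp add: y_def star_diff left_diff_distrib right_diff_distrib distrib_left)
  qed
  then have "star y * y = star x * x - star x * L u x"
    unfolding ss by (simp add: distrib_left right_diff_distrib)
  ultimately have "star x * x = star (L b x) * L b x + star y * y" by simp
  then have "\<iota> (star x * x) = \<iota> (star (L b x) * L b x) + \<iota> (star y * y)"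
    by (simp only: clinear_simps(1)[OF \<iota>(1)])
  then have "norm (\<iota> (L b x)) \<le> norm (\<iota> x)"
    by (intro norm_le_sum_squares[where y = "\<iota> y"]) (simp add: \<iota>)
  moreover have "\<iota> (L a x) = complex_of_real (norm a) *\<^sub>C \<iota> (L b x)"
    by (subst ab) (simp only: scale clinear_simps(2)[OF \<iota>(1)])
  ultimately show ?thesis by (simp add: norm_scaleC mult_left_mono)
qed

text \<open>\<open>y\<close> is twice the positive part of \<open>g = h - s\<close> with
  \<open>h = star a * a\<close>, so \<open>h\<close> acts on it with size at least \<open>s\<close>.
  The excess \<open>q\<close> is positive because \<open>k * (g * k)\<close> is the square of
  \<open>c * k\<close>, and \<open>w\<close> is a root of \<open>q\<close>.\<close>

lemma spectral_bump:
  fixes a :: "'a::cstar_algebra"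
  assumes a: "norm a = 1" and s: "0 < s" "s < 1"
  obtains y w where "y \<noteq> 0" "star (star a * a * y) * (star a * a * y) = (s * s) *\<^sub>R (star y * y) + star w * w"
proof -
  define h where "h = emb (star a * a)"
  have h: "cpos h" using cpos_star_mult[of "emb a"] by (simp add: h_def emb_hom)
  have nh: "norm h = 1" by (simp add: h_def cstar_identity a)
  define g where "g = h - s *\<^sub>R 1"
  have sg: "star g = g" by (simp add: g_def star_simps cpos_sa[OF h])
  obtain A where A: "cpos A" "A * A = g * g" "\<And>y. y * (g * g) = (g * g) * y \<Longrightarrow> y * A = A * y"
    using cpos_sqrt[OF cpos_square[OF sg]] by metis
  have gA: "g * A = A * g" by (rule A(3)) (simp add: mult.assoc)
  obtain c where c: "cpos c" "c * c = A" "\<And>y. y * A = A * y \<Longrightarrow> y * c = c * y"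
    using cpos_sqrt[OF A(1)] by metis
  define k where "k = A + g"
  have sk: "star k = k" by (simp add: k_def star_simps sg cpos_sa[OF A(1)])
  have gk: "g * k = A * k" by (simp add: k_def algebra_simps gA A(2))
  have kA: "k * A = A * k" by (simp add: k_def algebra_simps gA)
  have kc: "k * c = c * k" by (rule c(3)[OF kA])
  have kg: "k * g = g * k" by (simp add: k_def algebra_simps gA)
  \<comment> \<open>The scalar parts of \<open>g\<close> and of its absolute value \<open>A\<close>
    are \<open>- s\<close> and \<open>s\<close>, so \<open>k\<close> comes from the algebra
    itself.\<close>
  have scl_k: "scl k = 0"
  proof -
    obtain B where B: "star B = B" "A = B * B" using A(1) by (auto simp: cpos_def)
    have "scl B \<in> \<real>" using arg_cong[OF B(1), of scl] by (simp add: Reals_cnj_iff)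
    then obtain r where r: "scl B = of_real r" by (auto simp: Reals_def)
    have "scl A = of_real (r * r)" by (simp add: B(2) r)
    moreover have "scl g = - of_real s" by (simp add: g_def h_def) (simp add: scaleR_conv_of_real)
    moreover have "scl A * scl A = scl g * scl g" using arg_cong[OF A(2), of scl] by simp
    ultimately have "complex_of_real ((r * r) * (r * r)) = of_real (s * s)" by simp
    then have "(r * r)\<^sup>2 = s\<^sup>2" by (simp only: of_real_eq_iff power2_eq_square)
    then have "r * r = s" using s by (simp add: power2_eq_iff_nonneg)
    then show ?thesis using \<open>scl A = _\<close> \<open>scl g = _\<close> by (simp add: k_def)
  qed
  \<comment> \<open>Otherwise \<open>s - h\<close> would be positive and
    \<open>norm h \<le> s < 1\<close>.\<close>
  have k0: "k \<noteq> 0"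
  proof
    assume "k = 0"
    then have "s *\<^sub>R 1 - h = A" by (simp add: k_def g_def algebra_simps)
    then have "norm h \<le> norm (s *\<^sub>R (1 :: 'a uz))" using A(1) by (intro norm_le_cpos[OF h]) simp
    then show False using nh s by simp
  qed
  have hg: "h = g + s *\<^sub>R 1" by (simp add: g_def)
  define q where "q = (g * k) * (g * k) + (2 * s) *\<^sub>R ((c * k) * (c * k))"
  have "cpos q"
    unfolding q_def
    by (intro cpos_add cpos_scale cpos_square) (use s in \<open>auto simp: star_simps sg sk cpos_sa[OF c(1)] kc kg\<close>)
  then obtain W where W: "star W = W" "q = W * W" by (auto simp: cpos_def)
  have "scl q = 0" by (simp add: q_def scl_k)
  then have "scl W = 0" using W(2) by simp
  define y w where "y = vec k" and "w = vec W"
  have y: "emb y = k" and w: "emb w = W" using scl_k \<open>scl W = 0\<close> by (simp_all add: y_def w_def emb_vec)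
  have ckck: "(c * k) * (c * k) = k * (g * k)" by (metis c(2) kc gk mult.assoc)
  have "star (h * k) * (h * k) = k * h * (h * k)" by (simp add: star_simps sk cpos_sa[OF h] mult.assoc)
  also have "\<dots> = (k * g) * (g * k) + s *\<^sub>R (k * g * k) + s *\<^sub>R (k * (g * k)) + (s * s) *\<^sub>R (k * k)"
    by (simp add: hg distrib_left distrib_right mult.assoc add.assoc scaleR_add_right)
  also have "\<dots> = q + (s * s) *\<^sub>R (k * k)"
  proof -
    have "g * (k * (g * k)) = k * (g * (g * k))" by (metis kg mult.assoc)
    moreover have "(2 * s) *\<^sub>R (k * (g * k)) = s *\<^sub>R (k * (g * k)) + s *\<^sub>R (k * (g * k))"
      by (simp flip: scaleR_add_left)
    ultimately show ?thesis unfolding q_def ckck by (simp add: mult.assoc)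
  qed
  finally have "star (h * k) * (h * k) = (s * s) *\<^sub>R (star k * k) + star W * W"
    by (simp add: W sk)
  then have "emb (star (star a * a * y) * (star a * a * y)) = emb ((s * s) *\<^sub>R (star y * y) + star w * w)"
    by (simp add: emb_hom y w) (simp add: h_def emb_hom)
  then have "star (star a * a * y) * (star a * a * y) = (s * s) *\<^sub>R (star y * y) + star w * w"
    by (simp only: emb_inject)
  moreover have "y \<noteq> 0" using k0 y by (metis emb_hom(8))
  ultimately show ?thesis using that by blast
qed

lemma clinear_vanish_closure:
  fixes d :: "'a::cstar_algebra \<Rightarrow> complex"
  assumes d: "clinear d" and le: "\<And>x. cmod (d x) \<le> K * norm x" and S: "\<And>s. s \<in> S \<Longrightarrow> d s = 0"
    and x: "x \<in> closure (cspan S)"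
  shows "d x = 0"
proof -
  have "bounded_linear d"
    by (rule bounded_linear_intro[of _ K]) (auto simp: clinearD[OF d] scaleR_conv_of_real le mult.commute)
  then have "closed {x. d x = 0}"
    by (intro closed_Collect_eq continuous_on_const linear_continuous_on)
  moreover have "cspan S \<subseteq> {x. d x = 0}"
    by (rule complex_vector.span_minimal) (auto simp: S complex_vector.subspace_def clinearD[OF d])
  ultimately have "closure (cspan S) \<subseteq> {x. d x = 0}" by (intro closure_minimal)
  then show ?thesis using x by blast
qed

lemma cstar_subalgebra_closure_span:
  fixes S :: "'a::cstar_algebra set"
  assumes mult: "\<And>x y. x \<in> S \<Longrightarrow> y \<in> S \<Longrightarrow> x * y \<in> S" and st: "\<And>x. x \<in> S \<Longrightarrow> star x \<in> S"
  shows "cstar_subalgebra (closure (cspan S))"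
proof -
  let ?V = "cspan S"
  have V: "csubspace ?V" by (rule complex_vector.subspace_span)
  note v = csubspaceD[OF V]
  have 1: "x * y \<in> ?V" if "x \<in> S" "y \<in> ?V" for x y
    using that(2)
    by (induction rule: complex_vector.span_induct_alt)
      (use that(1) in \<open>auto simp: distrib_left mult_scaleC_right v(1) intro!: v(2)[OF v(3)[OF complex_vector.span_base[OF mult]]]\<close>)
  have 2: "x * y \<in> ?V" if "x \<in> ?V" "y \<in> ?V" for x y
    using that(1)
    by (induction rule: complex_vector.span_induct_alt)
      (use that(2) in \<open>auto simp: distrib_right mult_scaleC_left v(1) intro!: v(2)[OF v(3)[OF 1]]\<close>)
  have 3: "star x \<in> ?V" if "x \<in> ?V" for x
    using that
    by (induction rule: complex_vector.span_induct_alt)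
      (auto simp: star_simps v(1) intro!: v(2)[OF v(3)[OF complex_vector.span_base[OF st]]])
  have cl: "x + y \<in> closure ?V" "x * y \<in> closure ?V" if xy: "x \<in> closure ?V" "y \<in> closure ?V" for x y
  proof -
    obtain f g where f: "\<And>n. f n \<in> ?V" "f \<longlonglongrightarrow> x" and g: "\<And>n. g n \<in> ?V" "g \<longlonglongrightarrow> y"
      using xy unfolding closure_sequential by blast
    show "x + y \<in> closure ?V" unfolding closure_sequential
      using f g v(2) by (intro exI[of _ "\<lambda>n. f n + g n"]) (auto intro: tendsto_add)
    show "x * y \<in> closure ?V" unfolding closure_sequential
      using f g 2 by (intro exI[of _ "\<lambda>n. f n * g n"]) (auto intro: tendsto_mult)
  qed
  have cl2: "c *\<^sub>C x \<in> closure ?V" "star x \<in> closure ?V" if x: "x \<in> closure ?V" for x c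
  proof -
    obtain f where f: "\<And>n. f n \<in> ?V" "f \<longlonglongrightarrow> x" using x unfolding closure_sequential by blast
    show "c *\<^sub>C x \<in> closure ?V" unfolding closure_sequential
      using f v(3) by (intro exI[of _ "\<lambda>n. c *\<^sub>C f n"]) (auto intro: tendsto_scaleC)
    show "star x \<in> closure ?V" unfolding closure_sequential
      using f 3 by (intro exI[of _ "\<lambda>n. star (f n)"]) (auto intro: tendsto_star)
  qed
  have "0 \<in> closure ?V" using v(1) closure_subset by blast
  then show ?thesis using cl cl2 by (auto simp: cstar_subalgebra_def complex_vector.subspace_def)
qed

section \<open>C*-norms are cross norms\<close>

locale cstar_tensor =
  fixes \<beta> :: "'a::cstar_algebra \<odot> 'b::cstar_algebra \<Rightarrow> real" and \<iota> :: "'a \<odot> 'b \<Rightarrow> 'd::cstar_algebra"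
  assumes norm_\<beta>: "cstar_norm \<beta>" and compl: "is_completion \<beta> \<iota>"
begin

definition J :: "'a \<Rightarrow> 'b \<Rightarrow> 'd"
  where "J a b = \<iota> (a \<otimes> b)"

lemma \<iota>: "clinear \<iota>" "\<iota> (x * y) = \<iota> x * \<iota> y" "\<iota> (star x) = star (\<iota> x)" "norm (\<iota> x) = \<beta> x"
    "closure (range \<iota>) = UNIV"
  using compl by (auto simp: is_completion_def)

lemmas \<iota>_lin = clinear_simps[OF \<iota>(1)]

lemma \<iota>_eq_0: "\<iota> x = 0 \<longleftrightarrow> x = 0"
  using norm_\<beta> \<iota>(4)[of x] \<iota>_lin(3) by (metis cstar_norm_def norm_eq_zero)

lemma J_bilinear: "J (a + a') b = J a b + J a' b" "J (c *\<^sub>C a) b = c *\<^sub>C J a b"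
    "J a (b + b') = J a b + J a b'" "J a (c *\<^sub>C b) = c *\<^sub>C J a b"
  by (simp_all add: J_def tensor_bilinear \<iota>_lin)

lemma J_mult: "J a b * J a' b' = J (a * a') (b * b')"
  by (simp add: J_def tensor_elem_mult flip: \<iota>(2))

lemma J_star: "star (J a b) = J (star a) (star b)"
  by (simp add: J_def star_tensor_elem flip: \<iota>(3))

lemma clinear_J: "clinear (\<lambda>a. J a b)" "clinear (\<lambda>b. J a b)"
  by (simp_all add: clinear_iff J_bilinear)

lemmas J_lin = clinear_simps[OF clinear_J(1)] clinear_simps[OF clinear_J(2)]

lemma norm_lmul: "norm (\<iota> (lmul a x)) \<le> norm a * norm (\<iota> x)"
  by (rule action_bound[OF lmul_action \<iota>(1,2,3)])

lemma norm_rmul: "norm (\<iota> (rmul b x)) \<le> norm b * norm (\<iota> x)"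
  by (rule action_bound[OF rmul_action \<iota>(1,2,3)])

text \<open>For self-adjoint factors, \<open>star (J h k) * J h k\<close> comes from
  \<open>h \<otimes> k\<close> by the two one-sided actions, so one factor
  \<open>norm (J h k)\<close> cancels. The C*-identity reduces the general case to this one.\<close>

lemma norm_J_le: "norm (J a b) \<le> norm a * norm b"
proof -
  have sa: "norm (J h k) \<le> norm h * norm k" if "star h = h" "star k = k" for h k
  proof (cases "J h k = 0")
    case False
    have "star (J h k) * J h k = \<iota> (lmul h (rmul k (h \<otimes> k)))"
      by (simp add: J_star J_mult that) (simp add: J_def lmul(2) rmul(2))
    then have "(norm (J h k))\<^sup>2 = norm (\<iota> (lmul h (rmul k (h \<otimes> k))))" by (simp flip: cstar_identity)
    also have "\<dots> \<le> norm h * norm (\<iota> (rmul k (h \<otimes> k)))" by (rule norm_lmul)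
    also have "\<dots> \<le> norm h * (norm k * norm (J h k))"
      unfolding J_def by (intro mult_left_mono norm_rmul) simp
    finally have "norm (J h k) * norm (J h k) \<le> (norm h * norm k) * norm (J h k)"
      by (simp add: power2_eq_square mult.assoc)
    then show ?thesis using False by (simp add: mult_le_cancel_right)
  qed simp
  have "(norm (J a b))\<^sup>2 = norm (J (star a * a) (star b * b))"
    by (simp add: J_star J_mult flip: cstar_identity)
  also have "\<dots> \<le> (norm a)\<^sup>2 * (norm b)\<^sup>2"
    using sa[of "star a * a" "star b * b"] by (simp add: star_simps cstar_identity)
  finally show ?thesis by (metis power_mult_distrib mult_nonneg_nonneg norm_ge_zero power2_le_imp_le)
qed

lemma norm_J_mono:
  assumes eq: "star p * p = (s * s) *\<^sub>R (star y * y) + star w * w" and s: "0 \<le> s"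
  shows "s * norm (J y b) \<le> norm (J p b)"
proof -
  have "star (J p b) * J p b = star (s *\<^sub>R J y b) * (s *\<^sub>R J y b) + star (J w b) * J w b"
    by (simp add: J_star J_mult eq star_scaleR J_lin)
  from norm_le_sum_squares[OF this] show ?thesis using s by simp
qed

lemma norm_J_mono':
  assumes eq: "star p * p = (s * s) *\<^sub>R (star y * y) + star w * w" and s: "0 \<le> s"
  shows "s * norm (J a y) \<le> norm (J a p)"
proof -
  have "star (J a p) * J a p = star (s *\<^sub>R J a y) * (s *\<^sub>R J a y) + star (J a w) * J a w"
    by (simp add: J_star J_mult eq star_scaleR J_lin)
  from norm_le_sum_squares[OF this] show ?thesis using s by simp
qed

text \<open>If \<open>h = a\<^sup>* a\<close> and \<open>k = b\<^sup>* b\<close> have norm 1 but \<open>\<parallel>h \<otimes> k\<parallel> < s\<^sup>2 < 1\<close>, take nonzero \<open>y\<close>, \<open>z\<close>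
  from the spectral parts where \<open>h \<ge> s\<close> and \<open>k \<ge> s\<close>: multiplication by \<open>h \<otimes> k\<close> cannot shrink the
  nonzero element \<open>y \<otimes> z\<close> that much.\<close>

lemma norm_J: "norm (J a b) = norm a * norm b"
proof (rule antisym[OF norm_J_le])
  have unit: "1 \<le> norm (J a b)" if a: "norm a = 1" and b: "norm b = 1" for a b
  proof (rule ccontr)
    assume "\<not> 1 \<le> norm (J a b)"
    define r where "r = (norm (J a b))\<^sup>2"
    have r: "0 \<le> r" "r < 1"
      using \<open>\<not> 1 \<le> norm (J a b)\<close> by (auto simp: r_def power_less_one_iff abs_square_less_1)
    \<comment> \<open>The midpoint places \<open>s * s\<close> strictly between \<open>r\<close> and
      1.\<close>
    define s where "s = sqrt ((1 + r) / 2)"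
    have s: "0 < s" "s < 1" "r < s * s" using r by (auto simp: s_def)
    obtain y w where y: "y \<noteq> 0" "star (star a * a * y) * (star a * a * y) = (s * s) *\<^sub>R (star y * y) + star w * w"
      using spectral_bump[OF a s(1,2)] .
    obtain z v where z: "z \<noteq> 0" "star (star b * b * z) * (star b * b * z) = (s * s) *\<^sub>R (star z * z) + star v * v"
      using spectral_bump[OF b s(1,2)] .
    have "s * (s * norm (J y z)) \<le> s * norm (J (star a * a * y) z)"
      using norm_J_mono[OF y(2), of z] s by (intro mult_left_mono) auto
    also have "\<dots> \<le> norm (J (star a * a * y) (star b * b * z))"
      using norm_J_mono'[OF z(2), of "star a * a * y"] s by auto
    also have "\<dots> = norm (J (star a * a) (star b * b) * J y z)" by (simp add: J_mult)
    also have "\<dots> \<le> r * norm (J y z)"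
      using norm_mult_ineq[of "J (star a * a) (star b * b)" "J y z"] cstar_identity[of "J a b"]
      by (simp add: J_star J_mult r_def)
    finally have "s * s * norm (J y z) \<le> r * norm (J y z)" by (simp add: mult.assoc)
    moreover have "norm (J y z) > 0" using tensor_elem_nonzero[OF y(1) z(1)] by (simp add: J_def \<iota>_eq_0)
    ultimately show False using s(3) by simp
  qed
  show "norm a * norm b \<le> norm (J a b)"
  proof (cases "a = 0 \<or> b = 0")
    case False
    then have ab: "a \<noteq> 0" "b \<noteq> 0" by auto
    have "1 \<le> norm (J (inverse (norm a) *\<^sub>R a) (inverse (norm b) *\<^sub>R b))"
      using ab by (intro unit) auto
    also have "\<dots> = norm (J a b) / (norm a * norm b)"
      by (simp add: J_lin divide_inverse mult.commute)
    finally show ?thesis using ab by (simp add: field_simps)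
  qed (auto simp: J_lin)
qed

lemma \<iota>_image_alg_tensor: "\<iota> ` alg_tensor_set C1 C2 = cspan {J a b | a b. a \<in> C1 \<and> b \<in> C2}"
proof -
  interpret \<iota>: Vector_Spaces.linear scaleC scaleC \<iota> by (rule \<iota>(1))
  have "{J a b | a b. a \<in> C1 \<and> b \<in> C2} = \<iota> ` {a \<otimes> b | a b. a \<in> C1 \<and> b \<in> C2}" by (auto simp: J_def)
  then show ?thesis by (simp add: alg_tensor_set_def cspan_def \<iota>.span_image)
qed

abbreviation "T \<equiv> closed_tensor_set \<iota>"

lemma T_def: "T C1 C2 = closure (cspan {J a b | a b. a \<in> C1 \<and> b \<in> C2})"
  by (simp add: closed_tensor_set_def \<iota>_image_alg_tensor)

lemma J_in_T: "a \<in> C1 \<Longrightarrow> b \<in> C2 \<Longrightarrow> J a b \<in> T C1 C2"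
  unfolding T_def by (rule subsetD[OF closure_subset complex_vector.span_base]) auto

lemma vanish_on_T:
  assumes "clinear d" "\<And>x. cmod (d x) \<le> K * norm x" "\<And>a b. a \<in> C1 \<Longrightarrow> b \<in> C2 \<Longrightarrow> d (J a b) = 0" "x \<in> T C1 C2"
  shows "d x = 0"
  by (rule clinear_vanish_closure[OF assms(1,2) _ assms(4)[unfolded T_def]]) (use assms(3) in auto)

lemma T_UNIV: "T UNIV UNIV = UNIV"
proof -
  have "x \<in> alg_tensor_set UNIV UNIV" for x :: "'a \<odot> 'b"
    unfolding alg_tensor_set_def
    by (induction x rule: tensor_induct)
      (auto intro: complex_vector.span_zero complex_vector.span_add complex_vector.span_base)
  then have "alg_tensor_set UNIV UNIV = (UNIV :: ('a \<odot> 'b) set)" by auto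
  then show ?thesis using \<iota>(5) by (simp add: closed_tensor_set_def)
qed

lemma T_subalgebra:
  assumes "cstar_subalgebra C1" "cstar_subalgebra C2"
  shows "cstar_subalgebra (T C1 C2)"
  unfolding T_def
proof (rule cstar_subalgebra_closure_span)
  fix x assume "x \<in> {J a b | a b. a \<in> C1 \<and> b \<in> C2}"
  then obtain a b where x: "x = J a b" "a \<in> C1" "b \<in> C2" by blast
  show "star x \<in> {J a b | a b. a \<in> C1 \<and> b \<in> C2}"
    using x cstar_subalgebraD(4)[OF assms(1) x(2)] cstar_subalgebraD(4)[OF assms(2) x(3)] by (auto simp: J_star)
  fix y assume "y \<in> {J a b | a b. a \<in> C1 \<and> b \<in> C2}"
  then obtain a' b' where y: "y = J a' b'" "a' \<in> C1" "b' \<in> C2" by blast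
  show "x * y \<in> {J a b | a b. a \<in> C1 \<and> b \<in> C2}"
    using x y cstar_subalgebraD(3)[OF assms(1) x(2) y(2)] cstar_subalgebraD(3)[OF assms(2) x(3) y(3)]
    by (auto simp: J_mult)
qed

lemma T_abelian:
  assumes "abelian C1" "abelian C2"
  shows "abelian (T C1 C2)"
proof -
  define S where "S = {J a b | a b. a \<in> C1 \<and> b \<in> C2}"
  \<comment> \<open>Used twice: with \<open>U = S\<close>, and then with the closure itself as
    \<open>U\<close>.\<close>
  have sub: "closure (cspan S) \<subseteq> commutant U" if su: "\<And>s u. s \<in> S \<Longrightarrow> u \<in> U \<Longrightarrow> s * u = u * s" for U
  proof (rule closure_minimal)
    have "commutant U = (\<Inter>s\<in>U. {z. z * s = s * z})" by (auto simp: commutant_def)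
    moreover have "closed (\<Inter>s\<in>U. {z. z * s = s * z})"
      by (intro closed_INT ballI closed_Collect_eq continuous_intros)
    ultimately show "closed (commutant U)" by simp
    show "cspan S \<subseteq> commutant U"
    proof (rule complex_vector.span_minimal)
      show "S \<subseteq> commutant U" unfolding commutant_def using su by blast
    qed (auto simp: commutant_def complex_vector.subspace_def distrib_left distrib_right mult_scaleC_left mult_scaleC_right)
  qed
  have "s * u = u * s" if su: "s \<in> S" "u \<in> S" for s u
  proof -
    obtain a b a' b' where e: "s = J a b" "u = J a' b'" "a \<in> C1" "b \<in> C2" "a' \<in> C1" "b' \<in> C2"
      using su unfolding S_def by blast
    then have "a * a' = a' * a" "b * b' = b' * b" using assms unfolding abelian_def by blast+
    then show ?thesis by (simp add: e(1,2) J_mult)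
  qed
  then have 1: "closure (cspan S) \<subseteq> commutant S" by (rule sub)
  have "s * u = u * s" if "s \<in> S" "u \<in> closure (cspan S)" for s u
    using subsetD[OF 1 that(2)] that(1) unfolding commutant_def by force
  then have "closure (cspan S) \<subseteq> commutant (closure (cspan S))" by (rule sub)
  then show ?thesis unfolding T_def abelian_def commutant_def S_def[symmetric] by blast
qed

lemma functional_eqI:
  assumes f: "quasi_state_on UNIV f" and g: "quasi_state_on UNIV g"
    and eq: "\<And>a b. a \<in> C1 \<Longrightarrow> b \<in> C2 \<Longrightarrow> f (J a b) = g (J a b)" and x: "x \<in> T C1 C2"
  shows "f x = g x"
proof -
  have lin: "clinear f" "clinear g" using f g by (auto simp: quasi_state_on_def linear_functional_UNIV)
  have "f x - g x = 0"
  proof (rule vanish_on_T[OF _ _ _ x, of "\<lambda>x. f x - g x" 2])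
    show "clinear (\<lambda>x. f x - g x)"
      by (simp add: clinear_iff clinearD[OF lin(1)] clinearD[OF lin(2)] scaleC_complex_def algebra_simps)
    show "cmod (f x - g x) \<le> 2 * norm x" for x
      using norm_triangle_ineq4[of "f x" "g x"] quasi_stateD(3)[OF f UNIV_I, of x] quasi_stateD(3)[OF g UNIV_I, of x]
      by linarith
  qed (simp add: eq)
  then show ?thesis by simp
qed

end

section \<open>Characters and states of the tensor product\<close>

lemma quasi_state_clinear: "quasi_state_on UNIV f \<Longrightarrow> clinear f"
  by (simp add: quasi_state_on_def linear_functional_UNIV)

text \<open>The one form of nondegeneracy used for both factors: it follows from an approximate
  identity, from a unit in the algebra of a masa, and from the extension property of a masa.\<close>

definition no_state_vanishes_on :: "'a::cstar_algebra set \<Rightarrow> bool"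
  where "no_state_vanishes_on C \<longleftrightarrow>
    (\<forall>g. quasi_state_on UNIV g \<longrightarrow> (\<forall>x\<in>C. g x = 0) \<longrightarrow> (\<forall>x. g x = 0))"

lemma positive_functional_vanish:
  assumes vanish: "no_state_vanishes_on C"
    and g: "linear_functional_on UNIV g" "positive_on UNIV g" "\<And>x. cmod (g x) \<le> K * norm x"
    and 0: "\<And>x. x \<in> C \<Longrightarrow> g x = 0"
  shows "g x = 0"
proof -
  have K: "0 < \<bar>K\<bar> + 1" by (simp add: add_nonneg_pos)
  have "cmod (g x) \<le> (\<bar>K\<bar> + 1) * norm x" for x
    by (rule order_trans[OF g(3)]) (auto intro: mult_right_mono)
  from quasi_state_normalize[OF g(1,2) this K]
  have "of_real (inverse (\<bar>K\<bar> + 1)) * g x = 0"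
    using vanish 0 unfolding no_state_vanishes_on_def by (metis mult_zero_right)
  moreover have "complex_of_real (inverse (\<bar>K\<bar> + 1)) \<noteq> 0" using K by (simp del: of_real_inverse)
  ultimately show ?thesis by (metis mult_eq_0_iff)
qed

context cstar_tensor
begin

text \<open>Without units the factors are found by translating with an elementary tensor on which
  \<open>F\<close> does not vanish. Commutativity lets the translations recombine once everything is
  multiplied by \<open>K\<close> twice.\<close>

lemma character_factors:
  assumes C1: "cstar_subalgebra C1" "abelian C1" and C2: "cstar_subalgebra C2" "abelian C2"
    and F: "character_on (T C1 C2) F" and nz: "w \<in> T C1 C2" "F w \<noteq> 0"
  obtains f1 f2 c0 e0 where "character_on C1 f1" "character_on C2 f2" "c0 \<in> C1" "f1 c0 \<noteq> 0" "e0 \<in> C2" "f2 e0 \<noteq> 0"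
    "\<And>c e. c \<in> C1 \<Longrightarrow> e \<in> C2 \<Longrightarrow> F (J c e) = f1 c * f2 e"
proof -
  note cl1 = cstar_subalgebraD[OF C1(1)] and cl2 = cstar_subalgebraD[OF C2(1)]
  note T = T_subalgebra[OF C1(1) C2(1)]
  have m: "F (J c e * J c' e') = F (J c e) * F (J c' e')" if "c \<in> C1" "e \<in> C2" "c' \<in> C1" "e' \<in> C2" for c e c' e'
    using F that J_in_T by (auto simp: character_on_def)
  \<comment> \<open>\<open>F\<close> has meaning only on \<open>T C1 C2\<close>; the extension
    supplies a functional to which global linearity and the closure argument apply.\<close>
  obtain G where G: "quasi_state_on UNIV G" "\<And>x. x \<in> T C1 C2 \<Longrightarrow> G x = F x"
    using quasi_state_extension[OF T character_quasi_state[OF T F]] by blast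
  note Glin = clinearD[OF quasi_state_clinear[OF G(1)]]
  have "\<exists>c0\<in>C1. \<exists>e0\<in>C2. F (J c0 e0) \<noteq> 0"
  proof (rule ccontr)
    assume "\<not> ?thesis"
    then have "G (J a b) = 0" if "a \<in> C1" "b \<in> C2" for a b using that G(2) J_in_T by simp
    then have "G w = 0"
      using vanish_on_T[OF quasi_state_clinear[OF G(1)] _ _ nz(1), of 1] quasi_stateD(3)[OF G(1)] by simp
    then show False using nz G(2) by simp
  qed
  then obtain c0 e0 where ce: "c0 \<in> C1" "e0 \<in> C2" "F (J c0 e0) \<noteq> 0" by blast
  define K where "K = F (J c0 e0)"
  define f1 where "f1 c = F (J (c * c0) e0) / K" for c
  define f2 where "f2 e = F (J c0 (e * e0)) / K" for e
  have K: "K \<noteq> 0" using ce by (simp add: K_def)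
  have f1e: "f1 c * K = F (J (c * c0) e0)" and f2e: "f2 e * K = F (J c0 (e * e0))" for c e
    using K by (simp_all add: f1_def f2_def)
  have comm1: "x * y = y * x" if "x \<in> C1" "y \<in> C1" for x y using C1(2) that by (auto simp: abelian_def)
  have comm2: "x * y = y * x" if "x \<in> C2" "y \<in> C2" for x y using C2(2) that by (auto simp: abelian_def)
  have fact: "F (J c e) = f1 c * f2 e" if c: "c \<in> C1" and e: "e \<in> C2" for c e
  proof -
    have "F (J c e) * K * K = F (J (c * c0) (e * e0)) * F (J c0 e0)"
      using m[OF c e ce(1,2)] by (simp add: K_def J_mult)
    also have "\<dots> = F (J (c * c0 * c0) (e * e0 * e0))"
      using m[of "c * c0" "e * e0" c0 e0] c e ce cl1 cl2 by (simp add: J_mult)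
    also have "e * e0 * e0 = e0 * (e * e0)" using comm2[of e0 "e * e0"] e ce cl2 by simp
    also have "F (J (c * c0 * c0) (e0 * (e * e0))) = F (J (c * c0) e0) * F (J c0 (e * e0))"
      using m[of "c * c0" e0 c0 "e * e0"] c e ce cl1 cl2 by (simp add: J_mult)
    also have "\<dots> = f1 c * f2 e * K * K" by (simp flip: f1e f2e)
    finally show ?thesis using K by simp
  qed
  have "character_on C1 f1"
    unfolding character_on_def linear_functional_on_def
  proof (intro conjI ballI allI)
    fix x y assume x: "x \<in> C1" and y: "y \<in> C1"
    have f1G: "f1 z = G (J (z * c0) e0) / K" if "z \<in> C1" for z
      using that ce cl1 J_in_T G(2) by (simp add: f1_def)
    show "f1 (x + y) = f1 x + f1 y"
      using x y cl1 by (simp add: f1G distrib_right J_lin Glin add_divide_distrib)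
    have "f1 (x * y) * K * K = F (J (x * y * c0) e0) * F (J c0 e0)" by (simp only: f1e) (simp add: K_def)
    also have "\<dots> = F (J (x * y * c0 * c0) (e0 * e0))"
      using m[of "x * y * c0" e0 c0 e0] x y ce cl1 cl2 by (simp add: J_mult)
    also have "x * y * c0 * c0 = (x * c0) * (y * c0)" using comm1[OF y ce(1)] by (simp add: mult.assoc)
    also have "F (J ((x * c0) * (y * c0)) (e0 * e0)) = F (J (x * c0) e0) * F (J (y * c0) e0)"
      using m[of "x * c0" e0 "y * c0" e0] x y ce cl1 cl2 by (simp add: J_mult)
    also have "\<dots> = f1 x * f1 y * K * K" by (simp flip: f1e)
    finally show "f1 (x * y) = f1 x * f1 y" using K by simp
    show "f1 (c *\<^sub>C x) = c * f1 x" for c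
      using x cl1 by (simp add: f1G mult_scaleC_left J_lin Glin)
  qed
  moreover have "character_on C2 f2"
    unfolding character_on_def linear_functional_on_def
  proof (intro conjI ballI allI)
    fix x y assume x: "x \<in> C2" and y: "y \<in> C2"
    have f2G: "f2 z = G (J c0 (z * e0)) / K" if "z \<in> C2" for z
      using that ce cl2 J_in_T G(2) by (simp add: f2_def)
    show "f2 (x + y) = f2 x + f2 y"
      using x y cl2 by (simp add: f2G distrib_right J_lin Glin add_divide_distrib)
    have "f2 (x * y) * K * K = F (J c0 (x * y * e0)) * F (J c0 e0)" by (simp only: f2e) (simp add: K_def)
    also have "\<dots> = F (J (c0 * c0) (x * y * e0 * e0))"
      using m[of c0 "x * y * e0" c0 e0] x y ce cl1 cl2 by (simp add: J_mult)
    also have "x * y * e0 * e0 = (x * e0) * (y * e0)" using comm2[OF y ce(2)] by (simp add: mult.assoc)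
    also have "F (J (c0 * c0) ((x * e0) * (y * e0))) = F (J c0 (x * e0)) * F (J c0 (y * e0))"
      using m[of c0 "x * e0" c0 "y * e0"] x y ce cl1 cl2 by (simp add: J_mult)
    also have "\<dots> = f2 x * f2 y * K * K" by (simp flip: f2e)
    finally show "f2 (x * y) = f2 x * f2 y" using K by simp
    show "f2 (c *\<^sub>C x) = c * f2 x" for c
      using x cl2 by (simp add: f2G mult_scaleC_left J_lin Glin)
  qed
  moreover have "f1 c0 \<noteq> 0 \<and> f2 e0 \<noteq> 0" using fact[OF ce(1,2)] ce(3) by auto
  ultimately show ?thesis using that ce fact by blast
qed

text \<open>For \<open>b = star y * y\<close> the functional \<open>a \<mapsto> G (J a b)\<close> is
  positive and restricts to \<open>h b\<close> times \<open>f1\<close>, so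
  \<open>positive_extension_unique\<close> determines it. Linearity in \<open>b\<close> then passes
  from squares to all elements.\<close>

lemma extension_is_product:
  assumes M1: "masa C1" and EP: "extension_property C1" and f1: "pure_state_on C1 f1"
    and g1: "quasi_state_on UNIV g1" "\<And>x. x \<in> C1 \<Longrightarrow> g1 x = f1 x"
    and G: "quasi_state_on UNIV G" and h: "\<And>c b. c \<in> C1 \<Longrightarrow> G (J c b) = f1 c * h b"
  shows "G (J a b) = g1 a * h b"
proof -
  note C1 = masa_subalgebra[OF M1]
  note Glin = clinearD[OF quasi_state_clinear[OF G]]
  note g1lin = clinearD[OF quasi_state_clinear[OF g1(1)]]
  have char: "character_on C1 f1" by (rule pure_state_character[OF C1 masa_abelian[OF M1] f1])
  obtain z where z: "z \<in> C1" "f1 z \<noteq> 0" using pure_state_nonzero[OF C1 f1] .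
  obtain c0 where c0: "c0 \<in> C1" "star c0 = c0" "f1 c0 = 1" using character_normalized[OF C1 char z] .
  have h_eq: "h b = G (J c0 b)" for b using h[OF c0(1)] c0(3) by simp
  have Gle: "cmod (G (J a b)) \<le> norm a * norm b" for a b
    using quasi_stateD(3)[OF G UNIV_I, of "J a b"] by (simp add: norm_J)
  have sq: "G (J a (star y * y)) = g1 a * h (star y * y)" for a y
  proof -
    have "G (J a (star y * y)) = h (star y * y) * g1 a"
    proof (rule positive_extension_unique[where \<psi> = "\<lambda>a. G (J a (star y * y))" and K = "norm (star y * y)", OF M1 EP f1 g1(1)])
      show "linear_functional_on UNIV (\<lambda>a. G (J a (star y * y)))"
        by (simp add: linear_functional_on_def J_lin Glin)
      show "positive_on UNIV (\<lambda>a. G (J a (star y * y)))"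
        using positive_onD[OF quasi_stateD(2)[OF G], of "J x y" for x]
        by (simp add: positive_on_def J_star J_mult)
      show "cmod (G (J a (star y * y))) \<le> norm (star y * y) * norm a" for a
        using Gle[of a "star y * y"] by (simp add: mult.commute)
      show "G (J x (star y * y)) = h (star y * y) * f1 x" if "x \<in> C1" for x
        using h[OF that] by (simp add: mult.commute)
    qed (rule g1(2))
    then show ?thesis by simp
  qed
  \<comment> \<open>\<open>h\<close> is not assumed linear, so it is replaced by
    \<open>G (J c0 b)\<close>, where \<open>f1 c0 = 1\<close>.\<close>
  have "G (J a b) - g1 a * G (J c0 b) = 0"
  proof (rule functional_vanish_on_squares[where d = "\<lambda>b. G (J a b) - g1 a * G (J c0 b)", OF cstar_subalgebra_UNIV _ _ _ UNIV_I])
    show "linear_functional_on UNIV (\<lambda>b. G (J a b) - g1 a * G (J c0 b))"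
      by (simp add: linear_functional_on_def J_lin Glin algebra_simps)
    show "cmod (G (J a b) - g1 a * G (J c0 b)) \<le> (norm a + cmod (g1 a) * norm c0) * norm b" for b
    proof -
      have "cmod (g1 a * G (J c0 b)) \<le> cmod (g1 a) * (norm c0 * norm b)"
        using Gle[of c0 b] by (simp add: norm_mult mult_left_mono)
      then show ?thesis
        using norm_triangle_ineq4[of "G (J a b)" "g1 a * G (J c0 b)"] Gle[of a b]
        by (simp add: distrib_right)
    qed
    show "G (J a (star y * y)) - g1 a * G (J c0 (star y * y)) = 0" for y
      using sq[of a y] by (simp add: h_eq)
  qed
  then show ?thesis by (simp add: h_eq)
qed

text \<open>The elementary tensors from \<open>C1\<close> and \<open>C2\<close> lie in the
  multiplicative domain of \<open>G\<close>. Inserting \<open>c0 \<otimes> e0\<close>, of value 1,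
  lets \<open>c\<close> and \<open>c0\<close> change places and isolates
  \<open>f1 c\<close>.\<close>

lemma second_factor:
  assumes C1: "cstar_subalgebra C1" "abelian C1" and C2: "cstar_subalgebra C2" "abelian C2"
    and f1: "character_on C1 f1" "z1 \<in> C1" "f1 z1 \<noteq> 0" and f2: "character_on C2 f2" "z2 \<in> C2" "f2 z2 \<noteq> 0"
    and G: "quasi_state_on UNIV G" and prod: "\<And>c e. c \<in> C1 \<Longrightarrow> e \<in> C2 \<Longrightarrow> G (J c e) = f1 c * f2 e"
  obtains h where "quasi_state_on UNIV h" "\<And>e. e \<in> C2 \<Longrightarrow> h e = f2 e" "\<And>c b. c \<in> C1 \<Longrightarrow> G (J c b) = f1 c * h b"
proof -
  note cl1 = cstar_subalgebraD[OF C1(1)] and cl2 = cstar_subalgebraD[OF C2(1)]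
  note Glin = clinearD[OF quasi_state_clinear[OF G]]
  obtain c1 where c1: "c1 \<in> C1" "star c1 = c1" "f1 c1 = 1" using character_normalized[OF C1(1) f1] .
  obtain e0 where e0: "e0 \<in> C2" "star e0 = e0" "f2 e0 = 1" using character_normalized[OF C2(1) f2] .
  have f1m: "f1 (x * y) = f1 x * f1 y" if "x \<in> C1" "y \<in> C1" for x y using f1 that by (auto simp: character_on_def)
  have f2m: "f2 (x * y) = f2 x * f2 y" if "x \<in> C2" "y \<in> C2" for x y using f2 that by (auto simp: character_on_def)
  have md: "G (J c e * x) = G (J c e) * G x" if c: "c \<in> C1" and e: "e \<in> C2" for c e x
  proof (rule quasi_state_multiplicative_domain[OF cstar_subalgebra_UNIV G UNIV_I UNIV_I])
    show "G (J c e * star (J c e)) = G (J c e) * cnj (G (J c e))"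
      using c e cl1 cl2 quasi_state_star(1)[OF C1(1) character_quasi_state[OF C1(1) f1(1)] c]
        quasi_state_star(1)[OF C2(1) character_quasi_state[OF C2(1) f2(1)] e]
      by (simp add: J_star J_mult prod f1m f2m)
  qed
  \<comment> \<open>A square, so that \<open>h (star y * y)\<close> is the value of \<open>G\<close>
    at the square of \<open>J c1 y\<close>.\<close>
  define c0 where "c0 = star c1 * c1"
  have c0: "c0 \<in> C1" "f1 c0 = 1" using c1 cl1 by (simp_all add: c0_def f1m)
  define h where "h b = G (J c0 b)" for b
  have fact: "G (J c b) = f1 c * h b" if c: "c \<in> C1" for c b
  proof -
    have "G (J c b) = G (J c0 e0 * J c b)" using md[OF c0(1) e0(1)] by (simp add: prod c0 e0)
    also have "J c0 e0 * J c b = J c e0 * J c0 b"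
      using C1(2) c c0(1) by (simp add: J_mult abelian_def)
    also have "G (J c e0 * J c0 b) = f1 c * h b" using md[OF c e0(1)] by (simp add: prod c e0 h_def)
    finally show ?thesis .
  qed
  \<comment> \<open>The fixed \<open>c0\<close> may have norm above 1 and would give a worse
    constant; elements \<open>c\<close> of the unit ball with \<open>f1 c\<close> of modulus near 1
    give the constant 1.\<close>
  have "cmod (h b) \<le> norm b" for b
  proof (rule field_le_mult_one_interval)
    fix t :: real assume t: "0 < t" "t < 1"
    have "state_on C1 f1" using pure_stateD(1)[OF C1(1) character_pure_state[OF C1(1) f1]] .
    from state_onD(2)[OF C1(1) this, of "1 - t"] t
    obtain c where c: "c \<in> C1" "norm c \<le> 1" "t < cmod (f1 c)" by auto
    have "t * cmod (h b) \<le> cmod (f1 c) * cmod (h b)" using c by (intro mult_right_mono) auto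
    also have "\<dots> = cmod (G (J c b))" by (simp add: fact c norm_mult)
    also have "\<dots> \<le> norm c * norm b" using quasi_stateD(3)[OF G UNIV_I, of "J c b"] by (simp add: norm_J)
    also have "\<dots> \<le> 1 * norm b" using c by (intro mult_right_mono) auto
    finally show "t * cmod (h b) \<le> norm b" by simp
  qed
  moreover have "h (star y * y) \<in> \<real>\<^sub>\<ge>\<^sub>0" for y
    using positive_onD[OF quasi_stateD(2)[OF G], of "J c1 y"] by (simp add: J_star J_mult h_def c0_def)
  ultimately have q: "quasi_state_on UNIV h"
    by (simp add: quasi_state_on_def positive_on_def linear_functional_on_def) (simp add: h_def J_lin Glin)
  have "h e = f2 e" if "e \<in> C2" for e using prod[OF c0(1) that] c0(2) by (simp add: h_def)
  then show ?thesis by (rule that[OF q _ fact])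
qed

text \<open>Positivity in one variable is available only while the other is a square. Squares from
  \<open>C2\<close> are fixed to free the first variable, then squares of the first algebra to free
  the second, each time followed by a passage from squares to all elements.\<close>

lemma vanishing_extension:
  assumes Z1: "no_state_vanishes_on C1"
    and C2: "cstar_subalgebra C2"
    and Z2: "no_state_vanishes_on C2"
    and G: "quasi_state_on UNIV G" and 0: "\<And>c e. c \<in> C1 \<Longrightarrow> e \<in> C2 \<Longrightarrow> G (J c e) = 0"
  shows "G x = 0"
proof -
  note cl2 = cstar_subalgebraD[OF C2]
  note Glin = clinearD[OF quasi_state_clinear[OF G]]
  have Gle: "cmod (G (J a b)) \<le> norm a * norm b" for a b
    using quasi_stateD(3)[OF G UNIV_I, of "J a b"] by (simp add: norm_J)
  have pos: "G (J (star x * x) (star y * y)) \<in> \<real>\<^sub>\<ge>\<^sub>0" for x y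
    using positive_onD[OF quasi_stateD(2)[OF G], of "J x y"] by (simp add: J_star J_mult)
  have lin1: "linear_functional_on UNIV (\<lambda>a. G (J a b))" and lin2: "linear_functional_on UNIV (\<lambda>b. G (J a b))" for a b
    by (simp_all add: linear_functional_on_def J_lin Glin)
  have 1: "G (J a (star e * e)) = 0" if e: "e \<in> C2" for a e
  proof (rule positive_functional_vanish[OF Z1 lin1])
    show "positive_on UNIV (\<lambda>a. G (J a (star e * e)))" by (simp add: positive_on_def pos)
    show "cmod (G (J a (star e * e))) \<le> norm (star e * e) * norm a" for a
      using Gle[of a "star e * e"] by (simp add: mult.commute)
  qed (use 0 e cl2 in auto)
  have 2: "G (J a e) = 0" if e: "e \<in> C2" for a e
  proof (rule functional_vanish_on_squares[OF C2 _ _ _ e])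
    show "linear_functional_on C2 (\<lambda>b. G (J a b))" using lin2 by (simp add: linear_functional_on_def)
    show "cmod (G (J a b)) \<le> norm a * norm b" for b by (rule Gle)
  qed (rule 1)
  have 3: "G (J (star a * a) b) = 0" for a b
  proof (rule positive_functional_vanish[OF Z2 lin2])
    show "positive_on UNIV (\<lambda>b. G (J (star a * a) b))" by (simp add: positive_on_def pos)
    show "cmod (G (J (star a * a) b)) \<le> norm (star a * a) * norm b" for b by (rule Gle)
  qed (use 2 in auto)
  have 4: "G (J a b) = 0" for a b
  proof (rule functional_vanish_on_squares[OF cstar_subalgebra_UNIV lin1 _ _ UNIV_I])
    show "cmod (G (J a b)) \<le> norm b * norm a" for a using Gle by (simp add: mult.commute)
  qed (rule 3)
  show ?thesis
    by (rule vanish_on_T[OF quasi_state_clinear[OF G], of 1 UNIV UNIV])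
      (use 4 quasi_stateD(3)[OF G UNIV_I] in \<open>auto simp: T_UNIV\<close>)
qed

end

text \<open>1 minus the square of \<open>1 - 2 *\<^sub>R h\<close> is the positive element
  \<open>4 *\<^sub>R (h * (1 - h))\<close>.\<close>

lemma norm_one_minus_twice:
  assumes h: "cpos h" "norm h \<le> 1"
  shows "norm (1 - 2 *\<^sub>R h) \<le> 1"
proof -
  define x where "x = 1 - 2 *\<^sub>R h"
  have sx: "star x = x" by (simp add: x_def star_simps cpos_sa[OF h(1)])
  have "cpos (1 - h)" using cpos_norm_minus[OF cpos_sa[OF h(1)] h(2)] by simp
  then have "cpos (4 *\<^sub>R (h * (1 - h)))"
    by (intro cpos_scale cpos_mult h(1)) (auto simp: algebra_simps)
  moreover have "4 *\<^sub>R (h * (1 - h)) = 1 - x * x"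
    by (simp add: x_def algebra_simps flip: scaleR_2)
  ultimately have "norm (x * x) \<le> norm (1 :: 'a)" by (intro norm_le_cpos cpos_square sx) simp
  then have "(norm x)\<^sup>2 \<le> 1" by (simp add: norm_square_sa[OF sx])
  then show ?thesis by (simp add: x_def abs_square_le_1)
qed

text \<open>For a contractive extension \<open>F\<close> to the unitization, the contraction
  \<open>1 - 2 *\<^sub>R emb (star y * y)\<close> gives
  \<open>cmod (F 1 - 2 * G (star y * y)) \<le> 1\<close> with second term near 2, which forces
  \<open>F 1 = 1\<close>; and normalized contractions are positive.\<close>

lemma contractive_functional_positive:
  fixes G :: "'a::cstar_algebra \<Rightarrow> complex"
  assumes G: "clinear G" "\<And>x. cmod (G x) \<le> norm x"
    and approx: "\<And>\<epsilon>. \<epsilon> > 0 \<Longrightarrow> \<exists>y. norm y \<le> 1 \<and> cmod (G (star y * y) - 1) < \<epsilon>"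
  shows "quasi_state_on UNIV G"
proof -
  define V :: "'a uz set" where "V = {z. scl z = 0}"
  have V: "csubspace V" by (simp add: V_def complex_vector.subspace_def)
  have lin: "linear_functional_on V (\<lambda>z. G (vec z))"
    by (simp add: linear_functional_on_def V_def clinearD[OF G(1)])
  have "cmod (G (vec z)) \<le> norm z" if "z \<in> V" for z
    using G(2)[of "vec z"] that norm_emb[of "vec z"] by (simp add: V_def emb_vec)
  from hahn_banach[OF V lin this] obtain F where F: "clinear F" "\<And>z. z \<in> V \<Longrightarrow> F z = G (vec z)" "\<And>z. cmod (F z) \<le> norm z"
    by blast
  have FG: "F (emb x) = G x" for x using F(2)[of "emb x"] by (simp add: V_def)
  have le1: "cmod (F 1) \<le> 1" using F(3)[of 1] by simp
  have "1 \<le> Re (F 1) + \<epsilon>" if e: "\<epsilon> > 0" for \<epsilon> :: real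
  proof -
    obtain y where y: "norm y \<le> 1" "cmod (G (star y * y) - 1) < \<epsilon> / 2" using approx[of "\<epsilon> / 2"] e by auto
    have "norm (emb (star y * y)) \<le> 1" using y(1) by (simp add: cstar_identity power_le_one)
    then have "norm (1 - 2 *\<^sub>R emb (star y * y)) \<le> 1"
      by (intro norm_one_minus_twice) (auto simp: emb_hom cpos_star_mult)
    then have "cmod (F (1 - 2 *\<^sub>R emb (star y * y))) \<le> 1" using F(3) order_trans by blast
    then have 1: "cmod (F 1 - 2 * G (star y * y)) \<le> 1" by (simp only: clinearD[OF F(1)] FG) simp
    have "Re (2 * G (star y * y) - F 1) \<le> 1"
      using complex_Re_le_cmod[of "2 * G (star y * y) - F 1"] 1 by (simp add: norm_minus_commute)
    moreover have "Re (1 - G (star y * y)) < \<epsilon> / 2"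
      using complex_Re_le_cmod[of "1 - G (star y * y)"] y(2) by (simp add: norm_minus_commute)
    ultimately show ?thesis by simp
  qed
  then have "1 \<le> Re (F 1)" by (rule field_le_epsilon)
  then have re: "Re (F 1) = 1" using complex_Re_le_cmod[of "F 1"] le1 by linarith
  then have "Im (F 1) = 0" using power_mono[OF le1 norm_ge_zero, of 2] cmod_power2[of "F 1"] by simp
  then have "nstate F" using F re by (simp add: nstate_def complex_eq_iff)
  from nstate_quasi_state[OF this] show ?thesis by (simp add: FG)
qed

lemma no_state_vanishes_approximate_identity:
  assumes C: "cstar_subalgebra C" and ai: "contains_approximate_identity C"
  shows "no_state_vanishes_on C"
  unfolding no_state_vanishes_on_def
proof (intro allI impI)
  fix g x assume g: "quasi_state_on UNIV g" and 0: "\<forall>x\<in>C. g x = 0"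
  obtain \<F> where \<F>: "\<F> \<noteq> bot" "\<forall>\<^sub>F e in \<F>. e \<in> C" "((\<lambda>e. e * x) \<longlongrightarrow> x) \<F>"
    using ai by (auto simp: contains_approximate_identity_def)
  have lin: "clinear g" by (rule quasi_state_clinear[OF g])
  have "bounded_linear g"
    by (rule bounded_linear_intro[of _ 1])
      (use quasi_stateD(3)[OF g UNIV_I] in \<open>auto simp: clinearD[OF lin] scaleR_conv_of_real\<close>)
  then have "((\<lambda>e. g (e * x)) \<longlongrightarrow> g x) \<F>" using \<F>(3) by (rule bounded_linear.tendsto)
  moreover have "\<forall>\<^sub>F e in \<F>. g (e * x) = 0"
    using \<F>(2)
  proof eventually_elim
    case (elim e)
    have "(cmod (g (star (star e) * x)))\<^sup>2 \<le> Re (g (star (star e) * star e)) * Re (g (star x * x))"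
      by (rule positive_form(2)[OF cstar_subalgebra_UNIV quasi_stateD(1,2)[OF g]]) auto
    then show ?case using 0 elim cstar_subalgebraD[OF C] by (simp add: star_star)
  qed
  then have "((\<lambda>e. g (e * x)) \<longlongrightarrow> 0) \<F>" by (rule tendsto_eventually)
  ultimately show "g x = 0" using tendsto_unique[OF \<F>(1)] by blast
qed

lemma no_state_vanishes_unital:
  fixes C :: "'a::cstar_algebra set"
  assumes M: "masa C" and u: "unital TYPE('a)"
  shows "no_state_vanishes_on C"
  unfolding no_state_vanishes_on_def
proof (intro allI impI)
  fix g x assume g: "quasi_state_on UNIV g" and 0: "\<forall>x\<in>C. g x = 0"
  obtain u :: 'a where u: "\<And>x. u * x = x \<and> x * u = x" using u by (auto simp: unital_def)
  then have "u \<in> C" by (intro masa_commutant[OF M]) simp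
  then show "g x = 0" using quasi_state_vanish_unit[OF g u] 0 by blast
qed

text \<open>Multiplying by powers of \<open>1 - y\<^sup>* y / \<parallel>y\<parallel>\<^sup>2\<close>, where \<open>y = c - f c\<close>, localizes \<open>d\<close> near the
  points at which \<open>c\<close> takes the value \<open>f c\<close>.\<close>

lemma localize_step:
  assumes C: "cstar_subalgebra C" and ab: "abelian C" and f: "character_on C f"
    and d: "d \<in> C" "f d = 1" and c: "c \<in> C" and \<delta>: "\<delta> > 0"
  obtains d' where "d' \<in> C" "f d' = 1" "norm d' \<le> norm d" "norm (c * d' - f c *\<^sub>C d') \<le> \<delta>"
    "\<And>c'. c' \<in> C \<Longrightarrow> norm (c' * d' - f c' *\<^sub>C d') \<le> norm (c' * d - f c' *\<^sub>C d)"
proof -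
  note cl = cstar_subalgebraD[OF C]
  define U where "U = unitize C"
  have U: "cstar_subalgebra U" unfolding U_def by (rule cstar_subalgebra_unitize[OF C])
  note ul = cstar_subalgebraD[OF U]
  have oneU: "1 \<in> U" using cl by (simp add: U_def)
  define \<phi> where "\<phi> z = f (vec z) + scl z" for z
  have \<phi>: "character_on U \<phi>" unfolding U_def \<phi>_def by (rule character_on_unitize[OF C f])
  have \<phi>m: "\<phi> (z * w) = \<phi> z * \<phi> w" if "z \<in> U" "w \<in> U" for z w using \<phi> that by (auto simp: character_on_def)
  have \<phi>l: "linear_functional_on U \<phi>" using \<phi> by (auto simp: character_on_def)
  note \<phi>lin = linear_functional_onD[OF \<phi>l ul(1)]
  have f0: "f 0 = 0" using linear_functional_onD(6)[of C f] f cl(1) by (simp add: character_on_def)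
  have \<phi>1: "\<phi> 1 = 1" and \<phi>e: "\<phi> (emb x) = f x" for x by (simp_all add: \<phi>_def f0)
  have comm: "z * w = w * z" if "z \<in> U" "w \<in> U" for z w
    using that ab by (auto simp: uz_eq_iff U_def unitize_def abelian_def mult.commute add.commute add.left_commute)
  define y where "y c = emb c - f c *\<^sub>C 1" for c
  have yU: "y c' \<in> U" if "c' \<in> C" for c' using that ul oneU by (simp add: y_def U_def)
  have emb_y: "emb (c' * x - f c' *\<^sub>C x) = y c' * emb x" for c' x
    by (simp add: y_def emb_hom left_diff_distrib mult_scaleC_left)
  show ?thesis
  proof (cases "y c = 0")
    case True
    have "emb (c * d - f c *\<^sub>C d) = emb 0" by (simp only: emb_y True) (simp add: emb_hom)
    then have "c * d - f c *\<^sub>C d = 0" by (simp only: emb_inject)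
    then show ?thesis using that[of d] d \<delta> by simp
  next
    case False
    define M where "M = (norm (y c))\<^sup>2"
    have M: "M > 0" using False by (simp add: M_def)
    define h where "h = inverse M *\<^sub>R (star (y c) * y c)"
    have h: "cpos h" unfolding h_def using M by (intro cpos_scale cpos_star_mult) auto
    have "norm h = 1" using M by (simp add: h_def cstar_identity M_def)
    then have h1: "cpos (1 - h)" using cpos_norm_minus[OF cpos_sa[OF h], of 1] by simp
    define g where "g = 1 - h"
    have g: "cpos g" using h1 by (simp add: g_def)
    have hU: "h \<in> U" using yU[OF c] ul by (simp add: h_def)
    then have gU: "g \<in> U" using ul oneU by (simp add: g_def)
    have "\<phi> (y c) = 0" using c oneU ul by (simp add: y_def \<phi>lin \<phi>e \<phi>1 U_def)
    then have "\<phi> (star (y c) * y c) = 0" using \<phi>m yU[OF c] ul(4) by simp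
    then have "\<phi> h = 0" using yU[OF c] ul by (simp add: h_def \<phi>lin)
    then have \<phi>g: "\<phi> g = 1" using hU oneU by (simp add: g_def \<phi>lin \<phi>1)
    have gnU: "g ^ n \<in> U" for n using gU oneU ul by (induction n) auto
    have \<phi>gn: "\<phi> (g ^ n) = 1" for n by (induction n) (auto simp: \<phi>1 \<phi>m gU gnU \<phi>g)
    have "norm g \<le> 1" using norm_le_cpos[OF g, of 1] h by (simp add: g_def)
    then have ngn: "norm (g ^ n) \<le> 1" for n
      using norm_power_ineq[of g n] power_le_one[of "norm g" n] by simp
    have sgn: "star (g ^ n) = g ^ n" for n by (rule cpos_sa[OF cpos_power[OF g]])
    \<comment> \<open>By \<open>norm_power_decay\<close> the squared norm of
      \<open>y c * g ^ n\<close> is at most \<open>M / (2 * real n + 1)\<close>; the other factor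
      accounts for the multiplication by \<open>d\<close>.\<close>
    obtain n where n: "M * (norm d)\<^sup>2 / (2 * real n + 1) < \<delta>\<^sup>2"
    proof -
      obtain n where "M * (norm d)\<^sup>2 / \<delta>\<^sup>2 < real n" using reals_Archimedean2 by blast
      then have "M * (norm d)\<^sup>2 < \<delta>\<^sup>2 * real n" using \<delta> by (simp add: field_simps)
      also have "\<dots> \<le> \<delta>\<^sup>2 * (2 * real n + 1)" by (intro mult_left_mono) auto
      finally show ?thesis using that[of n] by (simp add: divide_less_eq add_pos_nonneg)
    qed
    have dU: "emb d \<in> U" using d by (simp add: U_def)
    define d' where "d' = vec (g ^ n * emb d)"
    have d': "emb d' = g ^ n * emb d" unfolding d'_def by (rule emb_vec) simp
    have bound: "norm (c' * d' - f c' *\<^sub>C d') = norm (y c' * g ^ n * emb d)" for c'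
      by (subst norm_emb[symmetric]) (simp only: emb_y d' mult.assoc)
    show ?thesis
    proof (rule that)
      have "emb d' \<in> U" unfolding d' by (rule ul(3)[OF gnU dU])
      then show "d' \<in> C" by (simp add: U_def)
      have "f d' = \<phi> (g ^ n * emb d)" by (simp only: d'[symmetric] \<phi>e)
      then show "f d' = 1" using \<phi>m[OF gnU dU] by (simp add: \<phi>gn \<phi>e d)
      have "norm d' = norm (g ^ n * emb d)" by (metis d' norm_emb)
      also have "\<dots> \<le> norm (g ^ n) * norm d" using norm_mult_ineq[of "g ^ n" "emb d"] by simp
      also have "\<dots> \<le> 1 * norm d" by (intro mult_right_mono ngn) simp
      finally show "norm d' \<le> norm d" by simp
      have "(norm (y c * g ^ n))\<^sup>2 = norm (g ^ n * (star (y c) * y c) * g ^ n)"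
        by (simp add: star_mult sgn mult.assoc flip: cstar_identity)
      also have "g ^ n * (star (y c) * y c) * g ^ n = M *\<^sub>R (h * (1 - h) ^ (2 * n))"
      proof -
        have "star (y c) * y c = M *\<^sub>R h" using M by (simp add: h_def)
        moreover have "g ^ n * h * g ^ n = h * g ^ (2 * n)"
          using comm[OF gnU hU] by (simp add: mult.assoc mult_2 power_add)
        ultimately show ?thesis by (simp flip: g_def)
      qed
      also have "norm (M *\<^sub>R (h * (1 - h) ^ (2 * n))) \<le> M * (1 / (real (2 * n) + 1))"
        using norm_power_decay[OF h h1, of "2 * n"] M mult_left_mono[of _ _ M] by fastforce
      finally have "(norm (y c * g ^ n))\<^sup>2 * (norm d)\<^sup>2 \<le> M / (2 * real n + 1) * (norm d)\<^sup>2"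
        by (intro mult_right_mono) auto
      then have "(norm (y c * g ^ n) * norm d)\<^sup>2 \<le> \<delta>\<^sup>2"
        using n by (simp add: power_mult_distrib)
      then have "norm (y c * g ^ n) * norm d \<le> \<delta>" by (rule power2_le_imp_le) (use \<delta> in simp)
      then show "norm (c * d' - f c *\<^sub>C d') \<le> \<delta>"
        unfolding bound using norm_mult_ineq[of "y c * g ^ n" "emb d"] by simp
      \<comment> \<open>\<open>g ^ n\<close> is a contraction commuting with \<open>y c'\<close>, so
        estimates reached earlier are not spoilt.\<close>
      fix c' assume c': "c' \<in> C"
      have "norm (y c' * g ^ n * emb d) = norm (g ^ n * (y c' * emb d))"
        using comm[OF yU[OF c'] gnU] by (simp add: mult.assoc)
      also have "\<dots> \<le> norm (g ^ n) * norm (y c' * emb d)" by (rule norm_mult_ineq)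
      also have "\<dots> \<le> 1 * norm (y c' * emb d)" by (intro mult_right_mono ngn) simp
      also have "\<dots> = norm (c' * d - f c' *\<^sub>C d)" by (simp flip: emb_y)
      finally show "norm (c' * d' - f c' *\<^sub>C d') \<le> norm (c' * d - f c' *\<^sub>C d)" unfolding bound .
    qed
  qed
qed

text \<open>Induction over \<open>S\<close>: treating a new \<open>c\<close> worsens neither the
  norm nor the estimates already reached. The start is a rescaled element that nearly norms
  \<open>f\<close>.\<close>

lemma localizing_element:
  assumes C: "cstar_subalgebra C" and ab: "abelian C" and f: "character_on C f" and z: "z \<in> C" "f z \<noteq> 0"
    and S: "finite S" "S \<subseteq> C" and pos: "\<eta> > 0" "\<delta> > 0"
  obtains d where "d \<in> C" "f d = 1" "norm d \<le> 1 + \<eta>" "\<And>c. c \<in> S \<Longrightarrow> norm (c * d - f c *\<^sub>C d) \<le> \<delta>"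
proof -
  note cl = cstar_subalgebraD[OF C]
  have "\<exists>d\<in>C. f d = 1 \<and> norm d \<le> 1 + \<eta> \<and> (\<forall>c\<in>S. norm (c * d - f c *\<^sub>C d) \<le> \<delta>)"
    using S
  proof (induction S)
    case empty
    \<comment> \<open>This tolerance makes \<open>f c\<close> exceed \<open>1 / (1 + \<eta>)\<close>
      in modulus, which inverts to the required norm bound.\<close>
    have "0 < \<eta> / (1 + \<eta>)" using pos by simp
    from state_onD(2)[OF C pure_stateD(1)[OF C character_pure_state[OF C f z]] this]
    obtain c where c: "c \<in> C" "norm c \<le> 1" "1 - \<eta> / (1 + \<eta>) < cmod (f c)" by blast
    have "1 - \<eta> / (1 + \<eta>) = 1 / (1 + \<eta>)" using pos by (simp add: field_simps)
    then have fc: "1 / (1 + \<eta>) < cmod (f c)" using c by simp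
    moreover have "0 < 1 / (1 + \<eta>)" using pos by simp
    ultimately have fc0: "0 < cmod (f c)" by linarith
    have "f (inverse (f c) *\<^sub>C c) = 1"
      using f c fc0 by (simp add: character_on_def linear_functional_on_def)
    moreover have "norm (inverse (f c) *\<^sub>C c) \<le> 1 + \<eta>"
    proof -
      have "norm (inverse (f c) *\<^sub>C c) \<le> inverse (cmod (f c)) * 1"
        using c(2) by (simp add: norm_scaleC norm_inverse mult_left_le)
      also have "\<dots> \<le> 1 + \<eta>" using fc fc0 pos by (simp add: field_simps)
      finally show ?thesis .
    qed
    ultimately show ?case using c cl by (intro bexI[of _ "inverse (f c) *\<^sub>C c"]) auto
  next
    case (insert c S)
    then obtain d where d: "d \<in> C" "f d = 1" "norm d \<le> 1 + \<eta>" "\<forall>c\<in>S. norm (c * d - f c *\<^sub>C d) \<le> \<delta>" by auto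
    have c: "c \<in> C" using insert by auto
    obtain d' where d': "d' \<in> C" "f d' = 1" "norm d' \<le> norm d" "norm (c * d' - f c *\<^sub>C d') \<le> \<delta>"
      "\<And>c'. c' \<in> C \<Longrightarrow> norm (c' * d' - f c' *\<^sub>C d') \<le> norm (c' * d - f c' *\<^sub>C d)"
      using localize_step[OF C ab f d(1,2) c pos(2)] by metis
    have "norm (c' * d' - f c' *\<^sub>C d') \<le> \<delta>" if "c' \<in> S" for c'
      using d'(5)[of c'] d(4) that insert by (metis order_trans insert_subset subsetD)
    then show ?case using d d' by (intro bexI[of _ d']) auto
  qed
  then show ?thesis using that by blast
qed

section \<open>Slice maps and product states\<close>

context cstar_tensor
begin

lemma slice:
  assumes "clinear (g :: 'a \<Rightarrow> complex)"
  obtains r :: "'a \<odot> 'b \<Rightarrow> 'b" where "clinear r" "\<And>a b. r (a \<otimes> b) = g a *\<^sub>C b"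
proof -
  have "cbilinear (\<lambda>a b. g a *\<^sub>C b :: 'b)"
    by (simp add: cbilinear_iff clinearD[OF assms] scaleC_algebra mult.commute)
  from tensor_lift[OF this] show ?thesis using that by blast
qed

text \<open>For \<open>d\<close> close to a point evaluation at \<open>f\<close>, multiplication by \<open>d\<close> turns \<open>\<Sum> c\<^sub>i \<otimes> b\<^sub>i\<close>
  approximately into \<open>d \<otimes> \<Sum> f(c\<^sub>i) b\<^sub>i\<close>, whose norm is known.\<close>

lemma slice_bound_character:
  assumes C1: "cstar_subalgebra C1" "abelian C1" and f1: "character_on C1 f1" "z \<in> C1" "f1 z \<noteq> 0"
    and g1: "\<And>c. c \<in> C1 \<Longrightarrow> g1 c = f1 c" and r: "clinear r" "\<And>a b. r (a \<otimes> b) = g1 a *\<^sub>C b"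
    and x: "x \<in> alg_tensor_set C1 UNIV"
  shows "norm (r x) \<le> norm (\<iota> x)"
proof -
  have q: "quasi_state_on C1 f1" by (rule character_quasi_state[OF C1(1) f1(1)])
  \<comment> \<open>\<open>S\<close> collects the finitely many first factors of \<open>x\<close>.
    The error is linear in \<open>\<delta>\<close> with a constant independent of \<open>d\<close>,
    so that \<open>d\<close> can be chosen afterwards.\<close>
  define P where "P x S K \<longleftrightarrow> finite S \<and> S \<subseteq> C1 \<and> 0 \<le> K \<and>
      (\<forall>d\<in>C1. \<forall>\<delta>\<ge>0. (\<forall>c\<in>S. norm (c * d - f1 c *\<^sub>C d) \<le> \<delta>) \<longrightarrow>
        norm (\<iota> (lmul d x) - J d (r x)) \<le> K * \<delta>)" for x S and K :: real
  have PD: "norm (\<iota> (lmul d x) - J d (r x)) \<le> K * \<delta>"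
    if "P x S K" "d \<in> C1" "0 \<le> \<delta>" "\<And>c. c \<in> S \<Longrightarrow> norm (c * d - f1 c *\<^sub>C d) \<le> \<delta>" for x S K d \<delta>
    using that unfolding P_def by blast
  have "\<exists>S K. P x S K"
    using x unfolding alg_tensor_set_def
  proof (induction rule: complex_vector.span_induct_alt)
    case base
    have "P 0 {} 0" by (simp add: P_def clinear_simps[OF lmul(1)] clinear_simps[OF r(1)] \<iota>_lin J_lin)
    then show ?case by blast
  next
    case (step k t x)
    then obtain c b where t: "t = c \<otimes> b" "c \<in> C1" by blast
    from step obtain S K where SK: "P x S K" by blast
    have "norm (\<iota> (lmul d (k *\<^sub>C t + x)) - J d (r (k *\<^sub>C t + x))) \<le> (cmod k * norm b + K) * \<delta>"
      if d: "d \<in> C1" and \<delta>: "\<forall>c\<in>insert c S. norm (c * d - f1 c *\<^sub>C d) \<le> \<delta>" "0 \<le> \<delta>" for d \<delta>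
    proof -
      have dc: "d * c = c * d" using C1(2) d t(2) unfolding abelian_def by blast
      have "\<iota> (lmul d (k *\<^sub>C t + x)) - J d (r (k *\<^sub>C t + x)) =
          k *\<^sub>C J (c * d - f1 c *\<^sub>C d) b + (\<iota> (lmul d x) - J d (r x))"
        by (simp add: t(1) clinear_simps[OF lmul(1)] clinear_simps[OF r(1)] \<iota>_lin J_lin lmul(2) r(2) g1[OF t(2)] scaleC_diff
            dc flip: J_def)
      also have "norm \<dots> \<le> norm (k *\<^sub>C J (c * d - f1 c *\<^sub>C d) b) + norm (\<iota> (lmul d x) - J d (r x))"
        by (rule norm_triangle_ineq)
      also have "norm (k *\<^sub>C J (c * d - f1 c *\<^sub>C d) b) = cmod k * (norm (c * d - f1 c *\<^sub>C d) * norm b)"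
        by (simp add: norm_scaleC norm_J)
      also have "\<dots> \<le> cmod k * (\<delta> * norm b)"
        using \<delta> by (intro mult_left_mono mult_right_mono) auto
      also have "norm (\<iota> (lmul d x) - J d (r x)) \<le> K * \<delta>"
        using \<delta> by (intro PD[OF SK d]) auto
      finally show ?thesis by (simp add: algebra_simps)
    qed
    then have "P (k *\<^sub>C t + x) (insert c S) (cmod k * norm b + K)"
      using SK t unfolding P_def by simp
    then show ?case by blast
  qed
  then obtain S K where SK: "P x S K" by blast
  then have S: "finite S" "S \<subseteq> C1" and K: "0 \<le> K" by (auto simp: P_def)
  show ?thesis
  proof (rule field_le_epsilon)
    fix \<epsilon> :: real assume e: "\<epsilon> > 0"
    define \<eta> where "\<eta> = \<epsilon> / (K + norm (\<iota> x) + 1)"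
    have pos: "0 < K + norm (\<iota> x) + 1" using K by (simp add: add_nonneg_pos)
    then have \<eta>: "\<eta> > 0" using e by (simp add: \<eta>_def)
    obtain d where d: "d \<in> C1" "f1 d = 1" "norm d \<le> 1 + \<eta>" "\<And>c. c \<in> S \<Longrightarrow> norm (c * d - f1 c *\<^sub>C d) \<le> \<eta>"
      using localizing_element[OF C1 f1 S \<eta> \<eta>] by blast
    have "1 \<le> norm d" using quasi_stateD(3)[OF q d(1)] d(2) by simp
    then have "norm (r x) \<le> norm d * norm (r x)" using mult_right_mono[of 1 "norm d" "norm (r x)"] by simp
    also have "\<dots> = norm (\<iota> (lmul d x) - (\<iota> (lmul d x) - J d (r x)))" by (simp add: norm_J)
    also have "\<dots> \<le> norm (\<iota> (lmul d x)) + norm (\<iota> (lmul d x) - J d (r x))" by (rule norm_triangle_ineq4)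
    also have "\<dots> \<le> norm d * norm (\<iota> x) + K * \<eta>"
      using norm_lmul[of d x] PD[OF SK d(1) _ d(4)] \<eta> by (intro add_mono) auto
    also have "\<dots> \<le> (1 + \<eta>) * norm (\<iota> x) + K * \<eta>" using d(3) by (intro add_right_mono mult_right_mono) auto
    also have "\<dots> \<le> norm (\<iota> x) + \<eta> * (K + norm (\<iota> x) + 1)" using \<eta> by (simp add: algebra_simps)
    also have "\<dots> = norm (\<iota> x) + \<epsilon>" using pos by (simp add: \<eta>_def)
    finally show "norm (r x) \<le> norm (\<iota> x) + \<epsilon>" .
  qed
qed

end

context cstar_tensor
begin

lemma functional_on_image:
  assumes G: "clinear G" and h: "clinear h" and r: "clinear r" "\<And>a b. r (a \<otimes> b) = g a *\<^sub>C b"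
    and prod: "\<And>a b. G (J a b) = g a * h b"
  shows "G (\<iota> x) = h (r x)"
  by (induction x rule: tensor_induct)
    (simp_all add: \<iota>_lin clinearD[OF G] clinearD[OF h] clinear_simps[OF r(1)] r(2) prod flip: J_def)

text \<open>Hahn-Banach yields only a contractive extension. It is positive because elementary
  tensors \<open>y = J c b\<close> with nearly norming \<open>c\<close> and \<open>b\<close> bring
  \<open>G (star y * y)\<close> close to 1.\<close>

lemma product_state:
  assumes C1: "cstar_subalgebra C1" "abelian C1" and f1: "character_on C1 f1" "z \<in> C1" "f1 z \<noteq> 0"
    and h: "state_on UNIV h"
  obtains G where "quasi_state_on UNIV G" "\<And>c b. c \<in> C1 \<Longrightarrow> G (J c b) = f1 c * h b"
proof -
  note cl1 = cstar_subalgebraD[OF C1(1)]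
  have qf: "quasi_state_on C1 f1" by (rule character_quasi_state[OF C1(1) f1(1)])
  have qh: "quasi_state_on UNIV h" by (rule state_onD(1)[OF cstar_subalgebra_UNIV h])
  note hlin = clinearD[OF quasi_state_clinear[OF qh]]
  obtain g1 where g1: "quasi_state_on UNIV g1" "\<And>x. x \<in> C1 \<Longrightarrow> g1 x = f1 x"
    using quasi_state_extension[OF C1(1) qf] by blast
  obtain r where r: "clinear r" "\<And>a b. r (a \<otimes> b :: 'a \<odot> 'b) = g1 a *\<^sub>C b"
    using slice[OF quasi_state_clinear[OF g1(1)]] by blast
  note rlin = clinear_simps[OF r(1)]
  define A :: "('a \<odot> 'b) set" where "A = alg_tensor_set C1 UNIV"
  have A: "csubspace A" unfolding A_def alg_tensor_set_def by (rule complex_vector.subspace_span)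
  have "inj \<iota>"
  proof (rule injI)
    fix x y assume "\<iota> x = \<iota> y"
    then have "\<iota> (x - y) = 0" by (simp add: \<iota>_lin)
    then show "x = y" by (simp add: \<iota>_eq_0)
  qed
  define F where "F v = h (r (inv \<iota> v))" for v
  have F: "F (\<iota> x) = h (r x)" for x by (simp add: F_def inv_f_f[OF \<open>inj \<iota>\<close>])
  have V: "csubspace (\<iota> ` A)" unfolding A_def \<iota>_image_alg_tensor by (rule complex_vector.subspace_span)
  have "linear_functional_on (\<iota> ` A) F"
    unfolding linear_functional_on_def
  proof (intro conjI ballI allI)
    fix u v c assume "u \<in> \<iota> ` A" "v \<in> \<iota> ` A"
    then obtain x y where u: "u = \<iota> x" and v: "v = \<iota> y" by blast
    have "F (\<iota> (x + y)) = F (\<iota> x) + F (\<iota> y)" unfolding F by (simp add: rlin hlin)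
    then show "F (u + v) = F u + F v" by (simp add: u v \<iota>_lin)
    have "F (\<iota> (c *\<^sub>C x)) = c * F (\<iota> x)" unfolding F by (simp add: rlin hlin)
    then show "F (c *\<^sub>C u) = c * F u" by (simp add: u \<iota>_lin)
  qed
  moreover have "cmod (F v) \<le> norm v" if "v \<in> \<iota> ` A" for v
  proof -
    obtain x where x: "v = \<iota> x" "x \<in> A" using \<open>v \<in> \<iota> ` A\<close> by blast
    have "cmod (F v) \<le> norm (r x)" using quasi_stateD(3)[OF qh UNIV_I] by (simp add: x F)
    also have "\<dots> \<le> norm v"
      unfolding x(1) by (rule slice_bound_character[OF C1 f1 _ r]) (use g1(2) x(2) in \<open>auto simp: A_def\<close>)
    finally show ?thesis .
  qed
  ultimately obtain G where G: "clinear G" "\<And>v. v \<in> \<iota> ` A \<Longrightarrow> G v = F v" "\<And>v. cmod (G v) \<le> norm v"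
    using hahn_banach[OF V] by blast
  have GJ: "G (J c b) = f1 c * h b" if c: "c \<in> C1" for c b
  proof -
    have "c \<otimes> b \<in> A" unfolding A_def alg_tensor_set_def by (rule complex_vector.span_base) (use c in blast)
    then show ?thesis using G(2)[of "J c b"] c by (simp add: J_def F r(2) hlin g1)
  qed
  have "quasi_state_on UNIV G"
  proof (rule contractive_functional_positive[OF G(1,3)])
    fix \<epsilon> :: real assume e: "\<epsilon> > 0"
    \<comment> \<open>\<open>G (star y * y)\<close> will be at least
      \<open>(1 - \<delta>) ^ 4 \<ge> 1 - 4 * \<delta>\<close>; the cap \<open>1 / 2\<close> keeps
      \<open>1 - \<delta>\<close> positive for squaring.\<close>
    define \<delta> where "\<delta> = min (\<epsilon> / 5) (1 / 2)"
    have \<delta>: "0 < \<delta>" "\<delta> < 1" "4 * \<delta> < \<epsilon>" using e by (auto simp: \<delta>_def)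
    obtain c where c: "c \<in> C1" "norm c \<le> 1" "1 - \<delta> < cmod (f1 c)"
      using state_onD(2)[OF C1(1) pure_stateD(1)[OF C1(1) character_pure_state[OF C1(1) f1]] \<delta>(1)] by blast
    obtain b where b: "norm b \<le> 1" "1 - \<delta> < cmod (h b)"
      using state_onD(2)[OF cstar_subalgebra_UNIV h \<delta>(1)] by blast
    define s where "s = Re (h (star b * b))"
    have hs: "h (star b * b) = of_real s"
      unfolding s_def by (rule quasi_state_square_real(1)[OF qh UNIV_I])
    have s1: "(cmod (h b))\<^sup>2 \<le> s" unfolding s_def by (rule quasi_state_star(2)[OF cstar_subalgebra_UNIV qh UNIV_I])
    have "s \<le> cmod (h (star b * b))" by (simp add: hs)
    also have "\<dots> \<le> norm (star b * b)" by (rule quasi_stateD(3)[OF qh UNIV_I])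
    also have "\<dots> \<le> 1" using b by (simp add: cstar_identity power_le_one)
    finally have s2: "s \<le> 1" .
    have fc: "cmod (f1 c) \<le> 1" using quasi_stateD(3)[OF qf c(1)] c(2) by simp
    define v where "v = (cmod (f1 c))\<^sup>2 * s"
    have "star c * c \<in> C1" using c cl1 by simp
    moreover have "f1 (star c * c) = of_real ((cmod (f1 c))\<^sup>2)"
      using f1(1) c cl1 quasi_state_star(1)[OF C1(1) qf c(1)] by (simp add: character_on_def cnj_mult_self)
    ultimately have Gv: "G (star (J c b) * J c b) = of_real v"
      by (simp add: J_star J_mult GJ hs v_def)
    have "1 - 4 * \<delta> \<le> (1 - \<delta>) ^ 4"
      using Bernoulli_inequality[of "- \<delta>" 4] \<delta> by simp
    also have "\<dots> = (1 - \<delta>)\<^sup>2 * (1 - \<delta>)\<^sup>2" by (simp flip: power_add)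
    also have "\<dots> \<le> (cmod (f1 c))\<^sup>2 * s"
    proof (rule mult_mono)
      show "(1 - \<delta>)\<^sup>2 \<le> (cmod (f1 c))\<^sup>2" using c \<delta> by (intro power_mono) auto
      have "(1 - \<delta>)\<^sup>2 \<le> (cmod (h b))\<^sup>2" using b \<delta> by (intro power_mono) auto
      then show "(1 - \<delta>)\<^sup>2 \<le> s" using s1 by simp
    qed auto
    finally have v1: "1 - 4 * \<delta> \<le> v" by (simp add: v_def)
    have "0 \<le> s" using s1 zero_le_power2[of "cmod (h b)"] by linarith
    then have v2: "v \<le> 1"
      unfolding v_def using fc s2 mult_mono[of "(cmod (f1 c))\<^sup>2" 1 s 1] by (simp add: power_le_one)
    have "cmod (G (star (J c b) * J c b) - 1) = cmod (of_real (v - 1))" by (simp add: Gv)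
    also have "\<dots> = \<bar>v - 1\<bar>" by (rule norm_of_real)
    also have "\<dots> < \<epsilon>" using v1 v2 \<delta> by simp
    finally show "\<exists>y. norm y \<le> 1 \<and> cmod (G (star y * y) - 1) < \<epsilon>"
      using b c by (intro exI[of _ "J c b"]) (auto simp: norm_J mult_le_one)
  qed
  then show ?thesis using that GJ by blast
qed

text \<open>Let \<open>h\<close> norm \<open>y = r x\<close> and let \<open>G\<close> extend the
  product of \<open>f1\<close> and \<open>h\<close>; then \<open>G (\<iota> v) = h (r v)\<close> for
  all \<open>v\<close>. As \<open>h\<close> is known to attain the norm at \<open>star y * y\<close>
  only, this is used for \<open>v = rmul (star y) x\<close>, whose slice is
  \<open>star y * y\<close>.\<close>

lemma slice_contractive:
  assumes M1: "masa C1" and EP: "extension_property C1" and f1: "pure_state_on C1 f1"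
    and g1: "quasi_state_on UNIV g1" "\<And>x. x \<in> C1 \<Longrightarrow> g1 x = f1 x"
    and r: "clinear r" "\<And>a b. r (a \<otimes> b) = g1 a *\<^sub>C b"
  shows "norm (r x) \<le> norm (\<iota> x)"
proof (cases "r x = 0")
  case False
  note C1 = masa_subalgebra[OF M1]
  obtain z where z: "z \<in> C1" "f1 z \<noteq> 0" using pure_state_nonzero[OF C1 f1] .
  define y where "y = r x"
  obtain h where h: "pure_state_on UNIV h" "h (star y * y) = of_real ((norm y)\<^sup>2)"
    using norming_pure_state[OF cstar_subalgebra_UNIV UNIV_I, of y] False y_def by auto
  note sh = pure_stateD[OF cstar_subalgebra_UNIV h(1)]
  obtain G where G: "quasi_state_on UNIV G" "\<And>c b. c \<in> C1 \<Longrightarrow> G (J c b) = f1 c * h b"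
    using product_state[OF C1 masa_abelian[OF M1] pure_state_character[OF C1 masa_abelian[OF M1] f1] z sh(1)] by blast
  have "G (J a b) = g1 a * h b" for a b by (rule extension_is_product[OF M1 EP f1 g1 G])
  then have Gr: "G (\<iota> x) = h (r x)" for x
    by (rule functional_on_image[OF quasi_state_clinear[OF G(1)] quasi_state_clinear[OF sh(2)] r])
  have rr: "r (rmul b x) = b * r x" for b x
    by (induction x rule: tensor_induct)
      (simp_all add: clinear_simps[OF rmul(1)] rmul(2) clinear_simps[OF r(1)] r(2) distrib_left mult_scaleC_right)
  have "(norm y)\<^sup>2 = cmod (h (star y * y))" by (simp add: h(2) norm_power)
  also have "h (star y * y) = G (\<iota> (rmul (star y) x))" by (simp add: Gr rr y_def)
  also have "cmod (G (\<iota> (rmul (star y) x))) \<le> norm (\<iota> (rmul (star y) x))" by (rule quasi_stateD(3)[OF G(1) UNIV_I])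
  also have "\<dots> \<le> norm y * norm (\<iota> x)" using norm_rmul[of "star y" x] by simp
  finally show ?thesis using False by (simp add: y_def power2_eq_square)
qed simp

text \<open>\<open>\<rho>\<close> is the slice of \<open>t\<close>, a limit of
  \<open>r (X n)\<close> that exists by contractivity and does not depend on \<open>G\<close> and
  \<open>h\<close>. Since \<open>c0\<close> is in the multiplicative domain of \<open>g1\<close>
  with value 1, slicing turns multiplication by \<open>c0 \<otimes> e\<close> into multiplication by
  \<open>e\<close>, and commutation passes to the limit.\<close>

lemma product_functional_slice:
  assumes M1: "masa C1" and EP: "extension_property C1" and f1: "pure_state_on C1 f1"
    and M2: "masa C2" and t: "\<And>s. s \<in> T C1 C2 \<Longrightarrow> t * s = s * t"
  obtains \<rho> where "\<rho> \<in> C2"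
    "\<And>G h. quasi_state_on UNIV G \<Longrightarrow> quasi_state_on UNIV h \<Longrightarrow>
      (\<And>c b. c \<in> C1 \<Longrightarrow> G (J c b) = f1 c * h b) \<Longrightarrow> G t = h \<rho>"
proof -
  note C1 = masa_subalgebra[OF M1]
  note cl1 = cstar_subalgebraD[OF C1]
  have char: "character_on C1 f1" by (rule pure_state_character[OF C1 masa_abelian[OF M1] f1])
  obtain g1 where g1: "quasi_state_on UNIV g1" "\<And>x. x \<in> C1 \<Longrightarrow> g1 x = f1 x"
    using quasi_state_extension[OF C1 pure_stateD(2)[OF C1 f1]] by blast
  obtain z where z: "z \<in> C1" "f1 z \<noteq> 0" using pure_state_nonzero[OF C1 f1] .
  obtain c0 where c0: "c0 \<in> C1" "star c0 = c0" "f1 c0 = 1" using character_normalized[OF C1 char z] .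
  have "g1 (c0 * star c0) = g1 c0 * cnj (g1 c0)"
    using c0 cl1 char by (simp add: g1 character_on_def)
  then have md: "g1 (c0 * a) = g1 a" for a
    using quasi_state_multiplicative_domain[OF cstar_subalgebra_UNIV g1(1) UNIV_I UNIV_I] g1 c0 by simp
  have md': "g1 (a * c0) = g1 a" for a
    using md[of "star a"] quasi_state_star(1)[OF cstar_subalgebra_UNIV g1(1) UNIV_I, of "a * c0"]
      quasi_state_star(1)[OF cstar_subalgebra_UNIV g1(1) UNIV_I, of a] by (simp add: star_simps c0)
  obtain r where r: "clinear r" "\<And>a b. r (a \<otimes> b :: 'a \<odot> 'b) = g1 a *\<^sub>C b"
    using slice[OF quasi_state_clinear[OF g1(1)]] by blast
  note rlin = clinear_simps[OF r(1)]
  have contr: "norm (r x) \<le> norm (\<iota> x)" for x by (rule slice_contractive[OF M1 EP f1 g1 r])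
  have "t \<in> closure (range \<iota>)" using \<iota>(5) by simp
  then obtain u where u: "\<And>n. u n \<in> range \<iota>" "u \<longlonglongrightarrow> t" unfolding closure_sequential by blast
  then have "\<forall>n. \<exists>x. u n = \<iota> x" by blast
  then obtain X where X: "\<And>n. u n = \<iota> (X n)" by metis
  have Xt: "(\<lambda>n. \<iota> (X n)) \<longlonglongrightarrow> t" using u(2) unfolding X .
  have "Cauchy (\<lambda>n. r (X n))"
  proof (rule CauchyI)
    fix e :: real assume "e > 0"
    then obtain N where N: "\<And>m n. m \<ge> N \<Longrightarrow> n \<ge> N \<Longrightarrow> norm (\<iota> (X m) - \<iota> (X n)) < e"
      using CauchyD[OF LIMSEQ_imp_Cauchy[OF Xt]] by blast
    have "norm (r (X m) - r (X n)) < e" if "m \<ge> N" "n \<ge> N" for m n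
      using contr[of "X m - X n"] N[OF that] by (simp add: rlin \<iota>_lin)
    then show "\<exists>M. \<forall>m\<ge>M. \<forall>n\<ge>M. norm (r (X m) - r (X n)) < e" by blast
  qed
  then obtain \<rho> where \<rho>: "(\<lambda>n. r (X n)) \<longlonglongrightarrow> \<rho>"
    using Cauchy_convergent_iff convergent_def by blast
  have "\<rho> * e = e * \<rho>" if e: "e \<in> C2" for e
  proof -
    have r1: "r (x * (c0 \<otimes> e)) = r x * e" and r2: "r ((c0 \<otimes> e) * x) = e * r x" for x
      by (induction x rule: tensor_induct)
        (simp_all add: rlin r(2) distrib_left distrib_right tensor_elem_mult md md' mult_scaleC_left mult_scaleC_right)
    have "(\<lambda>n. \<iota> (X n) * J c0 e - J c0 e * \<iota> (X n)) \<longlonglongrightarrow> t * J c0 e - J c0 e * t"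
      by (intro tendsto_intros Xt)
    then have "(\<lambda>n. norm (\<iota> (X n) * J c0 e - J c0 e * \<iota> (X n))) \<longlonglongrightarrow> 0"
      using t[OF J_in_T[OF c0(1) e]] tendsto_norm_zero by fastforce
    then have "(\<lambda>n. r (X n) * e - e * r (X n)) \<longlonglongrightarrow> 0"
    proof (rule Lim_null_comparison[rotated], intro always_eventually allI)
      fix n
      have "norm (r (X n * (c0 \<otimes> e) - (c0 \<otimes> e) * X n)) \<le> norm (\<iota> (X n * (c0 \<otimes> e) - (c0 \<otimes> e) * X n))"
        by (rule contr)
      then show "norm (r (X n) * e - e * r (X n)) \<le> norm (\<iota> (X n) * J c0 e - J c0 e * \<iota> (X n))"
        by (simp add: rlin r1 r2 \<iota>_lin \<iota>(2) J_def)
    qed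
    moreover have "(\<lambda>n. r (X n) * e - e * r (X n)) \<longlonglongrightarrow> \<rho> * e - e * \<rho>" by (intro tendsto_intros \<rho>)
    ultimately show ?thesis using LIMSEQ_unique by fastforce
  qed
  then have "\<rho> \<in> C2" by (rule masa_commutant[OF M2])
  moreover have "G t = h \<rho>" if G: "quasi_state_on UNIV G" and h: "quasi_state_on UNIV h"
    and prod: "\<And>c b. c \<in> C1 \<Longrightarrow> G (J c b) = f1 c * h b" for G h
  proof -
    have bl: "bounded_linear k" if k: "quasi_state_on UNIV k" for k :: "'z::cstar_algebra \<Rightarrow> complex"
      by (rule bounded_linear_intro[of _ 1])
        (use quasi_stateD(3)[OF k UNIV_I] in \<open>auto simp: clinearD[OF quasi_state_clinear[OF k]] scaleR_conv_of_real\<close>)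
    have "G (J a b) = g1 a * h b" for a b by (rule extension_is_product[OF M1 EP f1 g1 G prod])
    then have Gr: "G (\<iota> x) = h (r x)" for x
      by (rule functional_on_image[OF quasi_state_clinear[OF G] quasi_state_clinear[OF h] r])
    have "(\<lambda>n. G (\<iota> (X n))) \<longlonglongrightarrow> G t" by (rule bounded_linear.tendsto[OF bl[OF G] Xt])
    moreover have "(\<lambda>n. G (\<iota> (X n))) \<longlonglongrightarrow> h \<rho>" unfolding Gr by (rule bounded_linear.tendsto[OF bl[OF h] \<rho>])
    ultimately show ?thesis by (rule LIMSEQ_unique)
  qed
  ultimately show ?thesis using that by blast
qed

section \<open>Maximality and the extension property for the tensor product\<close>

theorem masa_T:
  assumes M1: "masa C1" and EP: "extension_property C1" and M2: "masa C2" and Z2: "no_state_vanishes_on C2"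
  shows "masa (T C1 C2)"
  unfolding masa_def
proof (intro conjI allI impI)
  note C1 = masa_subalgebra[OF M1] masa_abelian[OF M1] and C2 = masa_subalgebra[OF M2] masa_abelian[OF M2]
  show T: "cstar_subalgebra (T C1 C2)" by (rule T_subalgebra[OF C1(1) C2(1)])
  show "abelian (T C1 C2)" by (rule T_abelian[OF C1(2) C2(2)])
  have Z1: "no_state_vanishes_on C1"
    unfolding no_state_vanishes_on_def using extension_property_vanish[OF M1 EP] by blast
  fix B assume B: "cstar_subalgebra B \<and> abelian B \<and> T C1 C2 \<subseteq> B"
  then have sub: "T C1 C2 \<subseteq> B" by blast
  show "B = T C1 C2"
  proof (rule stone_weierstrass_abelian)
    fix q q' t
    assume q: "character_on B q" and q': "character_on B q'"
      and eq: "\<And>x. x \<in> T C1 C2 \<Longrightarrow> q x = q' x" and t: "t \<in> B"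
    obtain G where G: "quasi_state_on UNIV G" "\<And>x. x \<in> B \<Longrightarrow> G x = q x"
      using quasi_state_extension[OF _ character_quasi_state[OF _ q]] B by blast
    obtain G' where G': "quasi_state_on UNIV G'" "\<And>x. x \<in> B \<Longrightarrow> G' x = q' x"
      using quasi_state_extension[OF _ character_quasi_state[OF _ q']] B by blast
    have GT: "G x = q x" "G' x = q x" if "x \<in> T C1 C2" for x using that G G' eq sub by auto
    show "q t = q' t"
    \<comment> \<open>Factorization needs a nonzero value on \<open>T C1 C2\<close>. If there is
      none, nondegeneracy of both factors makes the two functionals vanish altogether.\<close>
    proof (cases "\<forall>x\<in>T C1 C2. q x = 0")
      case True
      have "G t = 0" by (rule vanishing_extension[OF Z1 C2(1) Z2 G(1)]) (use True GT J_in_T in auto)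
      moreover have "G' t = 0" by (rule vanishing_extension[OF Z1 C2(1) Z2 G'(1)]) (use True GT J_in_T in auto)
      ultimately show ?thesis using G(2) G'(2) t by simp
    next
      case False
      then obtain w where w: "w \<in> T C1 C2" "q w \<noteq> 0" by blast
      have "character_on (T C1 C2) q"
        using q sub by (simp add: character_on_def linear_functional_on_def subset_iff)
      from character_factors[OF C1 C2 this w]
      obtain f1 f2 c0 e0 where f: "character_on C1 f1" "character_on C2 f2" "c0 \<in> C1" "f1 c0 \<noteq> 0" "e0 \<in> C2" "f2 e0 \<noteq> 0"
        "\<And>c e. c \<in> C1 \<Longrightarrow> e \<in> C2 \<Longrightarrow> q (J c e) = f1 c * f2 e" by metis
      have prod: "G (J c e) = f1 c * f2 e" "G' (J c e) = f1 c * f2 e" if "c \<in> C1" "e \<in> C2" for c e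
        using that f(7) GT J_in_T by simp_all
      obtain h where h: "quasi_state_on UNIV h" "\<And>e. e \<in> C2 \<Longrightarrow> h e = f2 e" "\<And>c b. c \<in> C1 \<Longrightarrow> G (J c b) = f1 c * h b"
        using second_factor[OF C1 C2 f(1,3,4) f(2,5,6) G(1) prod(1)] by metis
      obtain h' where h': "quasi_state_on UNIV h'" "\<And>e. e \<in> C2 \<Longrightarrow> h' e = f2 e" "\<And>c b. c \<in> C1 \<Longrightarrow> G' (J c b) = f1 c * h' b"
        using second_factor[OF C1 C2 f(1,3,4) f(2,5,6) G'(1) prod(2)] by metis
      have "t * s = s * t" if "s \<in> T C1 C2" for s
        using B t that unfolding abelian_def by blast
      from product_functional_slice[OF M1 EP character_pure_state[OF C1(1) f(1,3,4)] M2 this]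
      obtain \<rho> where \<rho>: "\<rho> \<in> C2" "G t = h \<rho>" "G' t = h' \<rho>" using G(1) G'(1) h(1,3) h'(1,3) by metis
      then show ?thesis using G(2) G'(2) t h(2) h'(2) by simp
    qed
  qed (use B T in auto)
qed

text \<open>If the first algebra were 0, the tensor product would be 0 and have the extension
  property vacuously for any \<open>C2\<close>; \<open>ne\<close> excludes this and provides a pure
  state \<open>f1\<close> of \<open>C1\<close>. Two extensions of \<open>f2\<close> then give two
  extensions of one product character; these are equal, and \<open>f1 c0\<close> can be
  cancelled.\<close>

theorem extension_property_T:
  assumes ne: "\<exists>x::'a. x \<noteq> 0" and M1: "masa C1" and EP: "extension_property C1"
    and M2: "masa C2" and Z2: "no_state_vanishes_on C2"
  shows "extension_property (T C1 C2) \<longleftrightarrow> extension_property C2"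
proof
  note C1 = masa_subalgebra[OF M1] masa_abelian[OF M1] and C2 = masa_subalgebra[OF M2] masa_abelian[OF M2]
  note T = T_subalgebra[OF C1(1) C2(1)] T_abelian[OF C1(2) C2(2)]
  have Z1: "no_state_vanishes_on C1"
    unfolding no_state_vanishes_on_def using extension_property_vanish[OF M1 EP] by blast
  {
    assume EP2: "extension_property C2"
    show "extension_property (T C1 C2)"
    proof (rule extension_propertyI[OF T(1)])
      fix G x assume "quasi_state_on UNIV G" "\<And>x. x \<in> T C1 C2 \<Longrightarrow> G x = 0"
      then show "G x = 0" using vanishing_extension[OF Z1 C2(1) Z2] J_in_T by blast
    next
      fix F G G' assume F: "pure_state_on (T C1 C2) F" and G: "quasi_state_on UNIV G" and G': "quasi_state_on UNIV G'"
        and GF: "\<And>x. x \<in> T C1 C2 \<Longrightarrow> G x = F x" and G'F: "\<And>x. x \<in> T C1 C2 \<Longrightarrow> G' x = F x"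
      obtain w where w: "w \<in> T C1 C2" "F w \<noteq> 0" using pure_state_nonzero[OF T(1) F] .
      from character_factors[OF C1 C2 pure_state_character[OF T F] w]
      obtain f1 f2 c0 e0 where f: "character_on C1 f1" "character_on C2 f2" "c0 \<in> C1" "f1 c0 \<noteq> 0" "e0 \<in> C2" "f2 e0 \<noteq> 0"
        "\<And>c e. c \<in> C1 \<Longrightarrow> e \<in> C2 \<Longrightarrow> F (J c e) = f1 c * f2 e" by metis
      have prod: "G (J c e) = f1 c * f2 e" "G' (J c e) = f1 c * f2 e" if "c \<in> C1" "e \<in> C2" for c e
        using that f(7) GF G'F J_in_T by simp_all
      obtain h where h: "quasi_state_on UNIV h" "\<And>e. e \<in> C2 \<Longrightarrow> h e = f2 e" "\<And>c b. c \<in> C1 \<Longrightarrow> G (J c b) = f1 c * h b"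
        using second_factor[OF C1 C2 f(1,3,4) f(2,5,6) G prod(1)] by metis
      obtain h' where h': "quasi_state_on UNIV h'" "\<And>e. e \<in> C2 \<Longrightarrow> h' e = f2 e" "\<And>c b. c \<in> C1 \<Longrightarrow> G' (J c b) = f1 c * h' b"
        using second_factor[OF C1 C2 f(1,3,4) f(2,5,6) G' prod(2)] by metis
      have "h = h'"
        by (rule extension_property_unique[OF C2(1) EP2 character_pure_state[OF C2(1) f(2,5,6)] h(1,2) h'(1,2)])
      have p1: "pure_state_on C1 f1" by (rule character_pure_state[OF C1(1) f(1,3,4)])
      obtain g1 where g1: "quasi_state_on UNIV g1" "\<And>x. x \<in> C1 \<Longrightarrow> g1 x = f1 x"
        using quasi_state_extension[OF C1(1) pure_stateD(2)[OF C1(1) p1]] by blast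
      have "G (J a b) = G' (J a b)" for a b
        using extension_is_product[OF M1 EP p1 g1 G h(3)] extension_is_product[OF M1 EP p1 g1 G' h'(3)] \<open>h = h'\<close> by simp
      then have "G x = G' x" for x
        using functional_eqI[OF G G', of UNIV UNIV x] by (simp add: T_UNIV)
      then show "G = G'" by blast
    qed
  }
  assume EPT: "extension_property (T C1 C2)"
  show "extension_property C2"
  proof (rule extension_propertyI[OF C2(1)])
    fix g x assume "quasi_state_on UNIV g" "\<And>x. x \<in> C2 \<Longrightarrow> g x = 0"
    then show "g x = 0" using Z2 unfolding no_state_vanishes_on_def by blast
  next
    fix f2 g g' assume f2: "pure_state_on C2 f2" and g: "quasi_state_on UNIV g" and g': "quasi_state_on UNIV g'"
      and gf: "\<And>x. x \<in> C2 \<Longrightarrow> g x = f2 x" and g'f: "\<And>x. x \<in> C2 \<Longrightarrow> g' x = f2 x"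
    have ch2: "character_on C2 f2" by (rule pure_state_character[OF C2 f2])
    have st: "state_on UNIV g" "state_on UNIV g'"
      using state_on_extends[OF C2(1) pure_stateD(1)[OF C2(1) f2] cstar_subalgebra_UNIV _ g gf]
        state_on_extends[OF C2(1) pure_stateD(1)[OF C2(1) f2] cstar_subalgebra_UNIV _ g' g'f] by auto
    obtain x0 where x0: "x0 \<in> C1" "x0 \<noteq> 0"
    proof (rule ccontr)
      assume "\<not> thesis"
      then have "\<forall>c\<in>C1. c = 0" using that by blast
      then have "y \<in> C1" for y by (intro masa_commutant[OF M1]) auto
      then show False using ne \<open>\<forall>c\<in>C1. c = 0\<close> by blast
    qed
    obtain f1 where f1: "pure_state_on C1 f1" using norming_pure_state[OF C1(1) x0] by blast
    have ch1: "character_on C1 f1" by (rule pure_state_character[OF C1 f1])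
    obtain c0 where c0: "c0 \<in> C1" "f1 c0 \<noteq> 0" using pure_state_nonzero[OF C1(1) f1] .
    obtain e0 where e0: "e0 \<in> C2" "f2 e0 \<noteq> 0" using pure_state_nonzero[OF C2(1) f2] .
    obtain G where G: "quasi_state_on UNIV G" "\<And>c b. c \<in> C1 \<Longrightarrow> G (J c b) = f1 c * g b"
      using product_state[OF C1 ch1 c0 st(1)] by metis
    obtain G' where G': "quasi_state_on UNIV G'" "\<And>c b. c \<in> C1 \<Longrightarrow> G' (J c b) = f1 c * g' b"
      using product_state[OF C1 ch1 c0 st(2)] by metis
    have eqT: "G' x = G x" if "x \<in> T C1 C2" for x
      by (rule functional_eqI[OF G'(1) G(1) _ that]) (simp add: G G' gf g'f)
    have md: "G (J c e * y) = G (J c e) * G y" if c: "c \<in> C1" and e: "e \<in> C2" for c e y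
    proof (rule quasi_state_multiplicative_domain[OF cstar_subalgebra_UNIV G(1) UNIV_I UNIV_I])
      show "G (J c e * star (J c e)) = G (J c e) * cnj (G (J c e))"
        using c e cstar_subalgebraD[OF C1(1)] cstar_subalgebraD[OF C2(1)] ch1 ch2
          quasi_state_star(1)[OF C1(1) character_quasi_state[OF C1(1) ch1] c]
          quasi_state_star(1)[OF C2(1) character_quasi_state[OF C2(1) ch2] e]
        by (simp add: J_star J_mult G gf character_on_def)
    qed
    note Glin = clinearD[OF quasi_state_clinear[OF G(1)]]
    \<comment> \<open>On elementary tensors this is \<open>md\<close>; both sides are linear and
      bounded in \<open>x\<close>, so it persists on the closure and makes \<open>G\<close> a
      character of \<open>T C1 C2\<close>.\<close>
    have mult: "G (x * y) = G x * G y" if x: "x \<in> T C1 C2" for x y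
    proof -
      have "G (x * y) - G x * G y = 0"
      proof (rule vanish_on_T[where d = "\<lambda>x. G (x * y) - G x * G y" and K = "2 * norm y", OF _ _ _ x])
        show "clinear (\<lambda>x. G (x * y) - G x * G y)"
          by (simp add: clinear_iff distrib_right mult_scaleC_left Glin scaleC_complex_def algebra_simps)
        show "cmod (G (x * y) - G x * G y) \<le> 2 * norm y * norm x" for x
        proof -
          have "cmod (G (x * y)) \<le> norm x * norm y"
            using order_trans[OF quasi_stateD(3)[OF G(1) UNIV_I] norm_mult_ineq] .
          moreover have "cmod (G x * G y) \<le> norm x * norm y"
            using quasi_stateD(3)[OF G(1) UNIV_I] by (simp add: norm_mult mult_mono)
          moreover have "2 * norm y * norm x = norm x * norm y + norm x * norm y" by simp
          ultimately show ?thesis using norm_triangle_ineq4[of "G (x * y)" "G x * G y"] by linarith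
        qed
      qed (simp add: md)
      then show ?thesis by simp
    qed
    have "character_on (T C1 C2) G"
      using mult quasi_stateD(1)[OF G(1)] by (simp add: character_on_def linear_functional_on_def)
    then have "pure_state_on (T C1 C2) G"
      using c0 e0 by (intro character_pure_state[OF T(1) _ J_in_T[OF c0(1) e0(1)]]) (auto simp: G gf)
    then have "G = G'" by (rule extension_property_unique[OF T(1) EPT _ G(1) _ G'(1) eqT]) simp
    then have "f1 c0 * g b = f1 c0 * g' b" for b using G(2)[OF c0(1)] G'(2)[OF c0(1)] by metis
    then show "g = g'" using c0(2) by auto
  qed
qed

end

theorem corollary3:
  fixes C\<^sub>1 :: "'a::cstar_algebra set" and C\<^sub>2 :: "'b::cstar_algebra set"
    and \<beta> :: "'a \<odot> 'b \<Rightarrow> real"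
    and \<iota> :: "'a \<odot> 'b \<Rightarrow> 'd::cstar_algebra"
  assumes "\<exists>x::'a. x \<noteq> 0"
    and "masa C\<^sub>1" and "masa C\<^sub>2"
    and "extension_property C\<^sub>1"
    and "\<not> unital TYPE('b) \<Longrightarrow> contains_approximate_identity C\<^sub>2"
    and "cstar_norm \<beta>"
    and "is_completion \<beta> \<iota>"
  shows "masa (closed_tensor_set \<iota> C\<^sub>1 C\<^sub>2)
    \<and> (extension_property (closed_tensor_set \<iota> C\<^sub>1 C\<^sub>2) \<longleftrightarrow> extension_property C\<^sub>2)"
proof -
  interpret cstar_tensor \<beta> \<iota> using assms(6,7) by unfold_locales
  \<comment> \<open>If the second algebra is unital, its unit commutes with \<open>C\<^sub>2\<close>
    and hence lies in it; otherwise the approximate identity is used.\<close>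
  have "no_state_vanishes_on C\<^sub>2"
    using assms(3,5) no_state_vanishes_unital no_state_vanishes_approximate_identity masa_subalgebra by blast
  then show ?thesis
    using masa_T[OF assms(2,4,3)] extension_property_T[OF assms(1,2,4,3)] by blast
qed

end
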